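(* Let $\mathbb{K}\in\{\mathbb{R},\mathbb{C}\}$ and let $A$ be a Mackey-complete continuous inverse algebra over $\mathbb{K}$ such that for each continuous seminorm $p$ on $A$, there exist a continuous seminorm $q$ on $A$ and $r>0$ (which may depend on $p$ and $q$) such that \[ \sum_{n=1}^\infty r^n\|\mu_n\|_{p,q}<\infty . \] Then the unit group $A^\times$ is a regular Lie group in Milnor's sense.
   Context: All locally convex spaces are Hausdorff. A locally convex, unital, associative topological algebra $A$ over $\mathbb{K}\in\{\mathbb{R},\mathbb{C}\}$ (multiplication $A\times A\to A$ jointly continuous) is called a continuous inverse algebra if its group $A^\times$ of invertible elements is open in $A$ and the inversion map $A^\times\to A$, $x\mapsto x^{-1}$ is continuous. Then $A^\times$, as an open subset of $A$, is a ($\mathbb{K}$-analytic) Lie group modelled on $A$; its tangent bundle is identified with $A^\times\times A$ and its Lie algebra with $A$. A locally convex space $E$ is Mackey-complete if every Lipschitz curve in $E$ admits a Riemann integral in $E$; equivalently, every Mackey-Cauchy sequence in $E$ converges, i.e. every sequence $(x_n)$ for which there are a bounded set $B\subseteq E$ and reals $r_{n,m}\ge 0$ with $x_n-x_m\in r_{n,m}B$ and $r_{n,m}\to 0$ as both $n,m\to\infty$. Here $\gamma\colon[0,1]\to E$ is a Lipschitz curve if $\{\frac{\gamma(t)-\gamma(s)}{t-s}: s\neq t\in[0,1]\}$ is bounded in $E$. For $n\in\mathbb{N}=\{1,2,\dots\}$, $\mu_n\colon A^n\to A$ is the $n$-linear map $\mu_n(x_1,\dots,x_n):=x_1x_2\cdots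 x_n$. For seminorms $p,q\colon A\to[0,\infty[$, \[ \|\mu_n\|_{p,q}:=\sup\{p(\mu_n(x_1,\dots,x_n)) : x_1,\dots,x_n\in A,\ q(x_j)\le 1 \text{ for all } j\}\in[0,\infty]. \] Smooth maps: for locally convex spaces $E,F$ (regarded as real spaces), $U\subseteq E$ open and $r\in\mathbb{N}_0\cup\{\infty\}$, a map $f\colon U\to F$ is $C^r$ if it is continuous, the iterated directional derivatives $d^{(k)}f(x,y_1,\dots,y_k):=(D_{y_k}\cdots D_{y_1}f)(x)$ exist for all $k\in\mathbb{N}$ with $k\le r$, $x\in U$, $y_1,\dots,y_k\in E$, and the maps $d^{(k)}f\colon U\times E^k\to F$ are continuous. Smooth means $C^\infty$. For a locally convex space $E$, $C^\infty([0,1],E)$ is the space of smooth curves $[0,1]\to E$ with the locally convex topology given by the seminorms $\|\gamma\|_{C^k,p}:=\max_{0\le j\le k}\max_{t\in[0,1]}p(\gamma^{(j)}(t))$, for $k\in\mathbb{N}_0$ and continuous seminorms $p$ on $E$. Regularity: let $G$ be a Lie group modelled on a locally convex space, with identity element $1$ and Lie algebra $\mathfrak{g}=T_1G$; for $g\in G$, $v\in T_1G$ let $gv:=T_1(\lambda_g)(v)$, where $\lambda_g(x)=gx$. For a continuous map $\gamma\colon[0,1]\to\mathfrak{g}$ there is at most one $C^1$-map $\eta\colon[0,1]\to G$ with $\eta(0)=1$ and $\eta'(t)=\eta(t)\gamma(t)$ for all $t\in[0,1]$; if it exists, $\eta_\gamma:=\eta$ is called the evolution of $\gamma$. (For $G=A^\times$,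 $\eta\colon[0,1]\to A^\times\subseteq A$ is a $C^1$-curve and $\eta(t)\gamma(t)$ is the product in $A$.) $G$ is called regular (in Milnor's sense) if each $\gamma\in C^\infty([0,1],\mathfrak{g})$ has an evolution $\eta_\gamma$ and the map $\operatorname{evol}\colon C^\infty([0,1],\mathfrak{g})\to G$, $\gamma\mapsto\eta_\gamma(1)$ is smooth. *)

theory Defs
  imports "HOL-Analysis.Analysis" "HOL-Algebra.Group" "HOL-Library.Extended_Nat"
begin

section \<open>The scalar field\<close>

text \<open>Up to isomorphism of normed fields, the instances are exactly the real and the complex numbers:
  the absolute value is the only multiplicative norm on them that extends the one of the reals.\<close>

class real_or_complex = real_normed_field +
  assumes real_or_complex:
    "(\<forall>z. \<exists>a. z = a *\<^sub>R 1) \<or>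
     (\<exists>i. i * i = - 1 \<and> (\<forall>z. \<exists>a b. z = a *\<^sub>R 1 + b *\<^sub>R i))"

instance real :: real_or_complex
  by standard auto

instance complex :: real_or_complex
proof
  have "z = Re z *\<^sub>R 1 + Im z *\<^sub>R \<i>" for z
    by (simp add: complex_eq_iff)
  then show "(\<forall>z::complex. \<exists>a. z = a *\<^sub>R 1) \<or>
     (\<exists>i::complex. i * i = - 1 \<and> (\<forall>z. \<exists>a b. z = a *\<^sub>R 1 + b *\<^sub>R i))"
    by (metis i_squared)
qed

section \<open>Locally convex spaces and continuous inverse algebras\<close>

class locally_convex_space = real_vector + topological_ab_group_add + t2_space +
  assumes tendsto_scaleR_Pair:
      "LIM x (nhds (a::real) \<times>\<^sub>F nhds b). fst x *\<^sub>R snd x :> nhds (a *\<^sub>R b)"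
    and locally_convex: "open U \<Longrightarrow> 0 \<in> U \<Longrightarrow>
      \<exists>V. open V \<and> 0 \<in> V \<and> V \<subseteq> U \<and>
        (\<forall>x\<in>V. \<forall>y\<in>V. \<forall>u\<ge>0. \<forall>v\<ge>0. u + v = 1 \<longrightarrow> u *\<^sub>R x + v *\<^sub>R y \<in> V)"

text \<open>The unit is taken from \<open>monoid_mult\<close> rather than from \<open>real_algebra_1\<close>
  so that the zero algebra is not excluded.\<close>

class locally_convex_algebra = locally_convex_space + real_algebra + topological_monoid_mult

definition algebra_monoid :: "'a::monoid_mult monoid"
  where "algebra_monoid = \<lparr>carrier = UNIV, mult = (*), one = 1\<rparr>"

text \<open>The type class carries the underlying real algebra; \<open>smul\<close> is the
  scalar multiplication by \<open>\<K>\<close> extending the real one.\<close>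

locale continuous_inverse_algebra = vector_space smul
  for smul :: "'k::real_or_complex \<Rightarrow> 'a::locally_convex_algebra \<Rightarrow> 'a" +
  assumes scale_of_real: "smul (of_real r) x = r *\<^sub>R x"
    and scale_mult_left: "smul c x * y = smul c (x * y)"
    and scale_mult_right: "x * smul c y = smul c (x * y)"
    and continuous_scale: "continuous_on UNIV (\<lambda>(c, x). smul c x)"
    and open_Units: "open (Units (algebra_monoid :: 'a monoid))"
    and continuous_inverse:
      "continuous_on (Units (algebra_monoid :: 'a monoid)) (m_inv algebra_monoid)"

definition continuous_seminorm ::
    "('k::real_normed_field \<Rightarrow> 'a::{ab_group_add,topological_space} \<Rightarrow> 'a) \<Rightarrow> ('a \<Rightarrow> real) \<Rightarrow> bool"
  where "continuous_seminorm smul p \<longleftrightarrow>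
    (\<forall>x. 0 \<le> p x) \<and> (\<forall>x y. p (x + y) \<le> p x + p y) \<and>
    (\<forall>c x. p (smul c x) = norm c * p x) \<and> continuous_on UNIV p"

text \<open>The extended seminorm \<open>\<parallel>\<mu>\<^sub>n\<parallel>\<^sub>p\<^sub>,\<^sub>q\<close> of the \<open>n\<close>-fold product.\<close>

definition mult_norm :: "nat \<Rightarrow> ('a::monoid_mult \<Rightarrow> real) \<Rightarrow> ('a \<Rightarrow> real) \<Rightarrow> ennreal"
  where "mult_norm n p q =
    (SUP xs\<in>{xs. length xs = n \<and> (\<forall>x\<in>set xs. q x \<le> 1)}. ennreal (p (prod_list xs)))"

section \<open>Mackey completeness\<close>

definition bounded_subset :: "'a::{real_vector,topological_space} set \<Rightarrow> bool"
  where "bounded_subset B \<longleftrightarrow>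
    (\<forall>U. open U \<and> 0 \<in> U \<longrightarrow> (\<exists>r>0. B \<subseteq> (\<lambda>x. r *\<^sub>R x) ` U))"

definition lipschitz_curve :: "(real \<Rightarrow> 'a::{real_vector,topological_space}) \<Rightarrow> bool"
  where "lipschitz_curve \<gamma> \<longleftrightarrow>
    bounded_subset {(\<gamma> t - \<gamma> s) /\<^sub>R (t - s) | s t. s \<in> {0..1} \<and> t \<in> {0..1} \<and> s \<noteq> t}"

text \<open>Constant gauges (as opposed to arbitrary ones) give the Riemann integral on \<open>[0,1]\<close>.\<close>

definition has_riemann_integral ::
    "(real \<Rightarrow> 'a::{real_vector,topological_space}) \<Rightarrow> 'a \<Rightarrow> bool"
  where "has_riemann_integral \<gamma> I \<longleftrightarrow>
    (\<forall>U. open U \<and> I \<in> U \<longrightarrow>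
      (\<exists>\<delta>>0. \<forall>\<D>. \<D> tagged_division_of {0..1} \<and> (\<lambda>t. ball t \<delta>) fine \<D> \<longrightarrow>
        (\<Sum>(t, J)\<in>\<D>. measure lborel J *\<^sub>R \<gamma> t) \<in> U))"

definition mackey_complete :: "'a::locally_convex_space itself \<Rightarrow> bool"
  where "mackey_complete _ \<longleftrightarrow>
    (\<forall>\<gamma>::real \<Rightarrow> 'a. lipschitz_curve \<gamma> \<longrightarrow> (\<exists>I. has_riemann_integral \<gamma> I))"

section \<open>Differentiable maps on open sets\<close>

definition has_dir_deriv ::
    "('a::real_vector \<Rightarrow> 'b::{real_vector,topological_space}) \<Rightarrow> 'a \<Rightarrow> 'a \<Rightarrow> 'b \<Rightarrow> bool"
  where "has_dir_deriv f x y v \<longleftrightarrow>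
    ((\<lambda>t::real. (f (x + t *\<^sub>R y) - f x) /\<^sub>R t) \<longlongrightarrow> v) (at 0)"

definition dir_deriv ::
    "('a::real_vector \<Rightarrow> 'b::{real_vector,t2_space}) \<Rightarrow> 'a \<Rightarrow> 'a \<Rightarrow> 'b"
  where "dir_deriv f x y = (THE v. has_dir_deriv f x y v)"

text \<open>\<open>iter_dir_deriv f [y\<^sub>1, \<dots>, y\<^sub>k] x\<close> is \<open>d\<^sup>(\<^sup>k\<^sup>)f(x, y\<^sub>1, \<dots>, y\<^sub>k)\<close>, with \<open>y\<^sub>1\<close> applied first.\<close>

fun iter_dir_deriv ::
    "('a::real_vector \<Rightarrow> 'b::{real_vector,t2_space}) \<Rightarrow> 'a list \<Rightarrow> 'a \<Rightarrow> 'b"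
  where
    "iter_dir_deriv f [] = f"
  | "iter_dir_deriv f (y # ys) = iter_dir_deriv (\<lambda>x. dir_deriv f x y) ys"

definition C_map_on ::
    "enat \<Rightarrow> 'a::{real_vector,topological_space} set \<Rightarrow> ('a \<Rightarrow> 'b::{real_vector,t2_space}) \<Rightarrow> bool"
  where "C_map_on r U f \<longleftrightarrow>
    (\<forall>ys. enat (Suc (length ys)) \<le> r \<longrightarrow>
      (\<forall>x\<in>U. \<forall>y. \<exists>v. has_dir_deriv (iter_dir_deriv f ys) x y v)) \<and>
    (\<forall>k. enat k \<le> r \<longrightarrow>
      continuous_map
        (prod_topology (top_of_set U) (product_topology (\<lambda>_. euclidean) {..<k})) euclidean
        (\<lambda>(x, y). iter_dir_deriv f (map y [0..<k]) x))"

abbreviation smooth_map_on ::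
    "'a::{real_vector,topological_space} set \<Rightarrow> ('a \<Rightarrow> 'b::{real_vector,t2_space}) \<Rightarrow> bool"
  where "smooth_map_on \<equiv> C_map_on \<infinity>"

section \<open>The space of smooth curves on the unit interval\<close>

text \<open>Derivatives at the end points of \<open>[0,1]\<close> are one-sided. Only the values on \<open>[0,1]\<close> of a curve
  and of its derivatives are relevant.\<close>

definition has_curve_deriv ::
    "(real \<Rightarrow> 'a::{real_vector,topological_space}) \<Rightarrow> 'a \<Rightarrow> real \<Rightarrow> bool"
  where "has_curve_deriv \<gamma> v t \<longleftrightarrow>
    ((\<lambda>s. (\<gamma> s - \<gamma> t) /\<^sub>R (s - t)) \<longlongrightarrow> v) (at t within {0..1})"

definition curve_deriv :: "(real \<Rightarrow> 'a::{real_vector,t2_space}) \<Rightarrow> real \<Rightarrow> 'a"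
  where "curve_deriv \<gamma> t = (THE v. has_curve_deriv \<gamma> v t)"

definition C_curve :: "enat \<Rightarrow> (real \<Rightarrow> 'a::{real_vector,t2_space}) \<Rightarrow> bool"
  where "C_curve r \<gamma> \<longleftrightarrow>
    (\<forall>j. enat (Suc j) \<le> r \<longrightarrow>
      (\<forall>t\<in>{0..1}. \<exists>v. has_curve_deriv ((curve_deriv ^^ j) \<gamma>) v t)) \<and>
    (\<forall>j. enat j \<le> r \<longrightarrow> continuous_on {0..1} ((curve_deriv ^^ j) \<gamma>))"

lemma tendsto_scaleR_const:
  fixes f :: "'b \<Rightarrow> 'a::locally_convex_space"
  assumes "(f \<longlongrightarrow> v) F"
  shows "((\<lambda>x. a *\<^sub>R f x) \<longlongrightarrow> a *\<^sub>R v) F"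
proof -
  have "((\<lambda>x. (a, f x)) \<longlongrightarrow> (a, v)) F"
    by (intro tendsto_Pair tendsto_const assms)
  with tendsto_scaleR_Pair[of a v] show ?thesis
    unfolding nhds_prod[symmetric] by (auto dest: filterlim_compose)
qed

lemma at_within_unit_interval_neq_bot: "t \<in> {0..1} \<Longrightarrow> at t within {0..1::real} \<noteq> bot"
  using trivial_limit_within[of t "{0..1}"] islimpt_Icc[of 0 1 t] by simp

lemma curve_deriv_eqI:
  assumes "has_curve_deriv \<gamma> v t" "t \<in> {0..1}"
  shows "curve_deriv \<gamma> t = v"
  unfolding curve_deriv_def
  by (rule the_equality)
    (use assms tendsto_unique[OF at_within_unit_interval_neq_bot] in
      \<open>auto simp: has_curve_deriv_def\<close>)

lemma has_curve_deriv_cong: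
  assumes "has_curve_deriv \<gamma> v t" "t \<in> {0..1}" "\<And>s. s \<in> {0..1} \<Longrightarrow> \<gamma> s = \<delta> s"
  shows "has_curve_deriv \<delta> v t"
proof -
  have "eventually (\<lambda>s. (\<gamma> s - \<gamma> t) /\<^sub>R (s - t) = (\<delta> s - \<delta> t) /\<^sub>R (s - t)) (at t within {0..1})"
    unfolding eventually_at_filter by (rule always_eventually) (use assms(2,3) in auto)
  then show ?thesis
    using assms(1) unfolding has_curve_deriv_def by (rule Lim_transform_eventually[rotated])
qed

lemma has_curve_deriv_lincomb:
  fixes \<gamma> \<delta> :: "real \<Rightarrow> 'a::locally_convex_space"
  assumes "has_curve_deriv \<gamma> v t" "has_curve_deriv \<delta> w t"
  shows "has_curve_deriv (\<lambda>s. a *\<^sub>R \<gamma> s + b *\<^sub>R \<delta> s) (a *\<^sub>R v + b *\<^sub>R w) t"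
proof -
  have "((\<lambda>s. a *\<^sub>R ((\<gamma> s - \<gamma> t) /\<^sub>R (s - t)) + b *\<^sub>R ((\<delta> s - \<delta> t) /\<^sub>R (s - t)))
      \<longlongrightarrow> a *\<^sub>R v + b *\<^sub>R w) (at t within {0..1})"
    by (intro tendsto_add tendsto_scaleR_const assms[unfolded has_curve_deriv_def])
  then show ?thesis
    unfolding has_curve_deriv_def by (simp add: algebra_simps)
qed

lemma iter_curve_deriv_lincomb:
  fixes \<gamma> \<delta> :: "real \<Rightarrow> 'a::locally_convex_space"
  assumes "C_curve \<infinity> \<gamma>" "C_curve \<infinity> \<delta>" "t \<in> {0..1}"
    and "\<And>s. s \<in> {0..1} \<Longrightarrow> \<eta> s = a *\<^sub>R \<gamma> s + b *\<^sub>R \<delta> s"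
  shows "(curve_deriv ^^ j) \<eta> t = a *\<^sub>R (curve_deriv ^^ j) \<gamma> t + b *\<^sub>R (curve_deriv ^^ j) \<delta> t
    \<and> (\<exists>v. has_curve_deriv ((curve_deriv ^^ j) \<eta>) v t)"
  using assms(3)
proof (induction j arbitrary: t)
  case 0
  obtain v w where "has_curve_deriv \<gamma> v t" "has_curve_deriv \<delta> w t"
    using assms(1,2) 0 unfolding C_curve_def by (metis enat_ord_code(3) funpow_0)
  then have "has_curve_deriv (\<lambda>s. a *\<^sub>R \<gamma> s + b *\<^sub>R \<delta> s) (a *\<^sub>R v + b *\<^sub>R w) t"
    by (rule has_curve_deriv_lincomb)
  then have "has_curve_deriv \<eta> (a *\<^sub>R v + b *\<^sub>R w) t"
    by (rule has_curve_deriv_cong) (use 0 assms(4) in auto)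
  then show ?case using assms(4) 0 by auto
next
  case (Suc j)
  have deriv: "has_curve_deriv ((curve_deriv ^^ n) \<beta>) ((curve_deriv ^^ Suc n) \<beta> s) s"
    if "C_curve \<infinity> \<beta>" "s \<in> {0..1}" for n s and \<beta> :: "real \<Rightarrow> 'a"
  proof -
    obtain v where v: "has_curve_deriv ((curve_deriv ^^ n) \<beta>) v s"
      using \<open>C_curve \<infinity> \<beta>\<close> \<open>s \<in> {0..1}\<close> unfolding C_curve_def by (metis enat_ord_code(3))
    then show ?thesis using curve_deriv_eqI[OF v \<open>s \<in> {0..1}\<close>] by simp
  qed
  have eq: "(curve_deriv ^^ Suc j) \<eta> s =
      a *\<^sub>R (curve_deriv ^^ Suc j) \<gamma> s + b *\<^sub>R (curve_deriv ^^ Suc j) \<delta> s" if "s \<in> {0..1}" for s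
  proof -
    have "has_curve_deriv ((curve_deriv ^^ j) \<eta>)
        (a *\<^sub>R (curve_deriv ^^ Suc j) \<gamma> s + b *\<^sub>R (curve_deriv ^^ Suc j) \<delta> s) s"
      by (rule has_curve_deriv_cong[OF has_curve_deriv_lincomb[OF deriv[OF assms(1)] deriv[OF assms(2)]]])
        (use that Suc.IH in auto)
    then show ?thesis using curve_deriv_eqI[OF _ that] by simp
  qed
  have "has_curve_deriv ((curve_deriv ^^ Suc j) \<eta>)
      (a *\<^sub>R (curve_deriv ^^ Suc (Suc j)) \<gamma> t + b *\<^sub>R (curve_deriv ^^ Suc (Suc j)) \<delta> t) t"
    by (rule has_curve_deriv_cong[OF has_curve_deriv_lincomb[OF deriv[OF assms(1)] deriv[OF assms(2)]]])
      (use Suc.prems eq in auto)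
  with eq Suc.prems show ?case by blast
qed

lemma continuous_on_scaleR_const:
  fixes f :: "'b::topological_space \<Rightarrow> 'a::locally_convex_space"
  shows "continuous_on S f \<Longrightarrow> continuous_on S (\<lambda>x. a *\<^sub>R f x)"
  unfolding continuous_on_def by (auto intro: tendsto_scaleR_const)

lemma C_curve_lincomb:
  fixes \<gamma> \<delta> :: "real \<Rightarrow> 'a::locally_convex_space"
  assumes "C_curve \<infinity> \<gamma>" "C_curve \<infinity> \<delta>"
  shows "C_curve \<infinity> (\<lambda>t. a *\<^sub>R \<gamma> t + b *\<^sub>R \<delta> t)"
proof -
  note lc = iter_curve_deriv_lincomb[OF assms, where \<eta> = "\<lambda>t. a *\<^sub>R \<gamma> t + b *\<^sub>R \<delta> t" and a = a and b = b]
  have "continuous_on {0..1} ((curve_deriv ^^ j) (\<lambda>t. a *\<^sub>R \<gamma> t + b *\<^sub>R \<delta> t))" for j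
  proof -
    have "continuous_on {0..1} (\<lambda>t. a *\<^sub>R (curve_deriv ^^ j) \<gamma> t + b *\<^sub>R (curve_deriv ^^ j) \<delta> t)"
      using assms unfolding C_curve_def
      by (intro continuous_on_add continuous_on_scaleR_const) auto
    then show ?thesis by (rule continuous_on_eq) (use lc in auto)
  qed
  with lc show ?thesis unfolding C_curve_def by auto
qed

lemma C_curve_zero: "C_curve \<infinity> (\<lambda>_. 0 :: 'a::locally_convex_space)"
proof -
  have z: "has_curve_deriv \<gamma> 0 t" if "\<forall>s\<in>{0..1}. \<gamma> s = 0" "t \<in> {0..1}"
    for t and \<gamma> :: "real \<Rightarrow> 'a"
    by (rule has_curve_deriv_cong[of "\<lambda>_. 0"]) (use that in \<open>auto simp: has_curve_deriv_def\<close>)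
  have d: "\<forall>s\<in>{0..1}. (curve_deriv ^^ j) (\<lambda>_. 0 :: 'a) s = 0" for j
    by (induction j) (simp_all add: curve_deriv_eqI[OF z])
  have "continuous_on {0..1} ((curve_deriv ^^ j) (\<lambda>_. 0 :: 'a))" for j
    by (rule continuous_on_eq[OF continuous_on_const[of _ 0]]) (use d in auto)
  with z d show ?thesis unfolding C_curve_def by blast
qed

text \<open>A smooth curve \<open>[0,1] \<rightarrow> E\<close> is represented by its extension by zero to the real line.\<close>

typedef (overloaded) 'a smooth_curve =
    "{\<gamma> :: real \<Rightarrow> 'a::locally_convex_space. C_curve \<infinity> \<gamma> \<and> (\<forall>t. t \<notin> {0..1} \<longrightarrow> \<gamma> t = 0)}"
  morphisms curve Abs_smooth_curve
  using C_curve_zero by blast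

instantiation smooth_curve :: (locally_convex_space) real_vector
begin

definition "0 = Abs_smooth_curve (\<lambda>_. 0)"
definition "\<gamma> + \<delta> = Abs_smooth_curve (\<lambda>t. curve \<gamma> t + curve \<delta> t)"
definition "\<gamma> - \<delta> = Abs_smooth_curve (\<lambda>t. curve \<gamma> t - curve \<delta> t)"
definition "- \<gamma> = Abs_smooth_curve (\<lambda>t. - curve \<gamma> t)"
definition "a *\<^sub>R \<gamma> = Abs_smooth_curve (\<lambda>t. a *\<^sub>R curve \<gamma> t)"

lemma curve_lincomb:
  "curve (Abs_smooth_curve (\<lambda>t. a *\<^sub>R curve \<gamma> t + b *\<^sub>R curve \<delta> t)) =
    (\<lambda>t. a *\<^sub>R curve \<gamma> t + b *\<^sub>R curve \<delta> t)"
  using curve[of \<gamma>] curve[of \<delta>] by (intro Abs_smooth_curve_inverse) (auto intro: C_curve_lincomb)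

lemma curve_zero: "curve 0 = (\<lambda>_. 0)"
  unfolding zero_smooth_curve_def by (rule Abs_smooth_curve_inverse) (use C_curve_zero in auto)

lemma curve_add: "curve (\<gamma> + \<delta>) = (\<lambda>t. curve \<gamma> t + curve \<delta> t)"
  using curve_lincomb[of 1 \<gamma> 1 \<delta>] by (simp add: plus_smooth_curve_def)

lemma curve_diff: "curve (\<gamma> - \<delta>) = (\<lambda>t. curve \<gamma> t - curve \<delta> t)"
  using curve_lincomb[of 1 \<gamma> "-1" \<delta>] by (simp add: minus_smooth_curve_def)

lemma curve_uminus: "curve (- \<gamma>) = (\<lambda>t. - curve \<gamma> t)"
  using curve_lincomb[of "-1" \<gamma> 0 \<gamma>] by (simp add: uminus_smooth_curve_def)

lemma curve_scaleR: "curve (a *\<^sub>R \<gamma>) = (\<lambda>t. a *\<^sub>R curve \<gamma> t)"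
  using curve_lincomb[of a \<gamma> 0 \<gamma>] by (simp add: scaleR_smooth_curve_def)

instance
  by standard
    (simp_all add: curve_inject[symmetric] curve_zero curve_add curve_diff curve_uminus
      curve_scaleR fun_eq_iff algebra_simps)

end

definition curve_seminorm ::
    "nat \<Rightarrow> ('a::locally_convex_space \<Rightarrow> real) \<Rightarrow> 'a smooth_curve \<Rightarrow> real"
  where "curve_seminorm k p \<gamma> =
    (MAX j\<in>{..k}. SUP t\<in>{0..1}. p ((curve_deriv ^^ j) (curve \<gamma>) t))"

text \<open>The locally convex topology defined by the seminorms above: the open balls of
  all these seminorms form a subbase.\<close>

instantiation smooth_curve :: (locally_convex_space) topological_space
begin

definition open_smooth_curve :: "'a smooth_curve set \<Rightarrow> bool"
  where "open_smooth_curve = generate_topology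
    {{\<delta>. curve_seminorm k p (\<delta> - \<gamma>) < \<epsilon>} | k p \<gamma> \<epsilon>.
      continuous_seminorm scaleR p \<and> \<epsilon> > 0}"

instance
  by standard
    (auto simp: open_smooth_curve_def intro: generate_topology.intros generate_topology_Union)

end

section \<open>Regular Lie groups\<close>

text \<open>Lie groups whose manifold is an open subset of a locally convex space \<open>E\<close>, with the inclusion
  as global chart. All tangent spaces, in particular the Lie algebra, are identified with \<open>E\<close>.\<close>

definition open_lie_group :: "'a::locally_convex_space monoid \<Rightarrow> bool"
  where "open_lie_group G \<longleftrightarrow>
    Group.group G \<and> open (carrier G) \<and>
    smooth_map_on (carrier G \<times> carrier G) (\<lambda>(x, y). x \<otimes>\<^bsub>G\<^esub> y) \<and>
    smooth_map_on (carrier G) (m_inv G)"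

text \<open>The tangent map at the identity of left translation by \<open>g\<close>, giving the action \<open>(g, v) \<mapsto> gv\<close>.\<close>

definition left_translate :: "'a::locally_convex_space monoid \<Rightarrow> 'a \<Rightarrow> 'a \<Rightarrow> 'a"
  where "left_translate G g v = dir_deriv (\<lambda>x. g \<otimes>\<^bsub>G\<^esub> x) \<one>\<^bsub>G\<^esub> v"

definition is_evolution ::
    "'a::locally_convex_space monoid \<Rightarrow> (real \<Rightarrow> 'a) \<Rightarrow> (real \<Rightarrow> 'a) \<Rightarrow> bool"
  where "is_evolution G \<gamma> \<eta> \<longleftrightarrow>
    C_curve 1 \<eta> \<and> \<eta> ` {0..1} \<subseteq> carrier G \<and> \<eta> 0 = \<one>\<^bsub>G\<^esub> \<and>
    (\<forall>t\<in>{0..1}. curve_deriv \<eta> t = left_translate G (\<eta> t) (\<gamma> t))"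

definition evol :: "'a::locally_convex_space monoid \<Rightarrow> 'a smooth_curve \<Rightarrow> 'a"
  where "evol G \<gamma> = (THE g. \<exists>\<eta>. is_evolution G (curve \<gamma>) \<eta> \<and> \<eta> 1 = g)"

definition regular_lie_group :: "'a::locally_convex_space monoid \<Rightarrow> bool"
  where "regular_lie_group G \<longleftrightarrow>
    open_lie_group G \<and>
    (\<forall>\<gamma>::'a smooth_curve. \<exists>\<eta>. is_evolution G (curve \<gamma>) \<eta>) \<and>
    smooth_map_on UNIV (evol G)"

end

theory Submission
  imports Defs
begin

text \<open>The summability condition bounds all products \<open>x\<^sub>1 \<dots> x\<^sub>n\<close> by \<open>C Q(x\<^sub>1) \<dots> Q(x\<^sub>n)\<close>, which
  makes the algebra locally m-convex: its topology is given by submultiplicative seminorms. For these, the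
  Picard iteration for \<open>\<eta>' = \<eta> \<gamma>\<close> converges exponentially fast at every time, and Mackey completeness
  suffices to sum it. Differences of solutions solve linear equations again, so that Gronwall estimates, which
  involve only the topology of uniform convergence of \<open>\<gamma>\<close>, give continuity and the derivatives of the
  evolution. The latter are sums of iterated solutions of \<open>u' = u \<gamma> + f y\<close>.\<close>

section \<open>Continuous seminorms\<close>

text \<open>The obstacle is the weakness of Mackey completeness: it integrates Lipschitz curves and
  nothing else. So every curve that enters an equation is kept Lipschitz, a limit has to be
  recognised as Lipschitz before it may be integrated, and a series is summed by writing its sum as
  the integral of a Lipschitz curve. That device has a price: a cutoff at scale 2^(-k) has a
  derivative whose Lipschitz constant is of order 4^k. Terms of size 8^(-k) leave the summable
  2^(-k); this is the origin of the rate 1/8 and of the weight exp(8 \<rho> t) in the Picard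
  iteration. The weight may depend on the seminorm because the iteration itself does not.
  Submultiplicativity matters because multiplication by \<gamma>(t) is then bounded for one and the
  same seminorm, so that Gronwall arguments close without passing to a larger seminorm at each step.
  A smaller mismatch concerns scalars: the summability hypothesis speaks of seminorms homogeneous
  over the field, whereas convex neighbourhoods yield real ones, so each real seminorm is first
  dominated by one of the other kind.\<close>

abbreviation cseminorm :: "('a::{real_vector,topological_space} \<Rightarrow> real) \<Rightarrow> bool"
  where "cseminorm \<equiv> continuous_seminorm scaleR"

lemma cseminormD:
  assumes "cseminorm p"
  shows "0 \<le> p x" "p (x + y) \<le> p x + p y" "p (c *\<^sub>R x) = \<bar>c\<bar> * p x" "continuous_on UNIV p"
    "p 0 = 0" "p (- x) = p x" "p (x - y) \<le> p x + p y" "p (x - y) = p (y - x)"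
proof -
  have c: "p (c *\<^sub>R x) = \<bar>c\<bar> * p x" for c x using assms by (auto simp: continuous_seminorm_def)
  have n: "p (- x) = p x" for x using c[of "-1" x] by simp
  have a: "p (x + y) \<le> p x + p y" for x y using assms by (auto simp: continuous_seminorm_def)
  show "0 \<le> p x" "continuous_on UNIV p" using assms by (auto simp: continuous_seminorm_def)
  show "p (x + y) \<le> p x + p y" by (rule a)
  show "p (c *\<^sub>R x) = \<bar>c\<bar> * p x" by (rule c)
  show "p 0 = 0" using c[of 0 0] by simp
  show "p (- x) = p x" by (rule n)
  show "p (x - y) \<le> p x + p y" using a[of x "-y"] n[of y] by simp
  show "p (x - y) = p (y - x)" using n[of "x - y"] by simp
qed

lemma cseminorm_sum:
  assumes "cseminorm p"
  shows "p (sum f S) \<le> (\<Sum>i\<in>S. p (f i))"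
proof (induction S rule: infinite_finite_induct)
  case (insert x S)
  then show ?case using cseminormD(2)[OF assms, of "f x" "sum f S"] by simp
qed (simp_all add: cseminormD(5)[OF assms])

lemma tendsto_scaleR_lcs:
  fixes g :: "'b \<Rightarrow> 'a::locally_convex_space"
  assumes "(f \<longlongrightarrow> a) F" "(g \<longlongrightarrow> b) F"
  shows "((\<lambda>x. f x *\<^sub>R g x) \<longlongrightarrow> a *\<^sub>R b) F"
proof -
  have "((\<lambda>x. (f x, g x)) \<longlongrightarrow> (a, b)) F"
    by (intro tendsto_Pair assms)
  with tendsto_scaleR_Pair[of a b] show ?thesis
    unfolding nhds_prod[symmetric] by (auto dest: filterlim_compose)
qed

lemma open_scaled_preimage:
  fixes U :: "'a::locally_convex_space set"
  assumes "open U"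
  shows "open {x. c *\<^sub>R x \<in> U}"
proof -
  have "continuous_on UNIV (\<lambda>x::'a. c *\<^sub>R x)"
    by (intro continuous_on_scaleR_const continuous_on_id)
  then have "open ((\<lambda>x. c *\<^sub>R x) -` U)" by (rule open_vimage[OF assms])
  then show ?thesis by (simp only: vimage_def)
qed

text \<open>By homogeneity, a bound on one neighbourhood of zero makes \<open>p\<close> small on a
  shrunken neighbourhood, and the triangle inequality carries this from zero to every other
  point.\<close>

lemma cseminormI:
  fixes p :: "'a::locally_convex_space \<Rightarrow> real"
  assumes nonneg: "\<And>x. 0 \<le> p x" and add: "\<And>x y. p (x + y) \<le> p x + p y"
    and scale: "\<And>c x. p (c *\<^sub>R x) = \<bar>c\<bar> * p x"
    and U: "open U" "0 \<in> U" "\<And>x. x \<in> U \<Longrightarrow> p x \<le> B"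
  shows "cseminorm p"
proof -
  have neg: "p (- x) = p x" for x using scale[of "-1" x] by simp
  have small: "eventually (\<lambda>x. p x < e) (nhds 0)" if "e > 0" for e
  proof -
    have B: "B \<ge> 0" using nonneg[of 0] U(2,3) by force
    \<comment> \<open>If \<open>c *\<^sub>R x\<close> lies in \<open>U\<close>, then
      \<open>p x\<close> is at most \<open>B / c\<close>, which is less than \<open>e\<close>; the
      summand 1 keeps \<open>c\<close> positive when \<open>B = 0\<close>.\<close>
    define c where "c = (B + 1) / e"
    have c: "c > 0" using \<open>e > 0\<close> B by (simp add: c_def)
    have "p x < e" if "c *\<^sub>R x \<in> U" for x
    proof -
      have "c * p x \<le> B" using U(3)[OF that] scale[of c x] c by simp
      then have "(B + 1) * p x \<le> B * e" using \<open>e > 0\<close> by (simp add: c_def field_simps)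
      also have "\<dots> < (B + 1) * e" using \<open>e > 0\<close> by simp
      finally show ?thesis using B by simp
    qed
    then show ?thesis
      using open_scaled_preimage[OF U(1), of c] U(2) by (auto simp: eventually_nhds)
  qed
  have "continuous_on UNIV p"
    unfolding continuous_on_def
  proof
    fix x :: 'a
    have "((\<lambda>y. y - x) \<longlongrightarrow> x - x) (at x)"
      by (intro tendsto_diff tendsto_const tendsto_ident_at)
    then have lim: "filterlim (\<lambda>y. y - x) (nhds 0) (at x)" by simp
    show "(p \<longlongrightarrow> p x) (at x)"
    proof (rule tendstoI)
      fix e :: real assume "e > 0"
      have "eventually (\<lambda>y. p (y - x) < e) (at x)"
        using lim small[OF \<open>e > 0\<close>] by (auto simp: filterlim_iff)
      then show "eventually (\<lambda>y. dist (p y) (p x) < e) (at x)"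
      proof eventually_elim
        case (elim y)
        have "p y \<le> p (y - x) + p x" "p x \<le> p (x - y) + p y"
          using add[of "y - x" x] add[of "x - y" y] by simp_all
        moreover have "p (x - y) = p (y - x)" using neg[of "x - y"] by simp
        ultimately show ?case using elim by (simp add: dist_real_def)
      qed
    qed
  qed
  then show ?thesis using nonneg add scale by (simp add: continuous_seminorm_def)
qed

lemma absorbing_open:
  fixes x :: "'a::locally_convex_space"
  assumes "open U" "0 \<in> U"
  shows "\<exists>r>0. (1 / r) *\<^sub>R x \<in> U"
proof -
  have "((\<lambda>c. c *\<^sub>R x) \<longlongrightarrow> 0 *\<^sub>R x) (at_right 0)"
    by (intro tendsto_scaleR_lcs tendsto_ident_at tendsto_const)
  then have "eventually (\<lambda>c. c *\<^sub>R x \<in> U) (at_right 0)"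
    using assms by (auto dest: topological_tendstoD)
  then have "eventually (\<lambda>c. c *\<^sub>R x \<in> U \<and> c > 0) (at_right 0)"
    by (simp add: eventually_conj_iff eventually_at_right_less)
  then obtain c :: real where "c *\<^sub>R x \<in> U" "c > 0"
    using eventually_happens'[OF trivial_limit_at_right_real] by blast
  then show ?thesis by (intro exI[of _ "1 / c"]) simp
qed

text \<open>The seminorm is the Minkowski functional of a symmetric convex neighbourhood of zero.\<close>

lemma cseminorm_ball_subset:
  fixes U :: "'a::locally_convex_space set"
  assumes "open U" "0 \<in> U"
  shows "\<exists>p. cseminorm p \<and> (\<forall>x. p x < 1 \<longrightarrow> x \<in> U)"
proof -
  obtain V where V: "open V" "0 \<in> V" "V \<subseteq> U"
    and convV: "\<And>x y u v. x \<in> V \<Longrightarrow> y \<in> V \<Longrightarrow> u \<ge> 0 \<Longrightarrow> v \<ge> 0 \<Longrightarrow> u + v = 1 \<Longrightarrow>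
      u *\<^sub>R x + v *\<^sub>R y \<in> V"
    using locally_convex[OF assms] by metis
  \<comment> \<open>The class provides convex neighbourhoods without symmetry; intersecting
    \<open>V\<close> with its reflection is what yields \<open>p (- x) = p x\<close>.\<close>
  define W where "W = {x. x \<in> V \<and> (-1) *\<^sub>R x \<in> V}"
  have W: "open W" "0 \<in> W" "W \<subseteq> U"
    using open_Int[OF V(1) open_scaled_preimage[OF V(1), of "-1"]] V
    by (auto simp: W_def Int_def)
  have conv: "u *\<^sub>R x + v *\<^sub>R y \<in> W" if "x \<in> W" "y \<in> W" "u \<ge> 0" "v \<ge> 0" "u + v = 1" for x y u v
    using convV[of x y u v] convV[of "-x" "-y" u v] that by (simp add: W_def)
  have sym: "- x \<in> W" if "x \<in> W" for x using that by (simp add: W_def)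
  define R where "R x = {r::real. r > 0 \<and> (1 / r) *\<^sub>R x \<in> W}" for x
  have ne: "R x \<noteq> {}" for x using absorbing_open[OF W(1,2), of x] by (auto simp: R_def)
  have bdd: "bdd_below (R x)" for x by (rule bdd_belowI[of _ 0]) (auto simp: R_def)
  define p where "p x = Inf (R x)" for x
  have le: "p x \<le> r" if "r \<in> R x" for x r unfolding p_def using bdd that by (rule cInf_lower[rotated])
  have nonneg: "0 \<le> p x" for x unfolding p_def using ne by (rule cInf_greatest) (auto simp: R_def)
  have up: "s \<in> R x" if "r \<in> R x" "r \<le> s" for r s x
  proof -
    have "(r / s) *\<^sub>R ((1 / r) *\<^sub>R x) + (1 - r / s) *\<^sub>R 0 \<in> W"
      by (rule conv) (use that W(2) in \<open>auto simp: R_def field_simps\<close>)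
    then show ?thesis using that by (auto simp: R_def)
  qed
  have mem: "r \<in> R x" if less: "p x < r" for x r
  proof -
    obtain s where "s \<in> R x" "s < r"
      using less cInf_less_iff[OF ne[of x] bdd[of x], of r] unfolding p_def by blast
    then show ?thesis using up by simp
  qed
  have add: "p (x + y) \<le> p x + p y" for x y
  proof (rule field_le_epsilon)
    fix e :: real assume "e > 0"
    define r s where "r = p x + e / 2" and "s = p y + e / 2"
    have rs: "r \<in> R x" "s \<in> R y" using \<open>e > 0\<close> by (auto simp: r_def s_def intro: mem)
    then have pos: "r > 0" "s > 0" by (auto simp: R_def)
    \<comment> \<open>Subadditivity of the gauge: \<open>(x + y) / (r + s)\<close> is the convex
      combination of \<open>x / r\<close> and \<open>y / s\<close> with weights proportional to
      \<open>r\<close> and \<open>s\<close>.\<close>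
    have "(r / (r + s)) *\<^sub>R ((1 / r) *\<^sub>R x) + (s / (r + s)) *\<^sub>R ((1 / s) *\<^sub>R y) \<in> W"
      by (rule conv) (use rs pos in \<open>auto simp: R_def add_divide_distrib[symmetric]\<close>)
    then have "r + s \<in> R (x + y)" using pos by (simp add: R_def scaleR_add_right)
    then show "p (x + y) \<le> p x + p y + e" using le by (force simp: r_def s_def)
  qed
  have scale1: "p (c *\<^sub>R x) \<le> c * p x" if "c > 0" for c x
  proof (rule field_le_epsilon)
    fix e :: real assume "e > 0"
    have "p x + e / c \<in> R x" using \<open>e > 0\<close> that by (intro mem) simp
    then have "c * (p x + e / c) \<in> R (c *\<^sub>R x)" using that by (auto simp: R_def)
    from le[OF this] show "p (c *\<^sub>R x) \<le> c * p x + e" using that by (simp add: distrib_left)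
  qed
  have zero: "p 0 = 0"
  proof (rule antisym)
    have "e \<in> R 0" if "e > 0" for e using W(2) that by (simp add: R_def)
    then show "p 0 \<le> 0" by (metis add_0 field_le_epsilon le)
  qed (rule nonneg)
  have scale2: "p (c *\<^sub>R x) = c * p x" if "c > 0" for c x
  proof (rule antisym)
    have "p ((1 / c) *\<^sub>R (c *\<^sub>R x)) \<le> (1 / c) * p (c *\<^sub>R x)" using that by (intro scale1) simp
    then show "c * p x \<le> p (c *\<^sub>R x)" using that by (simp add: field_simps)
  qed (rule scale1[OF that])
  have "(1 / r) *\<^sub>R (- x) \<in> W \<longleftrightarrow> (1 / r) *\<^sub>R x \<in> W" for r x
    using sym[of "(1 / r) *\<^sub>R x"] sym[of "(1 / r) *\<^sub>R (- x)"] by auto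
  then have "R (- x) = R x" for x by (simp add: R_def)
  then have neg: "p (- x) = p x" for x by (simp add: p_def)
  have scale: "p (c *\<^sub>R x) = \<bar>c\<bar> * p x" for c x
  proof (cases c "0::real" rule: linorder_cases)
    case less
    then show ?thesis using scale2[of "-c" x] neg[of "c *\<^sub>R x"] by simp
  qed (auto simp: zero scale2)
  have "cseminorm p"
    by (rule cseminormI[of p W 1, OF nonneg add scale W(1,2)]) (auto simp: R_def intro: le)
  moreover have "x \<in> U" if "p x < 1" for x using mem[OF that] W(3) by (auto simp: R_def)
  ultimately show ?thesis by blast
qed

lemma bounded_subsetI:
  fixes B :: "'a::locally_convex_space set"
  assumes "\<And>p. cseminorm p \<Longrightarrow> \<exists>M. \<forall>x\<in>B. p x \<le> M"
  shows "bounded_subset B"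
  unfolding bounded_subset_def
proof (intro allI impI)
  fix U :: "'a set" assume "open U \<and> 0 \<in> U"
  then obtain p where p: "cseminorm p" "\<And>x. p x < 1 \<Longrightarrow> x \<in> U"
    using cseminorm_ball_subset by blast
  obtain M where M: "\<And>x. x \<in> B \<Longrightarrow> p x \<le> M" using assms[OF p(1)] by blast
  define r where "r = \<bar>M\<bar> + 1"
  have "r > 0" by (simp add: r_def)
  have "x \<in> (*\<^sub>R) r ` U" if "x \<in> B" for x
  proof -
    have "p ((1 / r) *\<^sub>R x) < 1"
      using M[OF that] \<open>r > 0\<close> by (simp add: cseminormD(3)[OF p(1)] r_def field_simps)
    then have "(1 / r) *\<^sub>R x \<in> U" by (rule p(2))
    then show ?thesis using \<open>r > 0\<close> by (intro image_eqI[of _ _ "(1 / r) *\<^sub>R x"]) auto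
  qed
  then show "\<exists>r>0. B \<subseteq> (*\<^sub>R) r ` U" using \<open>r > 0\<close> by blast
qed

text \<open>With \<open>tendsto_cseminormD\<close>, limits become statements about one continuous
  seminorm at a time. Translating a neighbourhood of \<open>l\<close> to zero makes the Minkowski
  functionals available.\<close>

lemma tendsto_cseminormI:
  fixes f :: "'b \<Rightarrow> 'a::locally_convex_space"
  assumes "\<And>p e. cseminorm p \<Longrightarrow> e > 0 \<Longrightarrow> eventually (\<lambda>x. p (f x - l) < e) F"
  shows "(f \<longlongrightarrow> l) F"
proof (rule topological_tendstoI)
  fix U assume U: "open U" "l \<in> U"
  have "open ((\<lambda>x. x + l) -` U)"
    by (rule open_vimage[OF U(1)]) (intro continuous_intros)
  moreover have "0 \<in> (\<lambda>x. x + l) -` U" using U by simp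
  ultimately obtain p where p: "cseminorm p" "\<And>x. p x < 1 \<Longrightarrow> x + l \<in> U"
    using cseminorm_ball_subset[of "(\<lambda>x. x + l) -` U"] by auto
  have "eventually (\<lambda>x. p (f x - l) < 1) F" by (rule assms[OF p(1)]) simp
  then show "eventually (\<lambda>x. f x \<in> U) F" by eventually_elim (use p(2) in force)
qed

lemma tendsto_cseminormD:
  fixes f :: "'b \<Rightarrow> 'a::locally_convex_space"
  assumes "(f \<longlongrightarrow> l) F" "cseminorm p" "e > 0"
  shows "eventually (\<lambda>x. p (f x - l) < e) F"
proof -
  have "isCont p 0" using cseminormD(4)[OF assms(2)] by (simp add: continuous_on_eq_continuous_at)
  moreover have "((\<lambda>x. f x - l) \<longlongrightarrow> l - l) F" by (intro tendsto_diff assms(1) tendsto_const)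
  ultimately have "((\<lambda>x. p (f x - l)) \<longlongrightarrow> 0) F"
    using isCont_tendsto_compose[of 0 p "\<lambda>x. f x - l" F] cseminormD(5)[OF assms(2)] by simp
  then show ?thesis using assms(3) by (auto dest: order_tendstoD(2))
qed

lemma eq_zero_if_cseminorm_zero:
  fixes x :: "'a::locally_convex_space"
  assumes "\<And>p. cseminorm p \<Longrightarrow> p x = 0"
  shows "x = 0"
proof (rule ccontr)
  assume "x \<noteq> 0"
  then obtain U where "open U" "0 \<in> U" "x \<notin> U" using separation_t1[of 0 x] by blast
  with cseminorm_ball_subset[of U] assms show False by force
qed

section \<open>Submultiplicative seminorms\<close>

text \<open>The majorant \<open>B\<close> serves two purposes: pointwise it makes the supremum
  finite, and its bound \<open>b\<close> on \<open>U\<close> gives continuity through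
  \<open>cseminormI\<close>. It need not be a seminorm itself. The three suprema of this section are
  built with it: over scalars, over right factors and as an operator norm.\<close>

lemma cseminorm_SUP:
  fixes f :: "'i \<Rightarrow> 'a::locally_convex_space \<Rightarrow> real"
  assumes S: "S \<noteq> {}"
    and nonneg: "\<And>i x. i \<in> S \<Longrightarrow> 0 \<le> f i x"
    and add: "\<And>i x y. i \<in> S \<Longrightarrow> f i (x + y) \<le> f i x + f i y"
    and scale: "\<And>i c x. i \<in> S \<Longrightarrow> f i (c *\<^sub>R x) = \<bar>c\<bar> * f i x"
    and bound: "\<And>i x. i \<in> S \<Longrightarrow> f i x \<le> B x"
    and U: "open U" "0 \<in> U" "\<And>x. x \<in> U \<Longrightarrow> B x \<le> b"
  shows "cseminorm (\<lambda>x. SUP i\<in>S. f i x)"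
    and "i \<in> S \<Longrightarrow> f i x \<le> (SUP i\<in>S. f i x)"
    and "(SUP i\<in>S. f i x) \<le> B x"
proof -
  have le: "f i x \<le> (SUP i\<in>S. f i x)" if "i \<in> S" for i x
    using that bound by (intro cSUP_upper bdd_aboveI2) auto
  then show "i \<in> S \<Longrightarrow> f i x \<le> (SUP i\<in>S. f i x)" .
  have up: "(SUP i\<in>S. f i x) \<le> B x" for x using S bound by (intro cSUP_least) auto
  then show "(SUP i\<in>S. f i x) \<le> B x" .
  have scale1: "(SUP i\<in>S. f i (c *\<^sub>R x)) \<le> \<bar>c\<bar> * (SUP i\<in>S. f i x)" for c x
    using S scale le by (intro cSUP_least) (auto intro: mult_left_mono)
  show "cseminorm (\<lambda>x. SUP i\<in>S. f i x)"
  proof (rule cseminormI[OF _ _ _ U(1,2)])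
    fix x y :: 'a and c :: real
    show "0 \<le> (SUP i\<in>S. f i x)" using S nonneg le by (meson all_not_in_conv order_trans)
    show "(SUP i\<in>S. f i (x + y)) \<le> (SUP i\<in>S. f i x) + (SUP i\<in>S. f i y)"
      by (rule cSUP_least[OF S]) (use add[of _ x y] le[of _ x] le[of _ y] in fastforce)
    show "(SUP i\<in>S. f i (c *\<^sub>R x)) = \<bar>c\<bar> * (SUP i\<in>S. f i x)"
    proof (cases "c = 0")
      case True
      have "f i (0 *\<^sub>R x) = 0" if "i \<in> S" for i using scale[OF that, of 0] by simp
      with True S show ?thesis by (simp cong: SUP_cong)
    next
      case False
      then have "\<bar>c\<bar> * (SUP i\<in>S. f i x) \<le> (SUP i\<in>S. f i (c *\<^sub>R x))"
        using scale1[of "1 / c" "c *\<^sub>R x"] by (simp add: field_simps)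
      with scale1 show ?thesis by (intro antisym)
    qed
    show "x \<in> U \<Longrightarrow> (SUP i\<in>S. f i x) \<le> b" using up U(3) order_trans by blast
  qed
qed

lemma (in continuous_inverse_algebra) cseminorm_if_scale_seminorm:
  assumes "continuous_seminorm smul p"
  shows "cseminorm p"
proof -
  have "p (r *\<^sub>R x) = \<bar>r\<bar> * p x" for r x
    using assms unfolding continuous_seminorm_def by (metis norm_of_real scale_of_real)
  with assms show ?thesis by (simp add: continuous_seminorm_def)
qed

text \<open>Averaging over scalars is replaced by the supremum over the closed unit disc. Joint
  continuity of the scalar multiplication at (0,0) already bounds it, so compactness of the disc
  does not enter.\<close>

lemma (in continuous_inverse_algebra) dominating_scale_seminorm:
  assumes p: "cseminorm p"
  shows "\<exists>P. continuous_seminorm smul P \<and> (\<forall>x. p x \<le> P x)"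
proof -
  define W where "W = {z. p (case z of (c, x) \<Rightarrow> smul c x) < 1}"
  have "continuous_on UNIV (\<lambda>z. p (case z of (c, x) \<Rightarrow> smul c x))"
    by (rule continuous_on_compose2[OF cseminormD(4)[OF p] continuous_scale]) simp
  then have W: "open W" "(0, 0) \<in> W" "\<And>c x. (c, x) \<in> W \<Longrightarrow> p (smul c x) < 1"
    unfolding W_def by (auto simp: cseminormD(5)[OF p] intro: open_Collect_less)
  from open_prod_elim[OF W(1,2)] obtain D V
    where DV: "open D" "open V" "0 \<in> D" "0 \<in> V" "D \<times> V \<subseteq> W" by (metis mem_Times_iff fst_conv snd_conv)
  obtain d where d: "d > 0" "\<And>c. dist c 0 < d \<Longrightarrow> c \<in> D" using DV(1,3) by (metis open_dist)
  have comm: "smul c (a *\<^sub>R x) = a *\<^sub>R smul c x" for c a x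
    by (simp only: scale_of_real[symmetric] scale_left_commute)
  \<comment> \<open>Shrinking \<open>c\<close> by the factor \<open>d / 2\<close> and
    \<open>x\<close> by \<open>1 / r\<close> moves the pair into \<open>W\<close>, where the value
    is below 1; undoing both scalings gives \<open>2 * r / d\<close>.\<close>
  have bound: "p (smul c x) \<le> 2 * r / d" if "norm c \<le> 1" "r > 0" "(1 / r) *\<^sub>R x \<in> V" for c r x
  proof -
    have "norm c * d / 2 < d"
      using mult_right_mono[OF that(1), of d] d(1) by simp
    then have "of_real (d / 2) * c \<in> D"
      using d by (simp add: norm_mult)
    then have "p (smul (of_real (d / 2) * c) ((1 / r) *\<^sub>R x)) < 1"
      using that(3) W(3) DV(5) by blast
    moreover have "smul (of_real (d / 2) * c) ((1 / r) *\<^sub>R x) = (d / (2 * r)) *\<^sub>R smul c x"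
    proof -
      have "smul (of_real (d / 2) * c) ((1 / r) *\<^sub>R x) = (1 / r) *\<^sub>R smul (of_real (d / 2)) (smul c x)"
        by (simp only: comm scale_scale)
      then show ?thesis by (simp only: scale_of_real scaleR_scaleR) simp
    qed
    ultimately show ?thesis using d(1) \<open>r > 0\<close> by (simp add: cseminormD(3)[OF p] field_simps)
  qed
  define S where "S = {c::'k. norm c \<le> 1}"
  define P where "P x = (SUP c\<in>S. p (smul c x))" for x
  \<comment> \<open>Taking \<open>r = 1\<close> whenever \<open>x \<in> V\<close> makes this
    majorant at most \<open>2 / d\<close> on all of \<open>V\<close>, the uniform bound that
    \<open>cseminorm_SUP\<close> asks for.\<close>
  define B where "B x = 2 * (SOME r. r > 0 \<and> (1 / r) *\<^sub>R x \<in> V \<and> (x \<in> V \<longrightarrow> r = 1)) / d" for x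
  have "\<exists>r. r > 0 \<and> (1 / r) *\<^sub>R x \<in> V \<and> (x \<in> V \<longrightarrow> r = 1)" for x
    by (cases "x \<in> V") (use absorbing_open[OF DV(2,4), of x] in \<open>auto intro: exI[of _ 1]\<close>)
  from someI_ex[OF this] have B: "p (smul c x) \<le> B x" "x \<in> V \<Longrightarrow> B x \<le> 2 / d" if "norm c \<le> 1" for c x
    using bound that by (auto simp: B_def)
  have "1 \<in> S" by (simp add: S_def)
  then have "S \<noteq> {}" by blast
  have PP: "cseminorm P" "\<And>c x. c \<in> S \<Longrightarrow> p (smul c x) \<le> P x"
    unfolding P_def
    by (rule cseminorm_SUP[of S "\<lambda>c x. p (smul c x)" B V "2 / d"];
        use \<open>S \<noteq> {}\<close> DV B[where c = 0] B(1) in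
        \<open>auto simp: cseminormD[OF p] scale_right_distrib comm S_def\<close>)+
  have "P (smul c x) = norm c * P x" for c x
  proof -
    \<comment> \<open>Write \<open>c\<close> as \<open>norm c\<close> times a scalar
      \<open>u\<close> of norm 1; multiplication by \<open>u\<close> maps the unit disc into itself.
      The reverse inequality is this one for \<open>inverse c\<close>.\<close>
    have le: "P (smul c x) \<le> norm c * P x" for c x
    proof (cases "c = 0")
      case False
      define u where "u = (1 / norm c) *\<^sub>R c"
      have c: "c = of_real (norm c) * u" using False by (simp add: u_def scaleR_conv_of_real)
      have "P (smul c x) = norm c * P (smul u x)"
        by (subst c, simp only: scale_scale[symmetric] scale_of_real cseminormD(3)[OF PP(1)]) simp
      also have "P (smul u x) \<le> P x"
        unfolding P_def[of "smul u x"]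
        by (rule cSUP_least) (use \<open>S \<noteq> {}\<close> PP(2) False in \<open>auto simp: S_def u_def norm_mult\<close>)
      finally show ?thesis by (simp add: mult_left_mono)
    qed (simp add: cseminormD(5)[OF PP(1)])
    show ?thesis
    proof (cases "c = 0")
      case False
      have "P (smul (inverse c) (smul c x)) \<le> norm (inverse c) * P (smul c x)" by (rule le)
      with False have "norm c * P x \<le> P (smul c x)" by (simp add: norm_divide norm_inverse field_simps)
      with le show ?thesis by (intro antisym)
    qed (simp add: cseminormD(5)[OF PP(1)])
  qed
  then have "continuous_seminorm smul P"
    using cseminormD[OF PP(1)] by (simp add: continuous_seminorm_def)
  moreover have "p x \<le> P x" for x using PP(2)[OF \<open>1 \<in> S\<close>, of x] by simp
  ultimately show ?thesis by blast
qed

definition submult_seminorm :: "('a::{real_algebra,topological_space} \<Rightarrow> real) \<Rightarrow> bool"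
  where "submult_seminorm p \<longleftrightarrow> cseminorm p \<and> (\<forall>x y. p (x * y) \<le> p x * p y)"

lemma prod_list_scaleR:
  fixes xs :: "'a::{real_algebra,monoid_mult} list"
  shows "prod_list (map (\<lambda>x. c x *\<^sub>R x) xs) = prod_list (map c xs) *\<^sub>R prod_list xs"
  by (induction xs) auto

text \<open>Each term of the convergent series is at most its value \<open>C0\<close>, so
  \<open>r^n p(x_1 ... x_n)\<close> is at most \<open>C0\<close> on the unit ball of
  \<open>q\<close>; scaling every factor separately turns this into a bound multilinear in the
  values of \<open>q\<close>.\<close>

lemma mult_norm_homogeneous:
  fixes p q :: "'a::locally_convex_algebra \<Rightarrow> real"
  assumes p: "cseminorm p" and q: "cseminorm q" and "r > 0"
    and fin: "(\<Sum>n. ennreal (r ^ Suc n) * mult_norm (Suc n) p q) < \<infinity>"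
  shows "\<exists>C. \<forall>xs. p (prod_list xs) \<le> C * prod_list (map (\<lambda>x. q x / r) xs)"
proof -
  define C0 where "C0 = enn2real (\<Sum>n. ennreal (r ^ Suc n) * mult_norm (Suc n) p q)"
  have C0: "(\<Sum>n. ennreal (r ^ Suc n) * mult_norm (Suc n) p q) = ennreal C0" "C0 \<ge> 0"
    using fin by (simp_all add: C0_def)
  have 1: "r ^ length xs * p (prod_list xs) \<le> C0" if "xs \<noteq> []" "\<forall>x\<in>set xs. q x \<le> 1" for xs
  proof -
    obtain n where n: "length xs = Suc n" using \<open>xs \<noteq> []\<close> by (cases xs) auto
    have "ennreal (p (prod_list xs)) \<le> mult_norm (Suc n) p q"
      unfolding mult_norm_def using that n by (intro SUP_upper) auto
    then have "ennreal (r ^ Suc n) * ennreal (p (prod_list xs))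
        \<le> ennreal (r ^ Suc n) * mult_norm (Suc n) p q"
      by (rule mult_left_mono) simp
    also have "\<dots> \<le> (\<Sum>n. ennreal (r ^ Suc n) * mult_norm (Suc n) p q)"
      using sum_le_suminf[of "\<lambda>n. ennreal (r ^ Suc n) * mult_norm (Suc n) p q" "{n}"] by simp
    finally show ?thesis
      using \<open>r > 0\<close> C0 n by (simp add: ennreal_mult[symmetric] cseminormD(1)[OF p])
  qed
  \<comment> \<open>Since \<open>q x\<close> may vanish, the factors are normalised by
    \<open>q x + e\<close>; the limit \<open>e\<close> to 0 is taken in the next fact.\<close>
  have 2: "p (prod_list xs) \<le> C0 * prod_list (map (\<lambda>x. (q x + e) / r) xs)"
    if "xs \<noteq> []" "e > 0" for xs e
  proof -
    have pos: "q x + e > 0" for x using that(2) cseminormD(1)[OF q, of x] by simp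
    define k where "k = prod_list (map (\<lambda>x. 1 / (q x + e)) xs)"
    have k: "k > 0" unfolding k_def using pos by (induction xs) auto
    have "q ((1 / (q x + e)) *\<^sub>R x) \<le> 1" for x
      using pos[of x] \<open>e > 0\<close> by (simp add: cseminormD(3)[OF q])
    then have "r ^ length xs * p (k *\<^sub>R prod_list xs) \<le> C0"
      using 1[of "map (\<lambda>x. (1 / (q x + e)) *\<^sub>R x) xs"] \<open>xs \<noteq> []\<close> by (simp add: prod_list_scaleR k_def)
    then have "(k * r ^ length xs) * p (prod_list xs) \<le> C0"
      using k by (simp add: cseminormD(3)[OF p] mult_ac)
    moreover have "k * r ^ length xs * prod_list (map (\<lambda>x. (q x + e) / r) xs) = 1"
      unfolding k_def using pos \<open>r > 0\<close> 
    proof (induction xs)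
      case (Cons y ys)
      have "1 / (q y + e) * r * ((q y + e) / r) = 1" using pos[of y] \<open>r > 0\<close> by simp
      then have "(1 / (q y + e) * r * ((q y + e) / r)) *
          (prod_list (map (\<lambda>x. 1 / (q x + e)) ys) * r ^ length ys * prod_list (map (\<lambda>x. (q x + e) / r) ys)) = 1"
        using Cons.IH pos \<open>r > 0\<close> by (simp only: mult_1_left)
      then show ?case by (simp only: list.map prod_list.Cons list.size power_Suc add_Suc_right add_0_right mult_ac)
    qed simp
    moreover have "u \<le> C0 * w" if "v * u \<le> C0" "v * w = 1" "v > 0" for u v w :: real
    proof -
      have "w = 1 / v" using that by (simp add: field_simps)
      with that show ?thesis by (simp add: pos_le_divide_eq mult.commute)
    qed
    moreover have "k * r ^ length xs > 0" using k \<open>r > 0\<close> by simp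
    ultimately show ?thesis by blast
  qed
  have 3: "p (prod_list xs) \<le> C0 * prod_list (map (\<lambda>x. q x / r) xs)" if "xs \<noteq> []" for xs
  proof (rule tendsto_lowerbound)
    have "((\<lambda>e. prod_list (map (\<lambda>x. (q x + e) / r) xs)) \<longlongrightarrow> prod_list (map (\<lambda>x. (q x + 0) / r) xs))
        (at_right 0)"
    proof (induction xs)
      case (Cons y ys)
      then show ?case unfolding list.map prod_list.Cons
        by (intro tendsto_mult Cons.IH tendsto_divide tendsto_add tendsto_const tendsto_ident_at)
          (use \<open>r > 0\<close> in auto)
    qed simp
    then show "((\<lambda>e. C0 * prod_list (map (\<lambda>x. (q x + e) / r) xs))
        \<longlongrightarrow> C0 * prod_list (map (\<lambda>x. q x / r) xs)) (at_right 0)"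
      by (intro tendsto_mult tendsto_const) simp
    show "eventually (\<lambda>e. p (prod_list xs) \<le> C0 * prod_list (map (\<lambda>x. (q x + e) / r) xs)) (at_right 0)"
      using eventually_at_right_less by (rule eventually_mono) (use 2[OF that] in auto)
  qed simp
  \<comment> \<open>The series starts with products of one factor, so the empty product has to be
    covered by adding \<open>p 1\<close> to the constant.\<close>
  have "p (prod_list xs) \<le> (C0 + p 1) * prod_list (map (\<lambda>x. q x / r) xs)" for xs
  proof (cases "xs = []")
    case False
    have "prod_list (map (\<lambda>x. q x / r) xs) \<ge> 0"
      using \<open>r > 0\<close> by (induction xs) (auto simp: cseminormD(1)[OF q])
    then have "C0 * prod_list (map (\<lambda>x. q x / r) xs) \<le> (C0 + p 1) * prod_list (map (\<lambda>x. q x / r) xs)"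
      by (intro mult_right_mono) (simp_all add: cseminormD(1)[OF p])
    with 3[OF False] show ?thesis by linarith
  qed (use C0 in simp)
  then show ?thesis by blast
qed

text \<open>The seminorm \<open>N\<close> absorbs right factors, \<open>N (x y) \<le> N x Q y\<close>; the operator norm \<open>M\<close> of
  right multiplications with respect to \<open>N\<close> is then finite and submultiplicative.\<close>

lemma dominating_submult_seminorm:
  fixes p Q :: "'a::locally_convex_algebra \<Rightarrow> real"
  assumes p: "cseminorm p" and Q: "cseminorm Q"
    and prod: "\<And>xs. p (prod_list xs) \<le> C * prod_list (map Q xs)"
  shows "\<exists>P. submult_seminorm P \<and> (\<forall>x. p x \<le> P x)"
proof -
  have C: "C \<ge> 0" using prod[of "[]"] cseminormD(1)[OF p, of 1] by simp
  have opU: "open {x. Q x < 1}"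
    by (rule open_Collect_less[OF cseminormD(4)[OF Q] continuous_on_const])
  have Q0: "0 \<in> {x. Q x < 1}" by (simp add: cseminormD(5)[OF Q])
  define A where "A = {xs. \<forall>y\<in>set xs. Q y \<le> 1}"
  have A: "[] \<in> A" by (simp add: A_def)
  \<comment> \<open>Prepending a factor from the unit ball of \<open>Q\<close> to a word of
    \<open>A\<close> stays in \<open>A\<close>; hence right multiplication by such a factor cannot
    increase \<open>N\<close>.\<close>
  define N where "N x = (SUP xs\<in>A. p (x * prod_list xs))" for x
  have bd: "p (x * prod_list xs) \<le> C * Q x" if "xs \<in> A" for x xs
  proof -
    have "prod_list (map Q xs) \<le> 1 \<and> prod_list (map Q xs) \<ge> 0"
      using that unfolding A_def
      by (induction xs) (auto simp: cseminormD(1)[OF Q] intro!: mult_le_one)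
    then have "C * (Q x * prod_list (map Q xs)) \<le> C * (Q x * 1)"
      using C cseminormD(1)[OF Q, of x] by (intro mult_left_mono) auto
    with prod[of "x # xs"] show ?thesis by simp
  qed
  have N: "cseminorm N" "\<And>xs x. xs \<in> A \<Longrightarrow> p (x * prod_list xs) \<le> N x" "\<And>x. N x \<le> C * Q x"
    unfolding N_def
    by (rule cseminorm_SUP[where B = "\<lambda>x. C * Q x" and U = "{x. Q x < 1}" and b = C];
        use A bd C opU Q0 in \<open>auto simp: cseminormD[OF p] distrib_right intro: mult_left_le\<close>)+
  have N1: "N (x * y) \<le> N x" if "Q y \<le> 1" for x y
    unfolding N_def[of "x * y"]
  proof (rule cSUP_least)
    fix xs assume "xs \<in> A"
    then have "y # xs \<in> A" using that by (simp add: A_def)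
    from N(2)[OF this, of x] show "p (x * y * prod_list xs) \<le> N x" by (simp add: mult.assoc)
  qed (use A in blast)
  \<comment> \<open>If \<open>Q y = 0\<close>, every multiple of \<open>y\<close> lies in the unit
    ball and homogeneity forces \<open>N (x * y) = 0\<close>; otherwise \<open>y\<close> is
    normalised.\<close>
  have NQ: "N (x * y) \<le> N x * Q y" for x y
  proof (cases "Q y = 0")
    case True
    have "N (x * y) \<le> 0"
    proof (rule ccontr)
      assume "\<not> N (x * y) \<le> 0"
      then have pos: "N (x * y) > 0" by simp
      define t where "t = (N x + 1) / N (x * y)"
      have "N (x * (t *\<^sub>R y)) \<le> N x" by (rule N1) (simp add: cseminormD(3)[OF Q] True)
      moreover have "N (x * (t *\<^sub>R y)) = N x + 1"
        using pos cseminormD(1)[OF N(1), of x] by (simp add: cseminormD(3)[OF N(1)] t_def)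
      ultimately show False by simp
    qed
    with True show ?thesis by simp
  next
    case False
    then have pos: "Q y > 0" using cseminormD(1)[OF Q, of y] by simp
    have "N (x * ((1 / Q y) *\<^sub>R y)) \<le> N x" by (rule N1) (use pos in \<open>simp add: cseminormD(3)[OF Q]\<close>)
    with pos show ?thesis by (simp add: cseminormD(3)[OF N(1)] field_simps)
  qed
  define S where "S = {x. N x \<le> 1}"
  have "0 \<in> S" by (simp add: S_def cseminormD(5)[OF N(1)])
  define M where "M y = (SUP x\<in>S. N (x * y))" for y
  have bdM: "N (x * y) \<le> Q y" if "x \<in> S" for x y
  proof -
    have "N x * Q y \<le> 1 * Q y" using that by (intro mult_right_mono) (auto simp: S_def cseminormD(1)[OF Q])
    with NQ[of x y] show ?thesis by simp
  qed
  have M: "cseminorm M" "\<And>x y. x \<in> S \<Longrightarrow> N (x * y) \<le> M y" "\<And>y. M y \<le> Q y"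
    unfolding M_def
    by (rule cseminorm_SUP[where B = Q and U = "{x. Q x < 1}" and b = 1];
        use \<open>0 \<in> S\<close> bdM opU Q0 in \<open>auto simp: cseminormD[OF N(1)] distrib_left\<close>)+
  have NM: "N (x * y) \<le> N x * M y" for x y
  proof (cases "N x = 0")
    case True
    then show ?thesis using NQ[of x y] by simp
  next
    case False
    then have pos: "N x > 0" using cseminormD(1)[OF N(1), of x] by simp
    have "N (((1 / N x) *\<^sub>R x) * y) \<le> M y"
      by (rule M(2)) (use pos in \<open>simp add: S_def cseminormD(3)[OF N(1)]\<close>)
    with pos show ?thesis by (simp add: cseminormD(3)[OF N(1)] field_simps)
  qed
  have MM: "M (y * z) \<le> M y * M z" for y z
    unfolding M_def[of "y * z"]
  proof (rule cSUP_least)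
    fix x assume "x \<in> S"
    have "N ((x * y) * z) \<le> N (x * y) * M z" by (rule NM)
    also have "\<dots> \<le> M y * M z"
      using M(2)[OF \<open>x \<in> S\<close>] cseminormD(1)[OF M(1)] by (intro mult_right_mono)
    finally show "N (x * (y * z)) \<le> M y * M z" by (simp add: mult.assoc)
  qed (use \<open>0 \<in> S\<close> in blast)
  \<comment> \<open>From \<open>p x \<le> N (1 * x) \<le> N 1 * M x\<close> the constant must be at
    least \<open>N 1\<close>; being at least 1 it preserves submultiplicativity.\<close>
  define K where "K = max 1 (N 1)"
  have K: "K \<ge> 1" "K \<ge> N 1" by (simp_all add: K_def)
  have "open {x. M x < 1}"
    by (rule open_Collect_less[OF cseminormD(4)[OF M(1)] continuous_on_const])
  then have "cseminorm (\<lambda>x. K * M x)"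
    by (rule cseminormI[where B = K, rotated 3])
      (use K in \<open>auto simp: cseminormD(1,3,5)[OF M(1)] distrib_left[symmetric] cseminormD(2)[OF M(1)]\<close>)
  moreover have "K * M (x * y) \<le> (K * M x) * (K * M y)" for x y
  proof -
    have "1 * (K * (M x * M y)) \<le> K * (K * (M x * M y))"
      using K cseminormD(1)[OF M(1)] by (intro mult_right_mono) auto
    moreover have "K * M (x * y) \<le> K * (M x * M y)" using MM K by (intro mult_left_mono) auto
    ultimately show ?thesis by (simp add: mult_ac)
  qed
  moreover have "p x \<le> K * M x" for x
  proof -
    have "p x \<le> N (1 * x)" using N(2)[OF A, of x] by simp
    also have "\<dots> \<le> N 1 * M x" by (rule NM)
    also have "\<dots> \<le> K * M x" using K cseminormD(1)[OF M(1)] by (intro mult_right_mono)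
    finally show ?thesis .
  qed
  ultimately show ?thesis unfolding submult_seminorm_def by blast
qed

section \<open>Curves and their primitives\<close>

lemma has_curve_deriv_estimate:
  fixes F :: "real \<Rightarrow> 'a::locally_convex_space"
  assumes "has_curve_deriv F v x" "cseminorm p" "e > 0"
  shows "\<exists>d>0. \<forall>s\<in>{0..1}. \<bar>s - x\<bar> < d \<longrightarrow> p (F s - F x - (s - x) *\<^sub>R v) \<le> e * \<bar>s - x\<bar>"
proof -
  have "eventually (\<lambda>s. p ((F s - F x) /\<^sub>R (s - x) - v) < e) (at x within {0..1})"
    using assms unfolding has_curve_deriv_def by (intro tendsto_cseminormD)
  then obtain d where d: "d > 0"
    "\<And>s. s \<in> {0..1} \<Longrightarrow> s \<noteq> x \<Longrightarrow> \<bar>s - x\<bar> < d \<Longrightarrow> p ((F s - F x) /\<^sub>R (s - x) - v) < e"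
    unfolding eventually_at by (auto simp: dist_real_def)
  have "p (F s - F x - (s - x) *\<^sub>R v) \<le> e * \<bar>s - x\<bar>" if "s \<in> {0..1}" "\<bar>s - x\<bar> < d" for s
  proof (cases "s = x")
    case False
    then have "F s - F x - (s - x) *\<^sub>R v = (s - x) *\<^sub>R ((F s - F x) /\<^sub>R (s - x) - v)"
      by (simp add: scaleR_diff_right)
    then have "p (F s - F x - (s - x) *\<^sub>R v) = \<bar>s - x\<bar> * p ((F s - F x) /\<^sub>R (s - x) - v)"
      by (simp only: cseminormD(3)[OF assms(2)])
    also have "\<dots> \<le> \<bar>s - x\<bar> * e" using d(2)[OF that(1) False that(2)] by (intro mult_left_mono) auto
    finally show ?thesis by (simp add: mult.commute)
  qed (simp add: cseminormD(5)[OF assms(2)])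
  with d(1) show ?thesis by blast
qed

text \<open>A quadratic remainder is what integrating a Lipschitz function yields; the constant may
  depend on the seminorm.\<close>

lemma has_curve_derivI:
  fixes F :: "real \<Rightarrow> 'a::locally_convex_space"
  assumes "\<And>p. cseminorm p \<Longrightarrow> \<exists>C. \<forall>s\<in>{0..1}. p (F s - F t - (s - t) *\<^sub>R v) \<le> C * (s - t)\<^sup>2"
  shows "has_curve_deriv F v t"
  unfolding has_curve_deriv_def
proof (rule tendsto_cseminormI)
  fix p :: "'a \<Rightarrow> real" and e :: real
  assume p: "cseminorm p" and "e > 0"
  obtain C where C: "\<And>s. s \<in> {0..1} \<Longrightarrow> p (F s - F t - (s - t) *\<^sub>R v) \<le> C * (s - t)\<^sup>2"
    using assms[OF p] by blast
  have "p ((F s - F t) /\<^sub>R (s - t) - v) < e"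
    if s: "s \<in> {0..1}" "s \<noteq> t" "\<bar>s - t\<bar> < e / (\<bar>C\<bar> + 1)" for s
  proof -
    have "(F s - F t) /\<^sub>R (s - t) - v = (1 / (s - t)) *\<^sub>R (F s - F t - (s - t) *\<^sub>R v)"
      using s(2) by (simp add: scaleR_diff_right inverse_eq_divide)
    then have "p ((F s - F t) /\<^sub>R (s - t) - v) = p (F s - F t - (s - t) *\<^sub>R v) / \<bar>s - t\<bar>"
      by (simp add: cseminormD(3)[OF p])
    also have "\<dots> \<le> C * \<bar>s - t\<bar>\<^sup>2 / \<bar>s - t\<bar>" using C[OF s(1)] by (intro divide_right_mono) auto
    also have "\<dots> = C * \<bar>s - t\<bar>" using s(2) by (simp add: power2_eq_square del: power2_abs abs_mult_self_eq)
    also have "\<dots> \<le> (\<bar>C\<bar> + 1) * \<bar>s - t\<bar>" by (intro mult_right_mono) auto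
    also have "\<dots> < e" using s(3) by (simp add: pos_less_divide_eq add_pos_nonneg mult.commute)
    finally show ?thesis .
  qed
  moreover have "e / (\<bar>C\<bar> + 1) > 0" using \<open>e > 0\<close> by (simp add: add_pos_nonneg)
  ultimately show "eventually (\<lambda>s. p ((F s - F t) /\<^sub>R (s - t) - v) < e) (at t within {0..1})"
    unfolding eventually_at by (auto simp: dist_real_def intro!: exI[of _ "e / (\<bar>C\<bar> + 1)"])
qed

text \<open>With a slack \<open>e * (b - a)\<close> the inequality adds up over adjacent intervals
  and holds on short intervals around each point, so bisection makes it global. The comparison
  function \<phi> is kept general in order to admit exponential weights later.\<close>

lemma seminorm_mean_value:
  fixes F :: "real \<Rightarrow> 'a::locally_convex_space"
  assumes p: "cseminorm p"
    and F: "\<And>t. t \<in> {0..1} \<Longrightarrow> has_curve_deriv F (f t) t"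
    and \<phi>: "\<And>t. t \<in> {0..1} \<Longrightarrow> (\<phi> has_real_derivative \<phi>' t) (at t within {0..1})"
    and le: "\<And>t. t \<in> {0..1} \<Longrightarrow> p (f t) \<le> \<phi>' t"
    and ab: "0 \<le> a" "a \<le> b" "b \<le> 1"
  shows "p (F b - F a) \<le> \<phi> b - \<phi> a"
proof (rule field_le_epsilon)
  fix e :: real assume "e > 0"
  have "0 \<le> a \<and> b \<le> 1 \<longrightarrow> p (F b - F a) \<le> \<phi> b - \<phi> a + e * (b - a)"
    using \<open>a \<le> b\<close>
  proof (induction rule: Bolzano)
    case (trans a b c)
    show ?case
    proof
      assume "0 \<le> a \<and> c \<le> 1"
      moreover have "p (F c - F a) \<le> p (F c - F b) + p (F b - F a)"
        using cseminormD(2)[OF p, of "F c - F b" "F b - F a"] by simp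
      ultimately show "p (F c - F a) \<le> \<phi> c - \<phi> a + e * (c - a)"
        using trans by (auto simp: algebra_simps)
    qed
  next
    case (local x)
    then have x: "x \<in> {0..1}" using ab by auto
    \<comment> \<open>One half of the slack pays for linearising \<open>F\<close>, the other for
      linearising \<phi>.\<close>
    have e2: "e / 2 > 0" using \<open>e > 0\<close> by simp
    obtain d1 where d1: "d1 > 0"
      "\<And>s. s \<in> {0..1} \<Longrightarrow> \<bar>s - x\<bar> < d1 \<Longrightarrow> p (F s - F x - (s - x) *\<^sub>R f x) \<le> e / 2 * \<bar>s - x\<bar>"
      using has_curve_deriv_estimate[OF F[OF x] p e2] by blast
    have "\<exists>d>0. \<forall>s\<in>{0..1}. norm (s - x) < d \<longrightarrow> norm (\<phi> s - \<phi> x - \<phi>' x * (s - x)) \<le> e / 2 * norm (s - x)"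
      using \<phi>[OF x] e2 unfolding has_field_derivative_def has_derivative_within_alt by blast
    then obtain d2 where d2: "d2 > 0"
      "\<And>s. s \<in> {0..1} \<Longrightarrow> \<bar>s - x\<bar> < d2 \<Longrightarrow> \<bar>\<phi> s - \<phi> x - \<phi>' x * (s - x)\<bar> \<le> e / 2 * \<bar>s - x\<bar>"
      by auto
    have "p (F v - F u) \<le> \<phi> v - \<phi> u + e * (v - u)"
      if uv: "u \<le> x" "x \<le> v" "v - u < min d1 d2" "0 \<le> u" "v \<le> 1" for u v
    proof -
      let ?E = "\<lambda>s. F s - F x - (s - x) *\<^sub>R f x"
      have u: "p (?E u) \<le> e / 2 * (x - u)" "\<bar>\<phi> u - \<phi> x - \<phi>' x * (u - x)\<bar> \<le> e / 2 * (x - u)"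
        using d1(2)[of u] d2(2)[of u] uv by auto
      from u(2) have u2: "\<phi> u \<le> \<phi> x + \<phi>' x * (u - x) + e / 2 * (x - u)" by linarith
      have v: "p (?E v) \<le> e / 2 * (v - x)" "\<bar>\<phi> v - \<phi> x - \<phi>' x * (v - x)\<bar> \<le> e / 2 * (v - x)"
        using d1(2)[of v] d2(2)[of v] uv by auto
      from v(2) have v2: "\<phi> v \<ge> \<phi> x + \<phi>' x * (v - x) - e / 2 * (v - x)" by linarith
      have "F v - F u = (?E v - ?E u) + (v - u) *\<^sub>R f x" by (simp add: algebra_simps)
      then have "p (F v - F u) \<le> p (?E v - ?E u) + p ((v - u) *\<^sub>R f x)"
        by (simp only: cseminormD(2)[OF p])
      also have "p (?E v - ?E u) \<le> p (?E v) + p (?E u)" by (rule cseminormD(7)[OF p])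
      also have "p ((v - u) *\<^sub>R f x) \<le> (v - u) * \<phi>' x"
        using uv le[OF x] by (simp add: cseminormD(3)[OF p] mult_left_mono)
      finally have "p (F v - F u) \<le> e / 2 * (v - x) + e / 2 * (x - u) + (v - u) * \<phi>' x"
        using u(1) v(1) by linarith
      with u2 v2 show ?thesis by (simp add: algebra_simps add_divide_distrib diff_divide_distrib)
    qed
    then show ?case using d1(1) d2(1) by (intro exI[of _ "min d1 d2"]) auto
  qed
  then have "p (F b - F a) \<le> \<phi> b - \<phi> a + e * (b - a)" using ab by simp
  also have "e * (b - a) \<le> e * 1" using ab \<open>e > 0\<close> by (intro mult_left_mono) auto
  finally show "p (F b - F a) \<le> \<phi> b - \<phi> a + e" by simp
qed

lemma seminorm_mean_value_bound:
  fixes F :: "real \<Rightarrow> 'a::locally_convex_space"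
  assumes p: "cseminorm p"
    and F: "\<And>t. t \<in> {0..1} \<Longrightarrow> has_curve_deriv F (f t) t"
    and le: "\<And>t. t \<in> {0..1} \<Longrightarrow> p (f t) \<le> M"
    and st: "s \<in> {0..1}" "t \<in> {0..1}"
  shows "p (F t - F s) \<le> M * \<bar>t - s\<bar>"
proof -
  have le': "p (F b - F a) \<le> M * b - M * a" if "0 \<le> a" "a \<le> b" "b \<le> 1" for a b
    by (rule seminorm_mean_value[where \<phi>' = "\<lambda>_. M", OF p F _ le that])
      (auto intro!: derivative_eq_intros)
  show ?thesis
  proof (cases "s \<le> t")
    case True
    then show ?thesis using le'[of s t] st by (simp add: algebra_simps)
  next
    case False
    then show ?thesis using le'[of t s] st by (simp add: algebra_simps cseminormD(8)[OF p, of "F t"])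
  qed
qed

section \<open>Rules for derivatives of curves\<close>

lemma has_curve_deriv_const: "has_curve_deriv (\<lambda>_. c) (0::'a::locally_convex_space) t"
  by (simp add: has_curve_deriv_def)

lemma has_curve_deriv_add:
  fixes F G :: "real \<Rightarrow> 'a::locally_convex_space"
  shows "has_curve_deriv F v t \<Longrightarrow> has_curve_deriv G w t \<Longrightarrow> has_curve_deriv (\<lambda>s. F s + G s) (v + w) t"
  using has_curve_deriv_lincomb[of F v t G w 1 1] by simp

lemma has_curve_deriv_diff:
  fixes F G :: "real \<Rightarrow> 'a::locally_convex_space"
  shows "has_curve_deriv F v t \<Longrightarrow> has_curve_deriv G w t \<Longrightarrow> has_curve_deriv (\<lambda>s. F s - G s) (v - w) t"
  using has_curve_deriv_lincomb[of F v t G w 1 "-1"] by simp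

lemma has_curve_deriv_scaleR:
  fixes F :: "real \<Rightarrow> 'a::locally_convex_space"
  shows "has_curve_deriv F v t \<Longrightarrow> has_curve_deriv (\<lambda>s. c *\<^sub>R F s) (c *\<^sub>R v) t"
  using has_curve_deriv_lincomb[of F v t F v c 0] by simp

lemma has_curve_deriv_sum:
  fixes F :: "'i \<Rightarrow> real \<Rightarrow> 'a::locally_convex_space"
  assumes "\<And>i. i \<in> S \<Longrightarrow> has_curve_deriv (F i) (v i) t"
  shows "has_curve_deriv (\<lambda>s. \<Sum>i\<in>S. F i s) (\<Sum>i\<in>S. v i) t"
  using assms
  by (induction S rule: infinite_finite_induct) (simp_all add: has_curve_deriv_const has_curve_deriv_add)

lemma has_curve_deriv_scaleR_const:
  fixes x :: "'a::locally_convex_space"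
  assumes "(\<phi> has_real_derivative c) (at t within {0..1})"
  shows "has_curve_deriv (\<lambda>s. \<phi> s *\<^sub>R x) (c *\<^sub>R x) t"
proof -
  have "((\<lambda>s. (\<phi> s - \<phi> t) / (s - t)) \<longlongrightarrow> c) (at t within {0..1})"
    using assms by (simp add: has_field_derivative_iff)
  then have "((\<lambda>s. ((\<phi> s - \<phi> t) / (s - t)) *\<^sub>R x) \<longlongrightarrow> c *\<^sub>R x) (at t within {0..1})"
    by (intro tendsto_scaleR_lcs tendsto_const)
  then show ?thesis by (simp add: has_curve_deriv_def scaleR_diff_left[symmetric] divide_inverse mult.commute)
qed

lemma has_curve_deriv_tendsto:
  fixes F :: "real \<Rightarrow> 'a::locally_convex_space"
  assumes "has_curve_deriv F v t"
  shows "(F \<longlongrightarrow> F t) (at t within {0..1})"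
proof -
  have "((\<lambda>s. F t + (s - t) *\<^sub>R ((F s - F t) /\<^sub>R (s - t))) \<longlongrightarrow> F t + (t - t) *\<^sub>R v) (at t within {0..1})"
    using assms unfolding has_curve_deriv_def
    by (intro tendsto_add tendsto_scaleR_lcs tendsto_diff tendsto_const tendsto_ident_at)
  moreover have "eventually (\<lambda>s. F t + (s - t) *\<^sub>R ((F s - F t) /\<^sub>R (s - t)) = F s) (at t within {0..1})"
    by (simp add: eventually_at_filter)
  ultimately show ?thesis by (auto dest: Lim_transform_eventually)
qed

lemma continuous_on_if_has_curve_deriv:
  fixes F :: "real \<Rightarrow> 'a::locally_convex_space"
  assumes "\<And>t. t \<in> {0..1} \<Longrightarrow> has_curve_deriv F (f t) t"
  shows "continuous_on {0..1} F"
  unfolding continuous_on_def using assms has_curve_deriv_tendsto by blast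

lemma has_curve_deriv_mult:
  fixes F G :: "real \<Rightarrow> 'a::locally_convex_algebra"
  assumes "has_curve_deriv F v t" "has_curve_deriv G w t"
  shows "has_curve_deriv (\<lambda>s. F s * G s) (v * G t + F t * w) t"
proof -
  have "((\<lambda>s. ((F s - F t) /\<^sub>R (s - t)) * G s + F t * ((G s - G t) /\<^sub>R (s - t)))
      \<longlongrightarrow> v * G t + F t * w) (at t within {0..1})"
    using assms has_curve_deriv_tendsto[OF assms(2)] unfolding has_curve_deriv_def
    by (intro tendsto_add tendsto_mult tendsto_const)
  moreover have "((F s - F t) /\<^sub>R (s - t)) * G s + F t * ((G s - G t) /\<^sub>R (s - t))
      = (F s * G s - F t * G t) /\<^sub>R (s - t)" for s
    by (simp add: algebra_simps)
  ultimately show ?thesis by (simp add: has_curve_deriv_def)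
qed

section \<open>Bounded and Lipschitz curves\<close>

lemma seminorm_bounded_if_continuous:
  fixes f :: "real \<Rightarrow> 'a::locally_convex_space"
  assumes "continuous_on {0..1} f" "cseminorm p"
  shows "\<exists>M. \<forall>t\<in>{0..1}. p (f t) \<le> M"
proof -
  have "continuous_on {0..1} (\<lambda>t. p (f t))"
    using continuous_on_compose2[OF cseminormD(4)[OF assms(2)] assms(1)] by simp
  then have "compact ((\<lambda>t. p (f t)) ` {0..1})" by (rule compact_continuous_image) simp
  then show ?thesis by (meson bdd_above.E bounded_imp_bdd_above compact_imp_bounded imageI)
qed

text \<open>The seminorm version of \<open>lipschitz_curve\<close>. In this form stability under
  sums and products is a direct estimate, and the class is the one for which Mackey completeness
  supplies integrals.\<close>

definition lip_curve :: "(real \<Rightarrow> 'a::{real_vector,topological_space}) \<Rightarrow> bool"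
  where "lip_curve f \<longleftrightarrow>
    (\<forall>p. cseminorm p \<longrightarrow> (\<exists>L. \<forall>s\<in>{0..1}. \<forall>t\<in>{0..1}. p (f t - f s) \<le> L * \<bar>t - s\<bar>))"

lemma lip_curveI:
  assumes "\<And>p. cseminorm p \<Longrightarrow> \<exists>L. \<forall>s\<in>{0..1}. \<forall>t\<in>{0..1}. s \<le> t \<longrightarrow> p (f t - f s) \<le> L * (t - s)"
  shows "lip_curve f"
  unfolding lip_curve_def
proof (intro allI impI)
  fix p :: "'a \<Rightarrow> real" assume p: "cseminorm p"
  obtain L where L: "\<And>s t. s \<in> {0..1} \<Longrightarrow> t \<in> {0..1} \<Longrightarrow> s \<le> t \<Longrightarrow> p (f t - f s) \<le> L * (t - s)"
    using assms[OF p] by blast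
  have "p (f t - f s) \<le> L * \<bar>t - s\<bar>" if "s \<in> {0..1}" "t \<in> {0..1}" for s t
    using L[of s t] L[of t s] that cseminormD(8)[OF p, of "f s" "f t"] by (cases "s \<le> t") auto
  then show "\<exists>L. \<forall>s\<in>{0..1}. \<forall>t\<in>{0..1}. p (f t - f s) \<le> L * \<bar>t - s\<bar>" by blast
qed

lemma lip_curveD:
  assumes "lip_curve f" "cseminorm p"
  obtains L where "L > 0" "\<And>s t. s \<in> {0..1} \<Longrightarrow> t \<in> {0..1} \<Longrightarrow> p (f t - f s) \<le> L * \<bar>t - s\<bar>"
proof -
  obtain L where L: "\<And>s t. s \<in> {0..1} \<Longrightarrow> t \<in> {0..1} \<Longrightarrow> p (f t - f s) \<le> L * \<bar>t - s\<bar>"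
    using assms unfolding lip_curve_def by blast
  show ?thesis
  proof (rule that)
    show "\<bar>L\<bar> + 1 > 0" by simp
    fix s t :: real assume "s \<in> {0..1}" "t \<in> {0..1}"
    then have "p (f t - f s) \<le> L * \<bar>t - s\<bar>" by (rule L)
    also have "\<dots> \<le> (\<bar>L\<bar> + 1) * \<bar>t - s\<bar>" by (intro mult_right_mono) auto
    finally show "p (f t - f s) \<le> (\<bar>L\<bar> + 1) * \<bar>t - s\<bar>" .
  qed
qed

lemma lip_curve_bounded:
  assumes "lip_curve f" "cseminorm p"
  obtains M where "M > 0" "\<And>t. t \<in> {0..1} \<Longrightarrow> p (f t) \<le> M"
proof -
  obtain L where L: "L > 0" "\<And>s t. s \<in> {0..1} \<Longrightarrow> t \<in> {0..1} \<Longrightarrow> p (f t - f s) \<le> L * \<bar>t - s\<bar>"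
    using lip_curveD[OF assms] by metis
  show ?thesis
  proof (rule that)
    show "p (f 0) + L > 0" using L(1) cseminormD(1)[OF assms(2), of "f 0"] by simp
    fix t :: real assume t: "t \<in> {0..1}"
    have "p (f t) \<le> p (f t - f 0) + p (f 0)"
      using cseminormD(2)[OF assms(2), of "f t - f 0" "f 0"] by simp
    also have "p (f t - f 0) \<le> L * t" using L(2)[of 0 t] t by simp
    also have "L * t \<le> L * 1" using t L(1) by (intro mult_left_mono) auto
    finally show "p (f t) \<le> p (f 0) + L" by simp
  qed
qed

lemma lip_curve_const: "lip_curve (\<lambda>_. c)"
  by (auto simp: lip_curve_def cseminormD(5) intro: exI[of _ 0])

lemma lip_curve_add:
  assumes "lip_curve f" "lip_curve g"
  shows "lip_curve (\<lambda>t. f t + g t)"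
  unfolding lip_curve_def
proof (intro allI impI)
  fix p :: "'a \<Rightarrow> real" assume p: "cseminorm p"
  obtain L where L: "\<And>s t. s \<in> {0..1} \<Longrightarrow> t \<in> {0..1} \<Longrightarrow> p (f t - f s) \<le> L * \<bar>t - s\<bar>"
    using lip_curveD[OF assms(1) p] by metis
  obtain K where K: "\<And>s t. s \<in> {0..1} \<Longrightarrow> t \<in> {0..1} \<Longrightarrow> p (g t - g s) \<le> K * \<bar>t - s\<bar>"
    using lip_curveD[OF assms(2) p] by metis
  have "p (f t + g t - (f s + g s)) \<le> (L + K) * \<bar>t - s\<bar>" if "s \<in> {0..1}" "t \<in> {0..1}" for s t
    using cseminormD(2)[OF p, of "f t - f s" "g t - g s"] L[OF that] K[OF that]
    by (simp add: algebra_simps)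
  then show "\<exists>L. \<forall>s\<in>{0..1}. \<forall>t\<in>{0..1}. p (f t + g t - (f s + g s)) \<le> L * \<bar>t - s\<bar>" by blast
qed

lemma lip_curve_scaleR:
  assumes "lip_curve f"
  shows "lip_curve (\<lambda>t. c *\<^sub>R f t)"
  unfolding lip_curve_def
proof (intro allI impI)
  fix p :: "'a \<Rightarrow> real" assume p: "cseminorm p"
  obtain L where L: "\<And>s t. s \<in> {0..1} \<Longrightarrow> t \<in> {0..1} \<Longrightarrow> p (f t - f s) \<le> L * \<bar>t - s\<bar>"
    using lip_curveD[OF assms p] by metis
  have "p (c *\<^sub>R f t - c *\<^sub>R f s) \<le> (\<bar>c\<bar> * L) * \<bar>t - s\<bar>" if "s \<in> {0..1}" "t \<in> {0..1}" for s t
    using mult_left_mono[OF L[OF that], of "\<bar>c\<bar>"]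
    by (simp add: scaleR_diff_right[symmetric] cseminormD(3)[OF p])
  then show "\<exists>L. \<forall>s\<in>{0..1}. \<forall>t\<in>{0..1}. p (c *\<^sub>R f t - c *\<^sub>R f s) \<le> L * \<bar>t - s\<bar>" by blast
qed

lemma lip_curve_if_bounded_deriv:
  fixes F :: "real \<Rightarrow> 'a::locally_convex_space"
  assumes "\<And>t. t \<in> {0..1} \<Longrightarrow> has_curve_deriv F (f t) t"
    and "\<And>p. cseminorm p \<Longrightarrow> \<exists>M. \<forall>t\<in>{0..1}. p (f t) \<le> M"
  shows "lip_curve F"
  unfolding lip_curve_def using seminorm_mean_value_bound[OF _ assms(1)] assms(2) by blast

lemma lipschitz_curve_if_lip_curve:
  fixes f :: "real \<Rightarrow> 'a::locally_convex_space"
  assumes "lip_curve f"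
  shows "lipschitz_curve f"
  unfolding lipschitz_curve_def
proof (rule bounded_subsetI)
  fix p :: "'a \<Rightarrow> real" assume p: "cseminorm p"
  obtain L where L: "\<And>s t. s \<in> {0..1} \<Longrightarrow> t \<in> {0..1} \<Longrightarrow> p (f t - f s) \<le> L * \<bar>t - s\<bar>"
    using lip_curveD[OF assms p] by metis
  have "p ((f t - f s) /\<^sub>R (t - s)) \<le> L" if "s \<in> {0..1}" "t \<in> {0..1}" "s \<noteq> t" for s t
  proof -
    have "p ((f t - f s) /\<^sub>R (t - s)) = p (f t - f s) / \<bar>t - s\<bar>"
      by (simp add: cseminormD(3)[OF p] divide_inverse mult.commute)
    also have "\<dots> \<le> L" using L[OF that(1,2)] that(3) by (simp add: pos_divide_le_eq)
    finally show ?thesis .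
  qed
  then show "\<exists>M. \<forall>x\<in>{(f t - f s) /\<^sub>R (t - s) |s t. s \<in> {0..1} \<and> t \<in> {0..1} \<and> s \<noteq> t}. p x \<le> M"
    by blast
qed

text \<open>Only one tagged division is needed, fine for the balls of the Riemann integrals and for
  the gauges of the scalar Henstock-Kurzweil integrals.\<close>

lemma riemann_integral_diff_estimate:
  fixes g1 g2 :: "real \<Rightarrow> 'a::locally_convex_space"
  assumes p: "cseminorm p"
    and g1: "has_riemann_integral g1 I1" and g2: "has_riemann_integral g2 I2"
    and \<psi>: "(\<psi> has_integral a) {0..1}" and \<phi>: "(\<phi> has_integral b) {0..1}"
    and le: "\<And>s. s \<in> {0..1} \<Longrightarrow> p (g1 s - g2 s - \<psi> s *\<^sub>R v) \<le> \<phi> s"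
  shows "p (I1 - I2 - a *\<^sub>R v) \<le> b"
proof (rule field_le_epsilon)
  fix e :: real assume "e > 0"
  \<comment> \<open>Chosen so that the error of the scalar sum for \<psi>, multiplied by
    \<open>p v\<close>, is at most \<open>e / 4\<close>; adding 1 avoids a zero denominator. The
    other three quarters of \<open>e\<close> go to the two Riemann sums and to \<phi>.\<close>
  define c where "c = e / (4 * (1 + p v))"
  have pv: "p v \<ge> 0" by (rule cseminormD(1)[OF p])
  have c: "c > 0" using \<open>e > 0\<close> pv by (simp add: c_def add_pos_nonneg)
  have op: "open {x. p (x - I) < e / 4}" for I
    by (intro open_Collect_less continuous_on_compose2[OF cseminormD(4)[OF p]] continuous_intros) auto
  have mem: "I \<in> {x. p (x - I) < e / 4}" for I using \<open>e > 0\<close> by (simp add: cseminormD(5)[OF p])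
  obtain \<delta>1 where \<delta>1: "\<delta>1 > 0" "\<And>\<D>. \<D> tagged_division_of {0..1} \<Longrightarrow> (\<lambda>t. ball t \<delta>1) fine \<D> \<Longrightarrow>
      (\<Sum>(t, J)\<in>\<D>. measure lborel J *\<^sub>R g1 t) \<in> {x. p (x - I1) < e / 4}"
    using g1[unfolded has_riemann_integral_def, THEN spec, THEN mp, OF conjI[OF op mem]] by meson
  obtain \<delta>2 where \<delta>2: "\<delta>2 > 0" "\<And>\<D>. \<D> tagged_division_of {0..1} \<Longrightarrow> (\<lambda>t. ball t \<delta>2) fine \<D> \<Longrightarrow>
      (\<Sum>(t, J)\<in>\<D>. measure lborel J *\<^sub>R g2 t) \<in> {x. p (x - I2) < e / 4}"
    using g2[unfolded has_riemann_integral_def, THEN spec, THEN mp, OF conjI[OF op mem]] by meson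
  obtain \<gamma>1 where \<gamma>1: "gauge \<gamma>1" "\<And>\<D>. \<D> tagged_division_of {0..1} \<Longrightarrow> \<gamma>1 fine \<D> \<Longrightarrow>
      norm ((\<Sum>(t, J)\<in>\<D>. measure lborel J *\<^sub>R \<psi> t) - a) < c"
    using \<psi>[unfolded has_integral_real, THEN spec, THEN mp, OF c] by meson
  have "e / 4 > 0" using \<open>e > 0\<close> by simp
  then obtain \<gamma>2 where \<gamma>2: "gauge \<gamma>2" "\<And>\<D>. \<D> tagged_division_of {0..1} \<Longrightarrow> \<gamma>2 fine \<D> \<Longrightarrow>
      norm ((\<Sum>(t, J)\<in>\<D>. measure lborel J *\<^sub>R \<phi> t) - b) < e / 4"
    using \<phi>[unfolded has_integral_real, THEN spec, THEN mp] by meson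
  have "gauge (\<lambda>x. (ball x \<delta>1 \<inter> ball x \<delta>2) \<inter> (\<gamma>1 x \<inter> \<gamma>2 x))"
    by (intro gauge_Int gauge_ball \<delta>1 \<delta>2 \<gamma>1 \<gamma>2)
  from fine_division_exists_real[OF this, of 0 1] obtain D where D: "D tagged_division_of {0..1}"
    and "(\<lambda>x. (ball x \<delta>1 \<inter> ball x \<delta>2) \<inter> (\<gamma>1 x \<inter> \<gamma>2 x)) fine D"
    by blast
  then have fine: "(\<lambda>x. ball x \<delta>1) fine D" "(\<lambda>x. ball x \<delta>2) fine D" "\<gamma>1 fine D" "\<gamma>2 fine D"
    by (auto simp: fine_Int)
  define S1 where "S1 = (\<Sum>(t, J)\<in>D. measure lborel J *\<^sub>R g1 t)"
  define S2 where "S2 = (\<Sum>(t, J)\<in>D. measure lborel J *\<^sub>R g2 t)"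
  define S where "S = (\<Sum>(t, J)\<in>D. measure lborel J *\<^sub>R \<psi> t)"
  define T where "T = (\<Sum>(t, J)\<in>D. measure lborel J *\<^sub>R \<phi> t)"
  have 1: "p (S1 - I1) < e / 4" "p (S2 - I2) < e / 4" "\<bar>S - a\<bar> < c" "T < b + e / 4"
    using \<delta>1(2)[OF D fine(1), folded S1_def] \<delta>2(2)[OF D fine(2), folded S2_def]
      \<gamma>1(2)[OF D fine(3), folded S_def] \<gamma>2(2)[OF D fine(4), folded T_def]
    by (simp_all add: abs_if split: if_splits)
  have "S1 - S2 - S *\<^sub>R v = (\<Sum>(t, J)\<in>D. measure lborel J *\<^sub>R (g1 t - g2 t - \<psi> t *\<^sub>R v))"
    unfolding S1_def S2_def S_def scaleR_sum_left sum_subtractf[symmetric]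
    by (intro sum.cong) (auto simp: algebra_simps)
  then have "p (S1 - S2 - S *\<^sub>R v) \<le> (\<Sum>z\<in>D. p (case z of (t, J) \<Rightarrow> measure lborel J *\<^sub>R (g1 t - g2 t - \<psi> t *\<^sub>R v)))"
    using cseminorm_sum[OF p] by (simp only:)
  also have "\<dots> \<le> T"
    unfolding T_def
  proof (rule sum_mono)
    fix z assume "z \<in> D"
    then obtain t J where z: "z = (t, J)" "t \<in> {0..1}"
      using tag_in_interval[OF D] by (metis surj_pair)
    show "p (case z of (t, J) \<Rightarrow> measure lborel J *\<^sub>R (g1 t - g2 t - \<psi> t *\<^sub>R v))
        \<le> (case z of (t, J) \<Rightarrow> measure lborel J *\<^sub>R \<phi> t)"
      using le[OF z(2)] by (simp add: z(1) cseminormD(3)[OF p] mult_left_mono)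
  qed
  finally have 2: "p (S1 - S2 - S *\<^sub>R v) \<le> T" .
  have "\<bar>S - a\<bar> * p v \<le> c * (1 + p v)" using 1 pv by (intro mult_mono) auto
  also have "\<dots> = e / 4"
  proof -
    have "e / (4 * k) * k = e / 4" if "k > 0" for k :: real using that by simp
    then show ?thesis unfolding c_def using pv by (simp only: add_pos_nonneg zero_less_one)
  qed
  finally have 3: "p ((S - a) *\<^sub>R v) \<le> e / 4" by (simp add: cseminormD(3)[OF p])
  have "I1 - I2 - a *\<^sub>R v = (S1 - S2 - S *\<^sub>R v) + ((S - a) *\<^sub>R v - ((S1 - I1) - (S2 - I2)))"
    by (simp add: algebra_simps)
  then have "p (I1 - I2 - a *\<^sub>R v) \<le> p (S1 - S2 - S *\<^sub>R v) + p ((S - a) *\<^sub>R v - ((S1 - I1) - (S2 - I2)))"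
    by (simp only: cseminormD(2)[OF p])
  also have "p ((S - a) *\<^sub>R v - ((S1 - I1) - (S2 - I2))) \<le> p ((S - a) *\<^sub>R v) + p ((S1 - I1) - (S2 - I2))"
    by (rule cseminormD(7)[OF p])
  also have "p ((S1 - I1) - (S2 - I2)) \<le> p (S1 - I1) + p (S2 - I2)" by (rule cseminormD(7)[OF p])
  finally show "p (I1 - I2 - a *\<^sub>R v) \<le> b + e" using 1 2 3 by simp
qed

text \<open>With \<open>I t\<close> the integral of the curve stopped at time \<open>t\<close>, the primitive is \<open>I t - (1 - t) f t\<close>.\<close>

lemma primitive_exists:
  fixes f :: "real \<Rightarrow> 'a::locally_convex_space"
  assumes mc: "mackey_complete TYPE('a)" and f: "lip_curve f"
  shows "\<exists>F. F 0 = 0 \<and> (\<forall>t\<in>{0..1}. has_curve_deriv F (f t) t)"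
proof -
  have "\<exists>I. has_riemann_integral (\<lambda>s. f (min s t)) I" if "t \<in> {0..1}" for t
  proof -
    \<comment> \<open>Integrals are available over [0,1] only. Stopping the curve at
      \<open>t\<close> keeps it Lipschitz, which cutting it off to zero would not.\<close>
    have "lip_curve (\<lambda>s. f (min s t))"
    proof (rule lip_curveI)
      fix p :: "'a \<Rightarrow> real" assume p: "cseminorm p"
      obtain L where L: "L > 0" "\<And>s t. s \<in> {0..1} \<Longrightarrow> t \<in> {0..1} \<Longrightarrow> p (f t - f s) \<le> L * \<bar>t - s\<bar>"
        using lip_curveD[OF f p] by metis
      have "p (f (min s' t) - f (min s t)) \<le> L * (s' - s)"
        if "s \<in> {0..1}" "s' \<in> {0..1}" "s \<le> s'" for s s'
      proof -
        have "p (f (min s' t) - f (min s t)) \<le> L * \<bar>min s' t - min s t\<bar>"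
          using that \<open>t \<in> {0..1}\<close> by (intro L(2)) auto
        also have "\<dots> \<le> L * (s' - s)" using L(1) that(3) by (intro mult_left_mono) auto
        finally show ?thesis .
      qed
      then show "\<exists>L. \<forall>s\<in>{0..1}. \<forall>s'\<in>{0..1}. s \<le> s' \<longrightarrow> p (f (min s' t) - f (min s t)) \<le> L * (s' - s)"
        by blast
    qed
    then show ?thesis using mc lipschitz_curve_if_lip_curve unfolding mackey_complete_def by blast
  qed
  then obtain I where I: "\<And>t. t \<in> {0..1} \<Longrightarrow> has_riemann_integral (\<lambda>s. f (min s t)) (I t)"
    by metis
  define F where "F t = I t - (1 - t) *\<^sub>R f t" for t
  have F: "has_curve_deriv F (f t) t" if t: "t \<in> {0..1}" for t
  proof (rule has_curve_derivI)
    fix p :: "'a \<Rightarrow> real" assume p: "cseminorm p"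
    obtain L where L: "L > 0" "\<And>s t. s \<in> {0..1} \<Longrightarrow> t \<in> {0..1} \<Longrightarrow> p (f t - f s) \<le> L * \<bar>t - s\<bar>"
      using lip_curveD[OF f p] by metis
    have key: "p (F b - F a - (b - a) *\<^sub>R f a) \<le> L * (b - a)\<^sup>2" if ab: "a \<in> {0..1}" "b \<in> {0..1}" "a \<le> b" for a b
    proof -
      \<comment> \<open>After time \<open>b\<close> the two stopped curves differ by the constant
        \<open>f b - f a\<close>, which \<psi> removes exactly; on [a,b] they differ by at most
        \<open>L * (b - a)\<close>, and \<phi> integrates this to the quadratic remainder.\<close>
      have \<psi>: "((\<lambda>s. if s \<in> {b..1} then 1 else 0 :: real) has_integral (1 - b)) {0..1}"
        using has_integral_const_real[of "1::real" b 1] ab by (subst has_integral_restrict) auto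
      have \<phi>: "((\<lambda>s. if s \<in> {a..b} then L * (b - a) else 0) has_integral L * (b - a)\<^sup>2) {0..1}"
        using has_integral_const_real[of "L * (b - a)" a b] ab
        by (subst has_integral_restrict) (auto simp: power2_eq_square mult_ac)
      have "p (I b - I a - (1 - b) *\<^sub>R (f b - f a)) \<le> L * (b - a)\<^sup>2"
      proof (rule riemann_integral_diff_estimate[OF p I[OF ab(2)] I[OF ab(1)] \<psi> \<phi>])
        fix s :: real assume s: "s \<in> {0..1}"
        consider "s < a" | "a \<le> s" "s < b" | "b \<le> s" by linarith
        then show "p (f (min s b) - f (min s a) - (if s \<in> {b..1} then 1 else 0) *\<^sub>R (f b - f a))
            \<le> (if s \<in> {a..b} then L * (b - a) else 0)"
        proof cases
          case 1
          then show ?thesis using ab by (simp add: cseminormD(5)[OF p])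
        next
          case 2
          have "p (f s - f a) \<le> L * (s - a)" using L(2)[of a s] ab s 2 by simp
          also have "\<dots> \<le> L * (b - a)" using L(1) 2 by (intro mult_left_mono) auto
          finally show ?thesis using 2 by simp
        next
          case 3
          then show ?thesis using ab s L(1) by (simp add: cseminormD(5)[OF p])
        qed
      qed
      then show ?thesis by (simp add: F_def algebra_simps)
    qed
    have "p (F s - F t - (s - t) *\<^sub>R f t) \<le> (2 * L) * (s - t)\<^sup>2" if s: "s \<in> {0..1}" for s
    proof (cases "t \<le> s")
      case True
      then show ?thesis using key[OF t s] L(1) by (smt (verit) mult_right_mono zero_le_power2)
    next
      case False
      \<comment> \<open>The estimate \<open>key\<close> is anchored at the left end point. Moving
        the anchor from \<open>f s\<close> to \<open>f t\<close> costs another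
        \<open>L * (t - s)^2\<close>, hence the factor 2.\<close>
      have "F s - F t - (s - t) *\<^sub>R f t = - ((F t - F s - (t - s) *\<^sub>R f s) - (t - s) *\<^sub>R (f t - f s))"
        by (simp add: algebra_simps)
      then have "p (F s - F t - (s - t) *\<^sub>R f t) = p ((F t - F s - (t - s) *\<^sub>R f s) - (t - s) *\<^sub>R (f t - f s))"
        by (simp only: cseminormD(6)[OF p])
      also have "\<dots> \<le> p (F t - F s - (t - s) *\<^sub>R f s) + p ((t - s) *\<^sub>R (f t - f s))"
        by (rule cseminormD(7)[OF p])
      also have "p (F t - F s - (t - s) *\<^sub>R f s) \<le> L * (t - s)\<^sup>2" using False by (intro key s t) simp
      also have "p ((t - s) *\<^sub>R (f t - f s)) \<le> (t - s) * (L * \<bar>t - s\<bar>)"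
        using False L(2)[OF s t] by (simp add: cseminormD(3)[OF p] mult_left_mono)
      finally show ?thesis using False by (simp add: power2_eq_square algebra_simps)
    qed
    then show "\<exists>C. \<forall>s\<in>{0..1}. p (F s - F t - (s - t) *\<^sub>R f t) \<le> C * (s - t)\<^sup>2" by blast
  qed
  have "has_curve_deriv (\<lambda>t. F t - F 0) (f t) t" if "t \<in> {0..1}" for t
    using has_curve_deriv_diff[OF F[OF that] has_curve_deriv_const[of "F 0"]] by simp
  then show ?thesis by (intro exI[of _ "\<lambda>t. F t - F 0"]) simp
qed

section \<open>Mackey-convergent series and Gronwall estimates\<close>

text \<open>The derivative of \<open>-((max 0 (1 - s\<^sup>2))\<^sup>2) / 4\<close>.\<close>

definition bump :: "real \<Rightarrow> real"
  where "bump s = s * max 0 (1 - s\<^sup>2)"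

text \<open>Squaring smooths the corner of \<open>max 0\<close>: in every sign case the
  linearisation error is at most \<open>h^2\<close>. The aim is a cutoff whose derivative is
  Lipschitz.\<close>

lemma DERIV_max_0_square: "((\<lambda>y::real. (max 0 y)\<^sup>2) has_real_derivative 2 * max 0 y) (at y)"
proof -
  have le: "\<bar>(max 0 (y + h))\<^sup>2 - (max 0 y)\<^sup>2 - 2 * max 0 y * h\<bar> \<le> h\<^sup>2" for h :: real
  proof -
    consider "y \<ge> 0" "y + h \<ge> 0" | "y \<ge> 0" "y + h < 0" | "y < 0" "y + h \<ge> 0" | "y < 0" "y + h < 0"
      by linarith
    then show ?thesis
    proof cases
      case 1
      then show ?thesis by (simp add: power2_eq_square algebra_simps)
    next
      case 2
      have "- (y\<^sup>2) - 2 * y * h = y * (- y - 2 * h)" "- (y\<^sup>2) - 2 * y * h = h\<^sup>2 - (y + h)\<^sup>2"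
        by (simp_all add: power2_eq_square algebra_simps)
      moreover have "y * (- y - 2 * h) \<ge> 0" using 2 by (intro mult_nonneg_nonneg) auto
      moreover have "(y + h)\<^sup>2 \<ge> 0" by simp
      ultimately have "\<bar>- (y\<^sup>2) - 2 * y * h\<bar> \<le> h\<^sup>2" by linarith
      then show ?thesis using 2 by (simp add: max_def)
    next
      case 3
      then have "(y + h)\<^sup>2 \<le> h\<^sup>2" by (intro power_mono) auto
      then show ?thesis using 3 by (simp add: max_def)
    qed (simp add: max_def)
  qed
  have "((\<lambda>h. ((max 0 (y + h))\<^sup>2 - (max 0 y)\<^sup>2) / h - 2 * max 0 y) \<longlongrightarrow> 0) (at 0)"
  proof (rule Lim_null_comparison)
    show "(abs \<longlongrightarrow> (0::real)) (at 0)" by (rule tendsto_eq_intros | simp)+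
    have "norm (((max 0 (y + h))\<^sup>2 - (max 0 y)\<^sup>2) / h - 2 * max 0 y) \<le> \<bar>h\<bar>" if "h \<noteq> 0" for h
    proof -
      have "((max 0 (y + h))\<^sup>2 - (max 0 y)\<^sup>2) / h - 2 * max 0 y
          = ((max 0 (y + h))\<^sup>2 - (max 0 y)\<^sup>2 - 2 * max 0 y * h) / h"
        using that by (simp add: diff_divide_distrib)
      also have "norm \<dots> \<le> h\<^sup>2 / \<bar>h\<bar>"
        unfolding real_norm_def abs_divide using le by (intro divide_right_mono) auto
      also have "\<dots> = \<bar>h\<bar>" by (cases "h > 0") (simp_all add: power2_eq_square)
      finally show ?thesis .
    qed
    then show "eventually (\<lambda>h. norm (((max 0 (y + h))\<^sup>2 - (max 0 y)\<^sup>2) / h - 2 * max 0 y) \<le> \<bar>h\<bar>) (at 0)"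
      by (simp add: eventually_at_filter)
  qed
  then show ?thesis unfolding DERIV_def by (rule LIM_zero_cancel)
qed

lemma DERIV_bump:
  "((\<lambda>t::real. (max 0 (1 - (a * t)\<^sup>2))\<^sup>2) has_real_derivative - 4 * a * bump (a * t)) (at t within S)"
proof -
  have "((\<lambda>t::real. 1 - (a * t)\<^sup>2) has_real_derivative - (2 * a * (a * t))) (at t)"
    by (auto intro!: derivative_eq_intros simp: power2_eq_square)
  from DERIV_chain2[OF DERIV_max_0_square this]
  have "((\<lambda>t::real. (max 0 (1 - (a * t)\<^sup>2))\<^sup>2) has_real_derivative - 4 * a * bump (a * t)) (at t)"
    by (simp add: bump_def mult_ac)
  then show ?thesis by (rule has_field_derivative_at_within)
qed

lemma bump_eq_0: "s \<ge> 1 \<Longrightarrow> bump s = 0"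
  using one_le_power[of s 2] by (simp add: bump_def max_absorb1)

lemma bump_bound:
  assumes "s \<ge> 0"
  shows "\<bar>bump s\<bar> \<le> 1"
proof (cases "s \<le> 1")
  case True
  then have "s\<^sup>2 \<le> 1" using assms by (simp add: power_le_one)
  with True assms show ?thesis by (simp add: bump_def abs_mult mult_le_one)
qed (simp add: bump_eq_0)

text \<open>On [0,1] the derivative of \<open>s - s^3\<close> is \<open>1 - 3 s^2\<close>, which
  lies between -2 and 1; the factored difference quotient shows the same constant.\<close>

lemma bump_lipschitz:
  assumes "s \<ge> 0" "t \<ge> 0"
  shows "\<bar>bump t - bump s\<bar> \<le> 2 * \<bar>t - s\<bar>"
proof -
  have le: "\<bar>bump b - bump a\<bar> \<le> 2 * (b - a)" if ab: "0 \<le> a" "a \<le> b" for a b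
  proof -
    consider "b \<le> 1" | "a \<le> 1" "1 < b" | "1 < a" by linarith
    then show ?thesis
    proof cases
      case 1
      then have sq: "a\<^sup>2 \<le> 1" "b\<^sup>2 \<le> 1" "a * b \<le> 1"
        using ab by (auto simp: power_le_one intro: mult_le_one)
      then have "bump b - bump a = (b - a) * (1 - a\<^sup>2 - a * b - b\<^sup>2)"
        by (simp add: bump_def power2_eq_square algebra_simps)
      moreover have "\<bar>1 - a\<^sup>2 - a * b - b\<^sup>2\<bar> \<le> 2"
      proof -
        have "a * b \<ge> 0" "a\<^sup>2 \<ge> 0" "b\<^sup>2 \<ge> 0" using ab by auto
        then show ?thesis using sq by linarith
      qed
      ultimately show ?thesis using ab mult_left_mono[of "\<bar>1 - a\<^sup>2 - a * b - b\<^sup>2\<bar>" 2 "b - a"]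
        by (simp add: abs_mult)
    next
      case 2
      have "bump a = (a * (1 + a)) * (1 - a)"
        using 2 ab by (simp add: bump_def power2_eq_square max_def mult_le_one algebra_simps)
      moreover have "a * (1 + a) \<le> 1 * 2" using 2 ab by (intro mult_mono) auto
      ultimately have "0 \<le> bump a" "bump a \<le> 2 * (1 - a)"
        using 2 ab mult_right_mono[of "a * (1 + a)" 2 "1 - a"] by simp_all
      then show ?thesis using 2 ab bump_eq_0[of b] by simp
    qed (use ab bump_eq_0 in simp)
  qed
  show ?thesis
  proof (cases "s \<le> t")
    case False
    then show ?thesis using le[of t s] assms by (simp add: abs_minus_commute)
  qed (use le[of s t] assms in simp)
qed

lemma sum_half_powers_le: "(\<Sum>k\<in>{n..<m}. (1 / 2 :: real) ^ k) \<le> 2 * (1 / 2) ^ n"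
proof (cases "n \<le> m")
  case True
  then have "(\<Sum>k\<in>{n..<m}. (1 / 2 :: real) ^ k) = 2 * (1 / 2) ^ n - 2 * (1 / 2) ^ m"
    by (induction m rule: dec_induct) simp_all
  then show ?thesis by simp
qed simp

text \<open>The sum is obtained as an integral: the functions \<open>(max 0 (1 - (2\<^sup>k t)\<^sup>2))\<^sup>2\<close> drop from \<open>1\<close> at
  \<open>t = 0\<close> to \<open>0\<close> at \<open>t = 1\<close>, and the derivative \<open>f\<close> of their sum with coefficients \<open>x k\<close> is a Lipschitz
  curve that is locally a finite sum on \<open>(0,1]\<close>.\<close>

lemma mackey_series:
  fixes x :: "nat \<Rightarrow> 'a::locally_convex_space"
  assumes mc: "mackey_complete TYPE('a)"
    and x: "\<And>p. cseminorm p \<Longrightarrow> \<exists>C. \<forall>k. p (x k) \<le> C * (1 / 8) ^ k"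
  shows "\<exists>s. \<forall>p C n. cseminorm p \<longrightarrow> (\<forall>k. p (x k) \<le> C * (1 / 8) ^ k) \<longrightarrow>
    p (s - (\<Sum>k<n. x k)) \<le> 8 * C * (1 / 2) ^ n"
proof -
  define c where "c k t = - 4 * 2 ^ k * bump (2 ^ k * t)" for k :: nat and t :: real
  define F where "F n t = (\<Sum>k<n. (max 0 (1 - (2 ^ k * t)\<^sup>2))\<^sup>2 *\<^sub>R x k)" for n :: nat and t :: real
  define fn where "fn n t = (\<Sum>k<n. c k t *\<^sub>R x k)" for n t
  \<comment> \<open>For \<open>t > 0\<close> the index set is finite. At \<open>t = 0\<close> it is
    infinite and \<open>sum\<close> returns 0, which is the right value because every
    \<open>c k 0\<close> vanishes.\<close>
  define f where "f t = (\<Sum>k\<in>{k. 2 ^ k * t < 1}. c k t *\<^sub>R x k)" for t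
  have Fd: "has_curve_deriv (F n) (fn n t) t" for n t
    unfolding F_def fn_def c_def by (intro has_curve_deriv_sum has_curve_deriv_scaleR_const DERIV_bump)
  have stable: "\<exists>m. \<forall>n\<ge>m. f t = fn n t" if "t \<in> {0..1}" for t
  proof (cases "t = 0")
    case True
    have "c k 0 = 0" for k by (simp add: c_def bump_def)
    then show ?thesis by (simp add: True f_def fn_def)
  next
    case False
    then have t: "t > 0" using that by simp
    obtain m where m: "1 / t < 2 ^ m" using real_arch_pow[of 2 "1 / t"] by auto
    have "f t = fn n t" if "n \<ge> m" for n
    proof -
      have "2 ^ k * t \<ge> 1" if "k \<ge> m" for k
      proof -
        have "1 \<le> 2 ^ m * t" using m t by (simp add: field_simps)
        also have "\<dots> \<le> 2 ^ k * t" using t that by (intro mult_right_mono power_increasing) auto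
        finally show ?thesis .
      qed
      then have "{k. 2 ^ k * t < 1} \<subseteq> {..<n}"
        using \<open>n \<ge> m\<close> by (metis (no_types, lifting) lessThan_iff linorder_not_less mem_Collect_eq order_trans subsetI)
      then show ?thesis
        unfolding f_def fn_def
        by (intro sum.mono_neutral_left) (auto simp: c_def bump_eq_0)
    qed
    then show ?thesis by blast
  qed
  have le_sum: "(\<Sum>k\<in>{n..<m}. C * (1 / 2) ^ k) \<le> 2 * C * (1 / 2) ^ n" if "C \<ge> 0" for C :: real and n m
    using mult_left_mono[OF sum_half_powers_le that, of n m] by (simp add: sum_distrib_left)
  have tail: "p (f t - fn n t) \<le> 8 * C * (1 / 2) ^ n"
    if p: "cseminorm p" and C: "\<forall>k. p (x k) \<le> C * (1 / 8) ^ k" and t: "t \<in> {0..1}" for p C n t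
  proof -
    have C0: "C \<ge> 0" using C[rule_format, of 0] cseminormD(1)[OF p, of "x 0"] by simp
    obtain m where "\<And>n. n \<ge> m \<Longrightarrow> f t = fn n t" using stable[OF t] by blast
    then have "f t = fn (max n m) t" by simp
    then have "f t - fn n t = (\<Sum>k\<in>{n..<max n m}. c k t *\<^sub>R x k)"
      using sum_diff_nat_ivl[of 0 n "max n m" "\<lambda>k. c k t *\<^sub>R x k"] by (simp add: fn_def lessThan_atLeast0)
    then have "p (f t - fn n t) \<le> (\<Sum>k\<in>{n..<max n m}. p (c k t *\<^sub>R x k))"
      using cseminorm_sum[OF p] by metis
    also have "\<dots> \<le> (\<Sum>k\<in>{n..<max n m}. 4 * C * (1 / 2) ^ k)"
    proof (rule sum_mono)
      fix k
      \<comment> \<open>The coefficient grows like \<open>2^k\<close>, so this tail is even of order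
        \<open>4^(-k)\<close>; it is weakened to the rate \<open>2^(-k)\<close>.\<close>
      have "p (c k t *\<^sub>R x k) \<le> (4 * 2 ^ k) * (C * (1 / 8) ^ k)"
        unfolding cseminormD(3)[OF p]
      proof (rule mult_mono)
        show "\<bar>c k t\<bar> \<le> 4 * 2 ^ k"
          using bump_bound[of "2 ^ k * t"] t by (simp add: c_def abs_mult)
      qed (use C cseminormD(1)[OF p] in auto)
      also have "\<dots> = 4 * C * (1 / 4) ^ k"
        by (simp add: power_divide field_simps flip: power_mult_distrib)
      also have "\<dots> \<le> 4 * C * (1 / 2) ^ k" using C0 by (intro mult_left_mono power_mono) auto
      finally show "p (c k t *\<^sub>R x k) \<le> 4 * C * (1 / 2) ^ k" .
    qed
    also have "\<dots> \<le> 2 * (4 * C) * (1 / 2) ^ n" using C0 by (intro le_sum) simp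
    finally show ?thesis by simp
  qed
  have "lip_curve f"
    unfolding lip_curve_def
  proof (intro allI impI)
    fix p :: "'a \<Rightarrow> real" assume p: "cseminorm p"
    obtain C where C: "\<And>k. p (x k) \<le> C * (1 / 8) ^ k" using x[OF p] by blast
    have C0: "C \<ge> 0" using C[of 0] cseminormD(1)[OF p, of "x 0"] by simp
    have "p (f t - f s) \<le> (16 * C) * \<bar>t - s\<bar>" if st: "s \<in> {0..1}" "t \<in> {0..1}" for s t
    proof -
      obtain m1 where m1: "\<And>n. n \<ge> m1 \<Longrightarrow> f t = fn n t" using stable[OF st(2)] by blast
      obtain m2 where m2: "\<And>n. n \<ge> m2 \<Longrightarrow> f s = fn n s" using stable[OF st(1)] by blast
      define m where "m = max m1 m2"
      have "f t - f s = (\<Sum>k<m. (c k t - c k s) *\<^sub>R x k)"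
        using m1[of m] m2[of m] by (simp add: m_def fn_def sum_subtractf scaleR_diff_left)
      then have "p (f t - f s) \<le> (\<Sum>k<m. p ((c k t - c k s) *\<^sub>R x k))"
        using cseminorm_sum[OF p] by metis
      also have "\<dots> \<le> (\<Sum>k<m. (8 * C * \<bar>t - s\<bar>) * (1 / 2) ^ k)"
      proof (rule sum_mono)
        fix k
        \<comment> \<open>One factor \<open>2^k\<close> comes from the chain rule and a second one
          from the rescaled argument. Against \<open>4^k\<close>, the assumed decay
          \<open>8^(-k)\<close> leaves the summable \<open>2^(-k)\<close>.\<close>
        have "c k t - c k s = - 4 * 2 ^ k * (bump (2 ^ k * t) - bump (2 ^ k * s))"
          by (simp add: c_def algebra_simps)
        then have "\<bar>c k t - c k s\<bar> = 4 * 2 ^ k * \<bar>bump (2 ^ k * t) - bump (2 ^ k * s)\<bar>"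
          by (simp add: abs_mult)
        also have "\<dots> \<le> 4 * 2 ^ k * (2 * \<bar>2 ^ k * t - 2 ^ k * s\<bar>)"
          using st by (intro mult_left_mono bump_lipschitz) auto
        also have "\<dots> = 8 * 4 ^ k * \<bar>t - s\<bar>"
          by (simp add: right_diff_distrib[symmetric] abs_mult flip: power_mult_distrib)
        finally have "\<bar>c k t - c k s\<bar> \<le> 8 * 4 ^ k * \<bar>t - s\<bar>" .
        then have "p ((c k t - c k s) *\<^sub>R x k) \<le> (8 * 4 ^ k * \<bar>t - s\<bar>) * (C * (1 / 8) ^ k)"
          unfolding cseminormD(3)[OF p] using C by (intro mult_mono) (auto simp: cseminormD(1)[OF p])
        also have "\<dots> = (8 * C * \<bar>t - s\<bar>) * (4 * (1 / 8)) ^ k"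
          unfolding power_mult_distrib by (simp only: mult_ac)
        finally show "p ((c k t - c k s) *\<^sub>R x k) \<le> (8 * C * \<bar>t - s\<bar>) * (1 / 2) ^ k" by simp
      qed
      also have "\<dots> \<le> 2 * (8 * C * \<bar>t - s\<bar>) * (1 / 2) ^ 0"
        unfolding lessThan_atLeast0 using C0 by (intro le_sum) simp
      finally show ?thesis by simp
    qed
    then show "\<exists>L. \<forall>s\<in>{0..1}. \<forall>t\<in>{0..1}. p (f t - f s) \<le> L * \<bar>t - s\<bar>" by blast
  qed
  from primitive_exists[OF mc this] obtain G
    where G: "G 0 = 0" "\<And>t. t \<in> {0..1} \<Longrightarrow> has_curve_deriv G (f t) t" by blast
  have "p (- G 1 - (\<Sum>k<n. x k)) \<le> 8 * C * (1 / 2) ^ n"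
    if p: "cseminorm p" and C: "\<forall>k. p (x k) \<le> C * (1 / 8) ^ k" for p C n
  proof -
    \<comment> \<open>\<open>F n\<close> runs from the partial sum at 0 to 0 at 1, and
      \<open>G\<close> has the limiting derivative; so the sum of the series is
      \<open>- G 1\<close>, and integrating the tail estimate gives the rate.\<close>
    have "p ((G 1 - F n 1) - (G 0 - F n 0)) \<le> (8 * C * (1 / 2) ^ n) * \<bar>1 - 0\<bar>"
      by (rule seminorm_mean_value_bound[OF p has_curve_deriv_diff[OF G(2) Fd]])
        (use tail[OF p C] in auto)
    moreover have "F n 1 = 0"
    proof -
      have "1 \<le> ((2::real) ^ k)\<^sup>2" for k by (intro one_le_power) simp
      then show ?thesis by (simp add: F_def max_absorb1)
    qed
    moreover have "F n 0 = (\<Sum>k<n. x k)" by (simp add: F_def)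
    moreover have "G 1 + (\<Sum>k<n. x k) = - (- G 1 - (\<Sum>k<n. x k))" by simp
    ultimately show ?thesis using G(1) cseminormD(6)[OF p, of "- G 1 - (\<Sum>k<n. x k)"] by simp
  qed
  then show ?thesis by blast
qed

text \<open>The supremum \<open>M\<close> of \<open>exp (- 2 \<rho> t) p (u t)\<close> satisfies \<open>M \<le> p (u 0) + K + M / 2\<close>.\<close>

lemma seminorm_gronwall:
  fixes u :: "real \<Rightarrow> 'a::locally_convex_space"
  assumes p: "cseminorm p" and u: "\<And>t. t \<in> {0..1} \<Longrightarrow> has_curve_deriv u (u' t) t"
    and le: "\<And>t. t \<in> {0..1} \<Longrightarrow> p (u' t) \<le> \<rho> * p (u t) + K"
    and pos: "\<rho> > 0" "K \<ge> 0" and t: "t \<in> {0..1}"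
  shows "p (u t) \<le> 2 * exp (2 * \<rho>) * (p (u 0) + K)"
proof -
  have "continuous_on {0..1} (\<lambda>t. p (u t))"
    using continuous_on_compose2[OF cseminormD(4)[OF p] continuous_on_if_has_curve_deriv[OF u]] by simp
  then have "continuous_on {0..1} (\<lambda>t. exp (- 2 * \<rho> * t) * p (u t))"
    by (intro continuous_intros)
  then obtain t0 where t0: "t0 \<in> {0..1}"
    "\<And>t. t \<in> {0..1} \<Longrightarrow> exp (- 2 * \<rho> * t) * p (u t) \<le> exp (- 2 * \<rho> * t0) * p (u t0)"
    using continuous_attains_sup[of "{0..1::real}" "\<lambda>t. exp (- 2 * \<rho> * t) * p (u t)"] by auto
  define M where "M = exp (- 2 * \<rho> * t0) * p (u t0)"
  have M: "p (u t) \<le> M * exp (2 * \<rho> * t)" if "t \<in> {0..1}" for t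
    using mult_right_mono[OF t0(2)[OF that], of "exp (2 * \<rho> * t)"]
    by (simp add: M_def mult_ac flip: exp_add mult.assoc)
  have M0: "M \<ge> 0" by (simp add: M_def cseminormD(1)[OF p])
  \<comment> \<open>The exponent is \<open>2 * \<rho>\<close> and not \<rho> so that integrating
    \<open>\<rho> * M * exp (2 * \<rho> * t)\<close> gives back only half of \<open>M\<close>, which
    can be absorbed.\<close>
  have "p (u t0 - u 0) \<le> (M / 2 * exp (2 * \<rho> * t0) + K * t0) - (M / 2 * exp (2 * \<rho> * 0) + K * 0)"
  proof (rule seminorm_mean_value[OF p u, of "\<lambda>t. M / 2 * exp (2 * \<rho> * t) + K * t" "\<lambda>t. \<rho> * (M * exp (2 * \<rho> * t)) + K"])
    fix t :: real assume "t \<in> {0..1}"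
    show "((\<lambda>t. M / 2 * exp (2 * \<rho> * t) + K * t) has_real_derivative \<rho> * (M * exp (2 * \<rho> * t)) + K)
        (at t within {0..1})"
      by (auto intro!: derivative_eq_intros)
    have "\<rho> * p (u t) \<le> \<rho> * (M * exp (2 * \<rho> * t))" using M[OF \<open>t \<in> {0..1}\<close>] pos by (intro mult_left_mono) auto
    then show "p (u' t) \<le> \<rho> * (M * exp (2 * \<rho> * t)) + K" using le[OF \<open>t \<in> {0..1}\<close>] by linarith
  qed (use t0 in auto)
  also have "\<dots> \<le> M / 2 * exp (2 * \<rho> * t0) + K"
    using t0(1) pos M0 mult_left_mono[of t0 1 K] by simp
  finally have "p (u t0) \<le> p (u 0) + K + M / 2 * exp (2 * \<rho> * t0)"
    using cseminormD(2)[OF p, of "u t0 - u 0" "u 0"] by simp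
  then have "exp (- 2 * \<rho> * t0) * p (u t0) \<le> exp (- 2 * \<rho> * t0) * (p (u 0) + K + M / 2 * exp (2 * \<rho> * t0))"
    by (intro mult_left_mono) auto
  also have "\<dots> = exp (- 2 * \<rho> * t0) * (p (u 0) + K) + M / 2"
    by (simp add: distrib_left mult_ac flip: exp_add mult.assoc)
  also have "exp (- 2 * \<rho> * t0) * (p (u 0) + K) \<le> 1 * (p (u 0) + K)"
    using t0(1) pos cseminormD(1)[OF p, of "u 0"] by (intro mult_right_mono) auto
  finally have M2: "M \<le> 2 * (p (u 0) + K)" by (simp add: M_def)
  have "p (u t) \<le> M * exp (2 * \<rho> * t)" by (rule M[OF t])
  also have "\<dots> \<le> M * exp (2 * \<rho>)" using M0 t pos by (intro mult_left_mono) auto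
  also have "\<dots> \<le> 2 * (p (u 0) + K) * exp (2 * \<rho>)" using M2 by (intro mult_right_mono) auto
  finally show ?thesis by (simp add: algebra_simps)
qed

section \<open>Linear differential equations\<close>

lemma submult_seminormD:
  assumes "submult_seminorm p"
  shows "cseminorm p" "p (x * y) \<le> p x * p y"
  using assms by (simp_all add: submult_seminorm_def)

lemma le_zero_if_le_half_powers:
  fixes a C :: real
  assumes "\<And>n. a \<le> C * (1 / 2) ^ n"
  shows "a \<le> 0"
proof (rule tendsto_lowerbound)
  show "((\<lambda>n. C * (1 / 2) ^ n) \<longlonglongrightarrow> 0)"
    by (intro tendsto_mult_right_zero LIMSEQ_realpow_zero) auto
qed (use assms in auto)

text \<open>This isolates what the differential equations require: integrals of Lipschitz curves and
  enough submultiplicative seminorms. Invertibility of solutions will be derived, not taken from the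
  unit group being open.\<close>

locale mackey_lmc_algebra =
  fixes T :: "'a::locally_convex_algebra itself"
  assumes mackey: "mackey_complete T"
    and dominating: "cseminorm (p :: 'a \<Rightarrow> real) \<Longrightarrow> \<exists>P. submult_seminorm P \<and> (\<forall>x. p x \<le> P x)"
begin

lemma eq_if_submult_zero:
  fixes x y :: 'a
  assumes "\<And>p. submult_seminorm p \<Longrightarrow> p (x - y) \<le> 0"
  shows "x = y"
proof -
  have "x - y = 0"
  proof (rule eq_zero_if_cseminorm_zero)
    fix p :: "'a \<Rightarrow> real" assume p: "cseminorm p"
    obtain P where "submult_seminorm P" "\<And>x. p x \<le> P x" using dominating[OF p] by blast
    with assms[of P] have "p (x - y) \<le> 0" using order_trans by blast
    then show "p (x - y) = 0" using cseminormD(1)[OF p, of "x - y"] by simp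
  qed
  then show ?thesis by simp
qed

lemma lip_curve_submultI:
  fixes f :: "real \<Rightarrow> 'a"
  assumes "\<And>p. submult_seminorm p \<Longrightarrow>
    \<exists>L. \<forall>s\<in>{0..1}. \<forall>t\<in>{0..1}. p (f t - f s) \<le> L * \<bar>t - s\<bar>"
  shows "lip_curve f"
  unfolding lip_curve_def using dominating assms order_trans by meson

text \<open>Keeps the right-hand side \<open>u t * \<gamma> t\<close> within the class of integrable
  curves, as the Picard iteration requires.\<close>

lemma lip_curve_mult:
  fixes f g :: "real \<Rightarrow> 'a"
  assumes "lip_curve f" "lip_curve g"
  shows "lip_curve (\<lambda>t. f t * g t)"
proof (rule lip_curve_submultI)
  fix p :: "'a \<Rightarrow> real" assume p: "submult_seminorm p"
  note cp = submult_seminormD(1)[OF p]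
  obtain L where L: "L > 0" "\<And>s t. s \<in> {0..1} \<Longrightarrow> t \<in> {0..1} \<Longrightarrow> p (f t - f s) \<le> L * \<bar>t - s\<bar>"
    using lip_curveD[OF assms(1) cp] by metis
  obtain K where K: "K > 0" "\<And>s t. s \<in> {0..1} \<Longrightarrow> t \<in> {0..1} \<Longrightarrow> p (g t - g s) \<le> K * \<bar>t - s\<bar>"
    using lip_curveD[OF assms(2) cp] by metis
  obtain M where M: "M > 0" "\<And>t. t \<in> {0..1} \<Longrightarrow> p (f t) \<le> M"
    using lip_curve_bounded[OF assms(1) cp] by metis
  obtain N where N: "N > 0" "\<And>t. t \<in> {0..1} \<Longrightarrow> p (g t) \<le> N"
    using lip_curve_bounded[OF assms(2) cp] by metis
  have "p (f t * g t - f s * g s) \<le> (L * N + M * K) * \<bar>t - s\<bar>" if st: "s \<in> {0..1}" "t \<in> {0..1}" for s t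
  proof -
    have "f t * g t - f s * g s = (f t - f s) * g t + f s * (g t - g s)" by (simp add: algebra_simps)
    then have "p (f t * g t - f s * g s) \<le> p ((f t - f s) * g t) + p (f s * (g t - g s))"
      using cseminormD(2)[OF cp] by metis
    also have "p ((f t - f s) * g t) \<le> p (f t - f s) * p (g t)" by (rule submult_seminormD(2)[OF p])
    also have "p (f t - f s) * p (g t) \<le> (L * \<bar>t - s\<bar>) * N"
      using L(1) L(2)[OF st] N(2)[OF st(2)] by (intro mult_mono) (auto simp: cseminormD(1)[OF cp])
    also have "p (f s * (g t - g s)) \<le> p (f s) * p (g t - g s)" by (rule submult_seminormD(2)[OF p])
    also have "p (f s) * p (g t - g s) \<le> M * (K * \<bar>t - s\<bar>)"
      using M(1) K(2)[OF st] M(2)[OF st(1)] by (intro mult_mono) (auto simp: cseminormD(1)[OF cp])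
    finally show ?thesis by (simp add: algebra_simps)
  qed
  then show "\<exists>L. \<forall>s\<in>{0..1}. \<forall>t\<in>{0..1}. p (f t * g t - f s * g s) \<le> L * \<bar>t - s\<bar>" by blast
qed

text \<open>The weights \<open>exp (8 \<rho> t)\<close> turn the Picard iteration into a contraction with factor \<open>1 / 8\<close>,
  the rate required by \<open>mackey_series\<close>.\<close>

lemma linear_ode_solution_exists:
  fixes \<Phi> :: "real \<Rightarrow> 'a \<Rightarrow> 'a"
  assumes add: "\<And>t x y. \<Phi> t (x + y) = \<Phi> t x + \<Phi> t y"
    and bound: "\<And>p. submult_seminorm p \<Longrightarrow> \<exists>\<rho>>0. \<forall>t\<in>{0..1}. \<forall>x. p (\<Phi> t x) \<le> \<rho> * p x"
    and lip\<Phi>: "\<And>u. lip_curve u \<Longrightarrow> lip_curve (\<lambda>t. \<Phi> t (u t))"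
    and g: "lip_curve g"
  shows "\<exists>u. u 0 = c \<and> (\<forall>t\<in>{0..1}. has_curve_deriv u (\<Phi> t (u t) + g t) t) \<and> lip_curve u"
proof -
  have zero: "\<Phi> t 0 = 0" for t using add[of t 0 0] by simp
  have minus: "\<Phi> t (x - y) = \<Phi> t x - \<Phi> t y" for t x y
    using add[of t "x - y" y] by simp
  define V where "V f = (SOME F. F 0 = 0 \<and> (\<forall>t\<in>{0..1}. has_curve_deriv F (f t) t))" for f :: "real \<Rightarrow> 'a"
  have mc: "mackey_complete TYPE('a)" using mackey by (simp add: mackey_complete_def)
  have V: "V f 0 = 0" "\<And>t. t \<in> {0..1} \<Longrightarrow> has_curve_deriv (V f) (f t) t" if "lip_curve f" for f
    using someI_ex[OF primitive_exists[OF mc that]] unfolding V_def by auto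
  have lipV: "lip_curve (V f)" if f: "lip_curve f" for f
  proof (rule lip_curve_if_bounded_deriv[OF V(2)[OF f]])
    fix p :: "'a \<Rightarrow> real" assume p: "cseminorm p"
    obtain M where "\<And>t. t \<in> {0..1} \<Longrightarrow> p (f t) \<le> M" using lip_curve_bounded[OF f p] by metis
    then show "\<exists>M. \<forall>t\<in>{0..1}. p (f t) \<le> M" by blast
  qed
  \<comment> \<open>These are the increments of the Picard iteration, each the Volterra operator
    applied to the preceding one; the iterates are their partial sums.\<close>
  define u where "u n = ((\<lambda>v. V (\<lambda>t. \<Phi> t (v t))) ^^ n) (\<lambda>t. c + V g t)" for n
  have u0: "u 0 = (\<lambda>t. c + V g t)" and uS: "u (Suc n) = V (\<lambda>t. \<Phi> t (u n t))" for n
    by (simp_all add: u_def)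
  have lipu: "lip_curve (u n)" for n
    by (induction n) (auto simp: u0 uS g intro!: lipV lip\<Phi> lip_curve_add lip_curve_const)
  have du0: "has_curve_deriv (u 0) (g t) t" if "t \<in> {0..1}" for t
    using has_curve_deriv_add[OF has_curve_deriv_const V(2)[OF g that], of c] by (simp add: u0)
  have duS: "has_curve_deriv (u (Suc n)) (\<Phi> t (u n t)) t" if "t \<in> {0..1}" for n t
    unfolding uS using V(2)[OF lip\<Phi>[OF lipu] that] .
  have uS0: "u (Suc n) 0 = 0" for n unfolding uS using V(1)[OF lip\<Phi>[OF lipu]] .
  have u00: "u 0 0 = c" by (simp add: u0 V(1)[OF g])
  have est: "\<exists>K>0. \<forall>t\<in>{0..1}. \<forall>n. p (u n t) \<le> K * (1 / 8) ^ n" if p: "submult_seminorm p" for p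
  proof -
    note cp = submult_seminormD(1)[OF p]
    obtain \<rho> where \<rho>: "\<rho> > 0" "\<And>t x. t \<in> {0..1} \<Longrightarrow> p (\<Phi> t x) \<le> \<rho> * p x" using bound[OF p] by blast
    obtain M where M: "M > 0" "\<And>t. t \<in> {0..1} \<Longrightarrow> p (u 0 t) \<le> M" using lip_curve_bounded[OF lipu cp] by metis
    have est: "\<forall>t\<in>{0..1}. p (u n t) \<le> M * (1 / 8) ^ n * exp (8 * \<rho> * t)" for n
    proof (induction n)
      case 0
      show ?case
      proof
        fix t :: real assume t: "t \<in> {0..1}"
        have "M * 1 \<le> M * exp (8 * \<rho> * t)" using M(1) \<rho>(1) t by (intro mult_left_mono) auto
        with M(2)[OF t] show "p (u 0 t) \<le> M * (1 / 8) ^ 0 * exp (8 * \<rho> * t)" by simp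
      qed
    next
      case (Suc n)
      let ?k = "M * (1 / 8) ^ n"
      show ?case
      proof
        fix t :: real assume t: "t \<in> {0..1}"
        have "p (u (Suc n) t - u (Suc n) 0) \<le> ?k / 8 * exp (8 * \<rho> * t) - ?k / 8 * exp (8 * \<rho> * 0)"
        proof (rule seminorm_mean_value[OF cp duS, of "\<lambda>t. ?k / 8 * exp (8 * \<rho> * t)" "\<lambda>t. \<rho> * (?k * exp (8 * \<rho> * t))"])
          fix s :: real assume s: "s \<in> {0..1}"
          show "((\<lambda>t. ?k / 8 * exp (8 * \<rho> * t)) has_real_derivative \<rho> * (?k * exp (8 * \<rho> * s))) (at s within {0..1})"
            by (auto intro!: derivative_eq_intros)
          have "\<rho> * p (u n s) \<le> \<rho> * (?k * exp (8 * \<rho> * s))" using Suc.IH s \<rho>(1) by (intro mult_left_mono) auto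
          with \<rho>(2)[OF s, of "u n s"] show "p (\<Phi> s (u n s)) \<le> \<rho> * (?k * exp (8 * \<rho> * s))" by linarith
        qed (use t in auto)
        also have "\<dots> \<le> ?k / 8 * exp (8 * \<rho> * t)" using M(1) by simp
        finally show "p (u (Suc n) t) \<le> M * (1 / 8) ^ Suc n * exp (8 * \<rho> * t)" by (simp add: uS0)
      qed
    qed
    have "p (u n t) \<le> (M * exp (8 * \<rho>)) * (1 / 8) ^ n" if t: "t \<in> {0..1}" for n t
    proof -
      have "M * (1 / 8) ^ n * exp (8 * \<rho> * t) \<le> M * (1 / 8) ^ n * exp (8 * \<rho>)"
        using t M(1) \<rho>(1) by (intro mult_left_mono) auto
      with est[of n] t show ?thesis by (fastforce simp: mult_ac)
    qed
    moreover have "M * exp (8 * \<rho>) > 0" using M(1) by simp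
    ultimately show ?thesis by blast
  qed
  define s where "s n t = (\<Sum>k<n. u k t)" for n t
  have "\<exists>U. \<forall>p C n. cseminorm p \<longrightarrow> (\<forall>k. p (u k t) \<le> C * (1 / 8) ^ k) \<longrightarrow>
      p (U - (\<Sum>k<n. u k t)) \<le> 8 * C * (1 / 2) ^ n" if t: "t \<in> {0..1}" for t
  proof (rule mackey_series[OF mc])
    fix p :: "'a \<Rightarrow> real" assume "cseminorm p"
    then obtain P where P: "submult_seminorm P" "\<And>x. p x \<le> P x" using dominating by blast
    obtain K where "\<And>n. P (u n t) \<le> K * (1 / 8) ^ n" using est[OF P(1)] t by blast
    with P(2) show "\<exists>C. \<forall>k. p (u k t) \<le> C * (1 / 8) ^ k" using order_trans by blast
  qed
  then obtain U where U: "\<And>t p C n. t \<in> {0..1} \<Longrightarrow> cseminorm p \<Longrightarrow> (\<forall>k. p (u k t) \<le> C * (1 / 8) ^ k) \<Longrightarrow>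
      p (U t - s n t) \<le> 8 * C * (1 / 2) ^ n"
    unfolding s_def by metis
  \<comment> \<open>The index is shifted because \<open>s 0\<close> is the empty sum:
    \<open>s 1\<close> has derivative \<open>g\<close>, which matches the formula through
    \<open>\<Phi> t 0 = 0\<close>.\<close>
  have ds: "has_curve_deriv (s (Suc n)) (\<Phi> t (s n t) + g t) t" if t: "t \<in> {0..1}" for n t
  proof (induction n)
    case 0
    show ?case using du0[OF t] by (simp add: s_def[abs_def] zero)
  next
    case (Suc n)
    have "has_curve_deriv (\<lambda>t. s (Suc n) t + u (Suc n) t) ((\<Phi> t (s n t) + g t) + \<Phi> t (u n t)) t"
      by (intro has_curve_deriv_add Suc.IH duS t)
    then show ?case by (simp add: s_def[abs_def] add add_ac)
  qed
  have s0: "s (Suc n) 0 = c" for n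
    by (induction n) (simp_all add: s_def u00 uS0)
  \<comment> \<open>\<open>\<Phi> t (U t) + g t\<close> can be integrated only once \<open>U\<close>
    is known to be Lipschitz. The bound \<open>D\<close> on the derivatives of the partial sums is
    independent of \<open>n\<close> and survives the pointwise limit.\<close>
  have lipU: "lip_curve U"
  proof (rule lip_curve_submultI)
    fix p :: "'a \<Rightarrow> real" assume p: "submult_seminorm p"
    note cp = submult_seminormD(1)[OF p]
    obtain \<rho> where \<rho>: "\<rho> > 0" "\<And>t x. t \<in> {0..1} \<Longrightarrow> p (\<Phi> t x) \<le> \<rho> * p x" using bound[OF p] by blast
    obtain K where K: "K > 0" "\<And>t n. t \<in> {0..1} \<Longrightarrow> p (u n t) \<le> K * (1 / 8) ^ n" using est[OF p] by blast
    obtain M where M: "M > 0" "\<And>t. t \<in> {0..1} \<Longrightarrow> p (g t) \<le> M" using lip_curve_bounded[OF g cp] by metis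
    have sb: "p (s n t) \<le> 2 * K" if t: "t \<in> {0..1}" for n t
    proof -
      have "p (s n t) \<le> (\<Sum>k<n. p (u k t))" unfolding s_def by (rule cseminorm_sum[OF cp])
      also have "\<dots> \<le> (\<Sum>k<n. K * (1 / 2) ^ k)"
      proof (rule sum_mono)
        fix k
        have "K * (1 / 8) ^ k \<le> K * (1 / 2) ^ k" using K(1) by (intro mult_left_mono power_mono) auto
        with K(2)[OF t, of k] show "p (u k t) \<le> K * (1 / 2) ^ k" by linarith
      qed
      also have "\<dots> \<le> K * (2 * (1 / 2) ^ 0)"
        unfolding sum_distrib_left[symmetric] lessThan_atLeast0 using K(1)
        by (intro mult_left_mono sum_half_powers_le) simp
      finally show ?thesis by simp
    qed
    define D where "D = \<rho> * (2 * K) + M"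
    have db: "p (\<Phi> t (s n t) + g t) \<le> D" if t: "t \<in> {0..1}" for n t
    proof -
      have "p (\<Phi> t (s n t) + g t) \<le> p (\<Phi> t (s n t)) + p (g t)" by (rule cseminormD(2)[OF cp])
      also have "p (\<Phi> t (s n t)) \<le> \<rho> * p (s n t)" by (rule \<rho>(2)[OF t])
      also have "\<rho> * p (s n t) \<le> \<rho> * (2 * K)" using sb[OF t] \<rho>(1) by (intro mult_left_mono) auto
      finally show ?thesis using M(2)[OF t] by (simp add: D_def)
    qed
    have "p (U t - U r) \<le> D * \<bar>t - r\<bar>" if rt: "r \<in> {0..1}" "t \<in> {0..1}" for r t
    proof -
      have "p (U t - U r) - D * \<bar>t - r\<bar> \<le> (8 * K) * (1 / 2) ^ n" for n
      proof -
        have "U t - U r = (s (Suc n) t - s (Suc n) r) + ((U t - s (Suc n) t) - (U r - s (Suc n) r))" by simp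
        then have "p (U t - U r) \<le> p (s (Suc n) t - s (Suc n) r) + p ((U t - s (Suc n) t) - (U r - s (Suc n) r))"
          using cseminormD(2)[OF cp] by metis
        also have "p (s (Suc n) t - s (Suc n) r) \<le> D * \<bar>t - r\<bar>"
          by (rule seminorm_mean_value_bound[OF cp ds db rt])
        also have "p ((U t - s (Suc n) t) - (U r - s (Suc n) r)) \<le> p (U t - s (Suc n) t) + p (U r - s (Suc n) r)"
          by (rule cseminormD(7)[OF cp])
        also have "p (U t - s (Suc n) t) \<le> 8 * K * (1 / 2) ^ Suc n" using K rt by (intro U cp) auto
        also have "p (U r - s (Suc n) r) \<le> 8 * K * (1 / 2) ^ Suc n" using K rt by (intro U cp) auto
        finally show ?thesis using K(1) by simp
      qed
      from le_zero_if_le_half_powers[OF this] show ?thesis by simp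
    qed
    then show "\<exists>L. \<forall>r\<in>{0..1}. \<forall>t\<in>{0..1}. p (U t - U r) \<le> L * \<bar>t - r\<bar>" by blast
  qed
  define h where "h t = \<Phi> t (U t) + g t" for t
  have liph: "lip_curve h" unfolding h_def by (intro lip_curve_add lip\<Phi> lipU g)
  \<comment> \<open>\<open>U\<close> is so far only a pointwise limit without a derivative.
    \<open>W\<close> has the desired derivative by construction, and both are close to
    \<open>s (Suc n)\<close> with an error of order \<open>2^(-n)\<close>, so they agree.\<close>
  define W where "W t = c + V h t" for t
  have W0: "W 0 = c" by (simp add: W_def V(1)[OF liph])
  have dW: "has_curve_deriv W (h t) t" if "t \<in> {0..1}" for t
    using has_curve_deriv_add[OF has_curve_deriv_const V(2)[OF liph that], of c] by (simp add: W_def[abs_def])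
  have WU: "W t = U t" if t: "t \<in> {0..1}" for t
  proof (rule eq_if_submult_zero)
    fix p :: "'a \<Rightarrow> real" assume p: "submult_seminorm p"
    note cp = submult_seminormD(1)[OF p]
    obtain \<rho> where \<rho>: "\<rho> > 0" "\<And>t x. t \<in> {0..1} \<Longrightarrow> p (\<Phi> t x) \<le> \<rho> * p x" using bound[OF p] by blast
    obtain K where K: "K > 0" "\<And>t n. t \<in> {0..1} \<Longrightarrow> p (u n t) \<le> K * (1 / 8) ^ n" using est[OF p] by blast
    have Us: "p (U r - s n r) \<le> 8 * K * (1 / 2) ^ n" if "r \<in> {0..1}" for r n
      using K that by (intro U cp) auto
    have "p (W t - U t) \<le> (\<rho> * (8 * K) + 4 * K) * (1 / 2) ^ n" for n
    proof -
      let ?E = "\<rho> * (8 * K) * (1 / 2) ^ n"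
      have "p ((W t - s (Suc n) t) - (W 0 - s (Suc n) 0)) \<le> ?E * \<bar>t - 0\<bar>"
      proof (rule seminorm_mean_value_bound[OF cp has_curve_deriv_diff[OF dW ds]])
        fix r :: real assume r: "r \<in> {0..1}"
        have "h r - (\<Phi> r (s n r) + g r) = \<Phi> r (U r - s n r)" by (simp add: h_def minus)
        then have "p (h r - (\<Phi> r (s n r) + g r)) \<le> \<rho> * p (U r - s n r)" using \<rho>(2)[OF r] by simp
        also have "\<dots> \<le> \<rho> * (8 * K * (1 / 2) ^ n)" using Us[OF r] \<rho>(1) by (intro mult_left_mono) auto
        finally show "p (h r - (\<Phi> r (s n r) + g r)) \<le> ?E" by (simp add: mult_ac)
      qed (use t in auto)
      also have "\<dots> \<le> ?E * 1" using t \<rho>(1) K(1) by (intro mult_left_mono) auto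
      finally have "p (W t - s (Suc n) t) \<le> ?E" by (simp add: W0 s0)
      moreover have "p (W t - U t) \<le> p (W t - s (Suc n) t) + p (U t - s (Suc n) t)"
        using cseminormD(7)[OF cp, of "W t - s (Suc n) t" "U t - s (Suc n) t"] by simp
      moreover have "p (U t - s (Suc n) t) \<le> 8 * K * (1 / 2) ^ Suc n" by (rule Us[OF t])
      ultimately show ?thesis by (simp add: distrib_right)
    qed
    then show "p (W t - U t) \<le> 0" by (rule le_zero_if_le_half_powers)
  qed
  have "has_curve_deriv W (\<Phi> t (W t) + g t) t" if t: "t \<in> {0..1}" for t
    using dW[OF t] by (simp add: h_def WU[OF t])
  moreover have "lip_curve W"
    unfolding lip_curve_def using lipU by (simp add: WU lip_curve_def)
  ultimately show ?thesis using W0 by blast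
qed

lemma right_ode_solution_exists:
  fixes \<gamma> g :: "real \<Rightarrow> 'a"
  assumes \<gamma>: "lip_curve \<gamma>" and g: "lip_curve g"
  shows "\<exists>u. u 0 = c \<and> (\<forall>t\<in>{0..1}. has_curve_deriv u (u t * \<gamma> t + g t) t) \<and> lip_curve u"
proof (rule linear_ode_solution_exists[OF _ _ _ g])
  fix p :: "'a \<Rightarrow> real" assume p: "submult_seminorm p"
  obtain M where M: "M > 0" "\<And>t. t \<in> {0..1} \<Longrightarrow> p (\<gamma> t) \<le> M"
    using lip_curve_bounded[OF \<gamma> submult_seminormD(1)[OF p]] by metis
  have "p (x * \<gamma> t) \<le> M * p x" if "t \<in> {0..1}" for t x
    using submult_seminormD(2)[OF p, of x "\<gamma> t"] mult_left_mono[OF M(2)[OF that], of "p x"]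
      cseminormD(1)[OF submult_seminormD(1)[OF p], of x] by (simp add: mult.commute)
  with M(1) show "\<exists>\<rho>>0. \<forall>t\<in>{0..1}. \<forall>x. p (x * \<gamma> t) \<le> \<rho> * p x" by blast
qed (auto simp: distrib_right intro: lip_curve_mult \<gamma>)

text \<open>Supplies the candidate inverse: if \<eta>' = \<eta> \<gamma>, an inverse has to satisfy
  \<zeta>' = - \<gamma> \<zeta>.\<close>

lemma left_ode_solution_exists:
  fixes \<gamma> :: "real \<Rightarrow> 'a"
  assumes \<gamma>: "lip_curve \<gamma>"
  shows "\<exists>u. u 0 = c \<and> (\<forall>t\<in>{0..1}. has_curve_deriv u (- (\<gamma> t * u t)) t)"
proof -
  have lip: "lip_curve (\<lambda>t. - (\<gamma> t * u t))" if "lip_curve u" for u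
    using lip_curve_scaleR[OF lip_curve_mult[OF \<gamma> that], of "-1"] by simp
  have "\<exists>u. u 0 = c \<and> (\<forall>t\<in>{0..1}. has_curve_deriv u (- (\<gamma> t * u t) + 0) t) \<and> lip_curve u"
  proof (rule linear_ode_solution_exists[OF _ _ _ lip_curve_const])
    fix p :: "'a \<Rightarrow> real" assume p: "submult_seminorm p"
    note cp = submult_seminormD(1)[OF p]
    obtain M where M: "M > 0" "\<And>t. t \<in> {0..1} \<Longrightarrow> p (\<gamma> t) \<le> M"
      using lip_curve_bounded[OF \<gamma> cp] by metis
    have "p (- (\<gamma> t * x)) \<le> M * p x" if "t \<in> {0..1}" for t x
      using submult_seminormD(2)[OF p, of "\<gamma> t" x] mult_right_mono[OF M(2)[OF that], of "p x"]
        cseminormD(1)[OF cp, of x] by (simp add: cseminormD(6)[OF cp])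
    with M(1) show "\<exists>\<rho>>0. \<forall>t\<in>{0..1}. \<forall>x. p (- (\<gamma> t * x)) \<le> \<rho> * p x" by blast
  qed (auto simp: distrib_left lip)
  then show ?thesis by auto
qed

text \<open>The constant depends on \<gamma> only through a bound of \<open>p (\<gamma> t)\<close>,
  so it is uniform for nearby coefficients. Uniqueness, continuity and differentiability of the
  evolution all rest on this.\<close>

lemma right_ode_estimate:
  fixes u \<gamma> g :: "real \<Rightarrow> 'a"
  assumes p: "submult_seminorm p"
    and u: "\<And>t. t \<in> {0..1} \<Longrightarrow> has_curve_deriv u (u t * \<gamma> t + g t) t"
    and \<gamma>: "\<And>t. t \<in> {0..1} \<Longrightarrow> p (\<gamma> t) \<le> \<rho>" and g: "\<And>t. t \<in> {0..1} \<Longrightarrow> p (g t) \<le> K"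
    and "\<rho> > 0" "t \<in> {0..1}"
  shows "p (u t) \<le> 2 * exp (2 * \<rho>) * (p (u 0) + K)"
proof (rule seminorm_gronwall[OF submult_seminormD(1)[OF p] u])
  note cp = submult_seminormD(1)[OF p]
  fix t :: real assume t: "t \<in> {0..1}"
  have "p (u t * \<gamma> t + g t) \<le> p (u t * \<gamma> t) + p (g t)" by (rule cseminormD(2)[OF cp])
  also have "p (u t * \<gamma> t) \<le> p (u t) * p (\<gamma> t)" by (rule submult_seminormD(2)[OF p])
  also have "\<dots> \<le> p (u t) * \<rho>" using \<gamma>[OF t] cseminormD(1)[OF cp] by (intro mult_left_mono)
  finally show "p (u t * \<gamma> t + g t) \<le> \<rho> * p (u t) + K" using g[OF t] by (simp add: mult.commute)
next
  show "K \<ge> 0" using g[of 0] cseminormD(1)[OF submult_seminormD(1)[OF p], of "g 0"] by simp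
qed (use assms in auto)

lemma right_ode_unique:
  fixes u v \<gamma> g :: "real \<Rightarrow> 'a"
  assumes \<gamma>: "lip_curve \<gamma>"
    and u: "\<And>t. t \<in> {0..1} \<Longrightarrow> has_curve_deriv u (u t * \<gamma> t + g t) t"
    and v: "\<And>t. t \<in> {0..1} \<Longrightarrow> has_curve_deriv v (v t * \<gamma> t + g t) t"
    and "u 0 = v 0" "t \<in> {0..1}"
  shows "u t = v t"
proof (rule eq_if_submult_zero)
  fix p :: "'a \<Rightarrow> real" assume p: "submult_seminorm p"
  note cp = submult_seminormD(1)[OF p]
  obtain M where M: "M > 0" "\<And>t. t \<in> {0..1} \<Longrightarrow> p (\<gamma> t) \<le> M"
    using lip_curve_bounded[OF \<gamma> cp] by metis
  have "has_curve_deriv (\<lambda>t. u t - v t) ((u t - v t) * \<gamma> t + 0) t" if "t \<in> {0..1}" for t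
    using has_curve_deriv_diff[OF u[OF that] v[OF that]] by (simp add: algebra_simps)
  from right_ode_estimate[OF p this M(2), of 0] M(1) assms(4,5)
  show "p (u t - v t) \<le> 0" by (simp add: cseminormD(5)[OF cp])
qed

text \<open>The inverse is the solution of the adjoint equation; both products solve linear equations
  that are also solved by the constant \<open>1\<close>.\<close>

lemma evolution_invertible:
  fixes \<eta> \<gamma> :: "real \<Rightarrow> 'a"
  assumes \<gamma>: "lip_curve \<gamma>"
    and \<eta>: "\<And>t. t \<in> {0..1} \<Longrightarrow> has_curve_deriv \<eta> (\<eta> t * \<gamma> t) t" and "\<eta> 0 = 1" and t: "t \<in> {0..1}"
  shows "\<exists>z. \<eta> t * z = 1 \<and> z * \<eta> t = 1"
proof -
  obtain \<zeta> where \<zeta>: "\<zeta> 0 = 1" "\<And>t. t \<in> {0..1} \<Longrightarrow> has_curve_deriv \<zeta> (- (\<gamma> t * \<zeta> t)) t"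
    using left_ode_solution_exists[OF \<gamma>] by blast
  have d1: "has_curve_deriv (\<lambda>s. \<eta> s * \<zeta> s - 1) 0 s" if "s \<in> {0..1}" for s
    using has_curve_deriv_diff[OF has_curve_deriv_mult[OF \<eta>[OF that] \<zeta>(2)[OF that]] has_curve_deriv_const[of 1]]
    by (simp add: mult.assoc)
  \<comment> \<open>In this order the product rule leaves a commutator with \<gamma> instead of
    zero, so a Gronwall argument with the constant \<open>2 * M\<close> replaces the constancy used
    for \<open>\<eta> * \<zeta>\<close>.\<close>
  have d2: "has_curve_deriv (\<lambda>s. \<zeta> s * \<eta> s - 1) ((\<zeta> s * \<eta> s - 1) * \<gamma> s - \<gamma> s * (\<zeta> s * \<eta> s - 1)) s"
    if "s \<in> {0..1}" for s
    using has_curve_deriv_diff[OF has_curve_deriv_mult[OF \<zeta>(2)[OF that] \<eta>[OF that]] has_curve_deriv_const[of 1]]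
    by (simp add: algebra_simps)
  have "\<eta> t * \<zeta> t = 1"
  proof (rule eq_if_submult_zero)
    fix p :: "'a \<Rightarrow> real" assume p: "submult_seminorm p"
    note cp = submult_seminormD(1)[OF p]
    have "p ((\<eta> t * \<zeta> t - 1) - (\<eta> 0 * \<zeta> 0 - 1)) \<le> 0 * \<bar>t - 0\<bar>"
      by (rule seminorm_mean_value_bound[OF cp d1]) (use t in \<open>auto simp: cseminormD(5)[OF cp]\<close>)
    then show "p (\<eta> t * \<zeta> t - 1) \<le> 0" using \<open>\<eta> 0 = 1\<close> \<zeta>(1) by simp
  qed
  moreover have "\<zeta> t * \<eta> t = 1"
  proof (rule eq_if_submult_zero)
    fix p :: "'a \<Rightarrow> real" assume p: "submult_seminorm p"
    note cp = submult_seminormD(1)[OF p]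
    obtain M where M: "M > 0" "\<And>t. t \<in> {0..1} \<Longrightarrow> p (\<gamma> t) \<le> M"
      using lip_curve_bounded[OF \<gamma> cp] by metis
    have "p (\<zeta> t * \<eta> t - 1) \<le> 2 * exp (2 * (2 * M)) * (p (\<zeta> 0 * \<eta> 0 - 1) + 0)"
    proof (rule seminorm_gronwall[OF cp d2])
      fix s :: real assume s: "s \<in> {0..1}"
      let ?w = "\<zeta> s * \<eta> s - 1"
      have "p (?w * \<gamma> s - \<gamma> s * ?w) \<le> p (?w * \<gamma> s) + p (\<gamma> s * ?w)" by (rule cseminormD(7)[OF cp])
      also have "p (?w * \<gamma> s) \<le> p ?w * p (\<gamma> s)" by (rule submult_seminormD(2)[OF p])
      also have "p (\<gamma> s * ?w) \<le> p (\<gamma> s) * p ?w" by (rule submult_seminormD(2)[OF p])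
      finally have "p (?w * \<gamma> s - \<gamma> s * ?w) \<le> 2 * (p (\<gamma> s) * p ?w)" by (simp add: mult.commute)
      also have "\<dots> \<le> 2 * (M * p ?w)" using M(2)[OF s] cseminormD(1)[OF cp] by (intro mult_left_mono mult_right_mono) auto
      finally show "p (?w * \<gamma> s - \<gamma> s * ?w) \<le> (2 * M) * p ?w + 0" by simp
    qed (use M(1) t in auto)
    then show "p (\<zeta> t * \<eta> t - 1) \<le> 0" using \<open>\<eta> 0 = 1\<close> \<zeta>(1) by (simp add: cseminormD(5)[OF cp])
  qed
  ultimately show ?thesis by blast
qed

end

section \<open>Smoothness and the Lie group structure\<close>

lemma has_dir_deriv_unique:
  fixes f :: "'e::real_vector \<Rightarrow> 'b::{real_vector,t2_space}"
  assumes "has_dir_deriv f x y v"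
  shows "dir_deriv f x y = v"
  unfolding dir_deriv_def
  by (rule the_equality) (use assms tendsto_unique[OF trivial_limit_at] in \<open>auto simp: has_dir_deriv_def\<close>)

lemma has_dir_deriv_cong:
  assumes "has_dir_deriv f x y v" "f x = g x"
    and "eventually (\<lambda>t. f (x + t *\<^sub>R y) = g (x + t *\<^sub>R y)) (at 0)"
  shows "has_dir_deriv g x y v"
proof -
  have "eventually (\<lambda>t. (f (x + t *\<^sub>R y) - f x) /\<^sub>R t = (g (x + t *\<^sub>R y) - g x) /\<^sub>R t) (at 0)"
    using assms(3) by eventually_elim (use assms(2) in simp)
  then show ?thesis using assms(1) unfolding has_dir_deriv_def by (rule Lim_transform_eventually[rotated])
qed

lemma has_dir_deriv_const: "has_dir_deriv (\<lambda>_. c) x y (0::'b::{real_vector,topological_space})"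
  by (simp add: has_dir_deriv_def)

lemma has_dir_deriv_add:
  fixes f g :: "'e::real_vector \<Rightarrow> 'b::locally_convex_space"
  assumes "has_dir_deriv f x y v" "has_dir_deriv g x y w"
  shows "has_dir_deriv (\<lambda>x. f x + g x) x y (v + w)"
  using tendsto_add[OF assms[unfolded has_dir_deriv_def]]
  by (simp add: has_dir_deriv_def algebra_simps)

lemma has_dir_deriv_uminus:
  fixes f :: "'e::real_vector \<Rightarrow> 'b::locally_convex_space"
  assumes "has_dir_deriv f x y v"
  shows "has_dir_deriv (\<lambda>x. - f x) x y (- v)"
  using tendsto_minus[OF assms[unfolded has_dir_deriv_def]]
  by (simp add: has_dir_deriv_def algebra_simps)

lemma has_dir_deriv_sum_list:
  fixes f :: "'i \<Rightarrow> 'e::real_vector \<Rightarrow> 'b::locally_convex_space"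
  assumes "\<And>w. has_dir_deriv (f w) x y (v w)"
  shows "has_dir_deriv (\<lambda>x. \<Sum>w\<leftarrow>L. f w x) x y (\<Sum>w\<leftarrow>L. v w)"
  by (induction L) (auto intro: has_dir_deriv_const has_dir_deriv_add assms)

lemma has_dir_deriv_tendsto:
  fixes f :: "'e::real_vector \<Rightarrow> 'b::locally_convex_space"
  assumes "has_dir_deriv f x y v"
  shows "((\<lambda>t. f (x + t *\<^sub>R y)) \<longlongrightarrow> f x) (at 0)"
proof -
  have "((\<lambda>t. f x + t *\<^sub>R ((f (x + t *\<^sub>R y) - f x) /\<^sub>R t)) \<longlongrightarrow> f x + 0 *\<^sub>R v) (at 0)"
    using assms unfolding has_dir_deriv_def
    by (intro tendsto_add tendsto_scaleR_lcs tendsto_const tendsto_ident_at)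
  moreover have "eventually (\<lambda>t. f x + t *\<^sub>R ((f (x + t *\<^sub>R y) - f x) /\<^sub>R t) = f (x + t *\<^sub>R y)) (at 0)"
    by (simp add: eventually_at_filter)
  ultimately show ?thesis by (auto dest: Lim_transform_eventually)
qed

lemma has_dir_deriv_mult:
  fixes f g :: "'e::real_vector \<Rightarrow> 'b::locally_convex_algebra"
  assumes "has_dir_deriv f x y v" "has_dir_deriv g x y w"
  shows "has_dir_deriv (\<lambda>x. f x * g x) x y (v * g x + f x * w)"
proof -
  have "((\<lambda>t. ((f (x + t *\<^sub>R y) - f x) /\<^sub>R t) * g (x + t *\<^sub>R y) + f x * ((g (x + t *\<^sub>R y) - g x) /\<^sub>R t))
      \<longlongrightarrow> v * g x + f x * w) (at 0)"
    using assms has_dir_deriv_tendsto[OF assms(2)] unfolding has_dir_deriv_def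
    by (intro tendsto_add tendsto_mult tendsto_const)
  moreover have "((f (x + t *\<^sub>R y) - f x) /\<^sub>R t) * g (x + t *\<^sub>R y) + f x * ((g (x + t *\<^sub>R y) - g x) /\<^sub>R t)
      = (f (x + t *\<^sub>R y) * g (x + t *\<^sub>R y) - f x * g x) /\<^sub>R t" for t
    by (simp add: algebra_simps)
  ultimately show ?thesis by (simp add: has_dir_deriv_def)
qed

lemma has_dir_deriv_linear:
  fixes f :: "'e::real_vector \<Rightarrow> 'b::{real_vector,topological_space}"
  assumes "linear f"
  shows "has_dir_deriv f x y (f y)"
proof -
  have "(f (x + t *\<^sub>R y) - f x) /\<^sub>R t = f y" if "t \<noteq> 0" for t
    using that by (simp add: linear_add[OF assms] linear_scale[OF assms])
  then have "eventually (\<lambda>t. f y = (f (x + t *\<^sub>R y) - f x) /\<^sub>R t) (at 0)"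
    by (simp add: eventually_at_filter)
  then show ?thesis unfolding has_dir_deriv_def by (rule Lim_transform_eventually[OF tendsto_const])
qed

lemma eventually_in_open_along_line:
  fixes x :: "'a::locally_convex_space"
  assumes "open U" "x \<in> U"
  shows "eventually (\<lambda>t. x + t *\<^sub>R y \<in> U) (at 0)"
proof -
  have "((\<lambda>t. x + t *\<^sub>R y) \<longlongrightarrow> x + 0 *\<^sub>R y) (at 0)"
    by (intro tendsto_add tendsto_scaleR_lcs tendsto_const tendsto_ident_at)
  then show ?thesis using assms by (auto dest: topological_tendstoD)
qed

text \<open>In the three cases needed (multiplication, inversion and the evolution map), the higher
  derivatives are sums of multilinear \<open>words\<close>, and differentiating a word in direction \<open>z\<close> amounts to
  inserting the letter \<open>z\<close> at all possible places.\<close>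

fun inserts :: "'e \<Rightarrow> 'e list \<Rightarrow> 'e list list"
  where
    "inserts z [] = [[z]]"
  | "inserts z (y # ys) = (z # y # ys) # map ((#) y) (inserts z ys)"

fun all_inserts :: "'e list \<Rightarrow> 'e list list \<Rightarrow> 'e list list"
  where
    "all_inserts [] L = L"
  | "all_inserts (y # ys) L = all_inserts ys (concat (map (inserts y) L))"

lemma inserts_map: "inserts (f z) (map f ys) = map (map f) (inserts z ys)"
  by (induction ys) auto

text \<open>Insertion is natural in the letters: words in the directions are images of words in the
  indices \<open>[0..<k]\<close>. Continuity then concerns a finite list of index words fixed by
  \<open>k\<close>.\<close>

lemma all_inserts_map: "all_inserts (map f ys) (map (map f) L) = map (map f) (all_inserts ys L)"
proof (induction ys arbitrary: L)
  case (Cons y ys)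
  have "concat (map (inserts (f y)) (map (map f) L)) = map (map f) (concat (map (inserts y) L))"
    by (induction L) (auto simp: inserts_map)
  with Cons.IH show ?case by (simp only: list.map all_inserts.simps)
qed simp

lemma set_inserts: "w \<in> set (inserts z ys) \<Longrightarrow> set w = insert z (set ys)"
  by (induction ys arbitrary: w) auto

lemma length_inserts: "w \<in> set (inserts z ys) \<Longrightarrow> length w = Suc (length ys)"
  by (induction ys arbitrary: w) auto

lemma set_all_inserts:
  assumes "\<And>w. w \<in> set L \<Longrightarrow> set w \<subseteq> A" "set ys \<subseteq> A" "w \<in> set (all_inserts ys L)"
  shows "set w \<subseteq> A"
  using assms
proof (induction ys arbitrary: L)
  case (Cons y ys)
  show ?case
    by (rule Cons.IH[of "concat (map (inserts y) L)"]) (use Cons.prems set_inserts in fastforce)+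
qed auto

lemma sum_list_map_concat:
  fixes g :: "'i \<Rightarrow> 'b::monoid_add"
  shows "sum_list (map g (concat (map h L))) = (\<Sum>w\<leftarrow>L. \<Sum>v\<leftarrow>h w. g v)"
  by (induction L) auto

text \<open>Finite sums of words are stable under differentiation, so the induction over
  \<open>ys\<close> generalises \<open>h\<close> and \<open>L\<close>. Openness of \<open>U\<close>
  enters along lines, through \<open>near\<close>; this form applies to product spaces and to
  \<open>smooth_curve\<close>, which are not instances of \<open>locally_convex_space\<close>
  here.\<close>

lemma iter_dir_deriv_insertions:
  fixes F :: "'e::real_vector \<Rightarrow> 'e list \<Rightarrow> 'b::locally_convex_space"
  assumes near: "\<And>x z. x \<in> U \<Longrightarrow> eventually (\<lambda>t. x + t *\<^sub>R z \<in> U) (at 0)"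
    and deriv: "\<And>x z w. x \<in> U \<Longrightarrow> has_dir_deriv (\<lambda>x. F x w) x z (\<Sum>w'\<leftarrow>inserts z w. F x w')"
    and h: "\<And>x. x \<in> U \<Longrightarrow> h x = (\<Sum>w\<leftarrow>L. F x w)" and x: "x \<in> U"
  shows "iter_dir_deriv h ys x = (\<Sum>w\<leftarrow>all_inserts ys L. F x w)"
    and "\<exists>v. has_dir_deriv (iter_dir_deriv h ys) x z v"
proof -
  have "(\<forall>x\<in>U. iter_dir_deriv h ys x = (\<Sum>w\<leftarrow>all_inserts ys L. F x w)) \<and>
      (\<forall>x\<in>U. \<forall>z. \<exists>v. has_dir_deriv (iter_dir_deriv h ys) x z v)"
    using h
  proof (induction ys arbitrary: h L)
    case (Nil h L)
    have D: "has_dir_deriv h x z (\<Sum>w\<leftarrow>L. \<Sum>w'\<leftarrow>inserts z w. F x w')" if "x \<in> U" for x z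
      by (rule has_dir_deriv_cong[OF has_dir_deriv_sum_list[where f = "\<lambda>w x. F x w", OF deriv[OF that]]])
        (use Nil that near[OF that, of z] in \<open>auto elim: eventually_mono\<close>)
    with Nil show ?case by auto
  next
    case (Cons y ys h L)
    have D: "has_dir_deriv h x z (\<Sum>w\<leftarrow>L. \<Sum>w'\<leftarrow>inserts z w. F x w')" if "x \<in> U" for x z
      by (rule has_dir_deriv_cong[OF has_dir_deriv_sum_list[where f = "\<lambda>w x. F x w", OF deriv[OF that]]])
        (use Cons.prems that near[OF that, of z] in \<open>auto elim: eventually_mono\<close>)
    have "dir_deriv h x y = (\<Sum>w\<leftarrow>concat (map (inserts y) L). F x w)" if "x \<in> U" for x
      using has_dir_deriv_unique[OF D[OF that, of y]] by (simp add: sum_list_map_concat)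
    from Cons.IH[of "\<lambda>x. dir_deriv h x y", OF this] show ?case by simp
  qed
  with x show "iter_dir_deriv h ys x = (\<Sum>w\<leftarrow>all_inserts ys L. F x w)"
    "\<exists>v. has_dir_deriv (iter_dir_deriv h ys) x z v" by auto
qed

text \<open>Passes from maps on abstract product topologies to limits along \<open>atin\<close>,
  where the limit rules of a topological algebra apply.\<close>

lemma continuous_map_euclidean_iff_tendsto:
  "continuous_map X euclidean f \<longleftrightarrow> (\<forall>x\<in>topspace X. (f \<longlongrightarrow> f x) (atin X x))"
  by (simp add: continuous_map_atin)

lemma smooth_map_on_insertions:
  fixes F :: "'e::{real_vector,topological_space} \<Rightarrow> 'e list \<Rightarrow> 'b::locally_convex_space"
  assumes near: "\<And>x z. x \<in> U \<Longrightarrow> eventually (\<lambda>t. x + t *\<^sub>R z \<in> U) (at 0)"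
    and deriv: "\<And>x z w. x \<in> U \<Longrightarrow> has_dir_deriv (\<lambda>x. F x w) x z (\<Sum>w'\<leftarrow>inserts z w. F x w')"
    and cont: "\<And>(k::nat) v. set v \<subseteq> {..<k} \<Longrightarrow> continuous_map
      (prod_topology (top_of_set U) (product_topology (\<lambda>_. euclidean) {..<k})) euclidean
      (\<lambda>(x, y). F x (map y v))"
    and h: "\<And>x. x \<in> U \<Longrightarrow> h x = F x []"
  shows "smooth_map_on U h"
  unfolding C_map_on_def
proof (intro conjI allI impI ballI)
  have h': "h x = (\<Sum>w\<leftarrow>[[]]. F x w)" if "x \<in> U" for x using h[OF that] by simp
  fix ys x z assume "x \<in> U"
  from iter_dir_deriv_insertions(2)[where F = F and U = U and L = "[[]]" and h = h, OF near deriv h' this]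
  show "\<exists>v. has_dir_deriv (iter_dir_deriv h ys) x z v" .
next
  have h': "h x = (\<Sum>w\<leftarrow>[[]]. F x w)" if "x \<in> U" for x using h[OF that] by simp
  fix k :: nat
  let ?X = "prod_topology (top_of_set U) (product_topology (\<lambda>_. euclidean :: 'e topology) {..<k})"
  have sub: "set v \<subseteq> {..<k}" if "v \<in> set (all_inserts [0..<k] [[]])" for v
    by (rule set_all_inserts[OF _ _ that]) auto
  have "continuous_map ?X euclidean (\<lambda>z. \<Sum>v\<leftarrow>L. (case z of (x, y) \<Rightarrow> F x (map y v)))"
    if "set L \<subseteq> set (all_inserts [0..<k] [[]])" for L
    using that
  proof (induction L)
    case (Cons v L)
    then have "continuous_map ?X euclidean (\<lambda>z. case z of (x, y) \<Rightarrow> F x (map y v))"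
      "continuous_map ?X euclidean (\<lambda>z. \<Sum>v\<leftarrow>L. (case z of (x, y) \<Rightarrow> F x (map y v)))"
      using cont[OF sub] by auto
    then show ?case
      unfolding continuous_map_euclidean_iff_tendsto list.map sum_list.Cons
      by (intro ballI tendsto_add) (elim bspec, assumption)+
  qed simp
  then have "continuous_map ?X euclidean
      (\<lambda>z. \<Sum>v\<leftarrow>all_inserts [0..<k] [[]]. (case z of (x, y) \<Rightarrow> F x (map y v)))"
    by blast
  moreover have "(\<Sum>v\<leftarrow>all_inserts [0..<k] [[]]. (case z of (x, y) \<Rightarrow> F x (map y v)))
      = (case z of (x, y) \<Rightarrow> iter_dir_deriv h (map y [0..<k]) x)" if "z \<in> topspace ?X" for z
  proof -
    obtain x y where z: "z = (x, y)" by (cases z)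
    with that have "x \<in> U" by simp
    from iter_dir_deriv_insertions(1)[where F = F and U = U and L = "[[]]" and h = h, OF near deriv h' this]
    have "iter_dir_deriv h (map y [0..<k]) x = (\<Sum>w\<leftarrow>all_inserts (map y [0..<k]) [[]]. F x w)" .
    then show ?thesis using all_inserts_map[of y "[0..<k]" "[[]]"] by (simp add: z o_def)
  qed
  ultimately show "continuous_map ?X euclidean (\<lambda>(x, y). iter_dir_deriv h (map y [0..<k]) x)"
    by (rule continuous_map_eq)
qed

lemma tendsto_fst_prod_topology:
  fixes S :: "'e::topological_space set"
  assumes z: "z \<in> topspace (prod_topology (top_of_set S) Y)"
  shows "(fst \<longlongrightarrow> fst z) (atin (prod_topology (top_of_set S) Y) z)"
proof -
  have "continuous_map (prod_topology (top_of_set S) Y) euclidean fst"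
    using continuous_map_fst continuous_map_into_fulltopology by blast
  with z show ?thesis unfolding continuous_map_euclidean_iff_tendsto by blast
qed

lemma tendsto_snd_component_prod_topology:
  fixes I :: "'i set"
  assumes z: "z \<in> topspace (prod_topology X (product_topology (\<lambda>_. euclidean :: 'e::topological_space topology) I))"
    and "i \<in> I"
  shows "((\<lambda>z. snd z i) \<longlongrightarrow> snd z i) (atin (prod_topology X (product_topology (\<lambda>_. euclidean) I)) z)"
proof -
  have "continuous_map (prod_topology X (product_topology (\<lambda>_. euclidean) I)) euclidean ((\<lambda>y. y i) \<circ> snd)"
    by (intro continuous_map_compose[OF continuous_map_snd] continuous_map_product_projection assms)
  with z show ?thesis unfolding continuous_map_euclidean_iff_tendsto o_def by blast
qed

text \<open>Bilinearity stops the words at length 2. The two-letter word is deliberately one-sided: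
  the insertions \<open>[z, v]\<close> and \<open>[v, z]\<close> contribute one summand each of the
  symmetric second derivative.\<close>

lemma smooth_map_on_multiplication:
  fixes V :: "'a::locally_convex_algebra set"
  assumes "open V"
  shows "smooth_map_on (V \<times> V) (\<lambda>(x, y). x * y)"
proof -
  define F :: "'a \<times> 'a \<Rightarrow> ('a \<times> 'a) list \<Rightarrow> 'a" where
    "F x w = (case w of [] \<Rightarrow> fst x * snd x | [v] \<Rightarrow> fst x * snd v + fst v * snd x
      | [v, v'] \<Rightarrow> fst v * snd v' | _ \<Rightarrow> 0)" for x w
  have F_simps: "F x [] = fst x * snd x" "F x [v] = fst x * snd v + fst v * snd x"
    "F x [v, v'] = fst v * snd v'" "F x (v # v' # v'' # w) = 0" for x v v' v'' w
    by (simp_all add: F_def)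
  have lin: "linear (fst :: 'a \<times> 'a \<Rightarrow> 'a)" "linear (snd :: 'a \<times> 'a \<Rightarrow> 'a)"
    by (simp_all add: linear_iff)
  show ?thesis
  proof (rule smooth_map_on_insertions[where F = F])
    fix x z :: "'a \<times> 'a" assume "x \<in> V \<times> V"
    then have "eventually (\<lambda>t. fst x + t *\<^sub>R fst z \<in> V) (at 0)" "eventually (\<lambda>t. snd x + t *\<^sub>R snd z \<in> V) (at 0)"
      using \<open>open V\<close> by (auto intro!: eventually_in_open_along_line)
    then show "eventually (\<lambda>t. x + t *\<^sub>R z \<in> V \<times> V) (at 0)"
      by eventually_elim (simp add: mem_Times_iff)
  next
    fix x z :: "'a \<times> 'a" and w :: "('a \<times> 'a) list"
    note d = has_dir_deriv_mult has_dir_deriv_add has_dir_deriv_linear[OF lin(1)]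
      has_dir_deriv_linear[OF lin(2)] has_dir_deriv_const
    consider "w = []" | v where "w = [v]" | v v' w' where "w = v # v' # w'"
      by (metis list.exhaust)
    then show "has_dir_deriv (\<lambda>x. F x w) x z (\<Sum>w'\<leftarrow>inserts z w. F x w')"
    proof cases
      case 1
      have "has_dir_deriv (\<lambda>x :: 'a \<times> 'a. fst x * snd x) x z (fst z * snd x + fst x * snd z)" by (intro d)
      then show ?thesis by (simp add: 1 F_simps add.commute)
    next
      case 2
      have "has_dir_deriv (\<lambda>x :: 'a \<times> 'a. fst x * snd v + fst v * snd x) x z
          ((fst z * snd v + fst x * 0) + (0 * snd x + fst v * snd z))" by (intro d)
      then show ?thesis by (simp add: 2 F_simps)
    next
      case 3
      have "F x u = 0" if "u \<in> set (inserts z w)" for u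
      proof -
        have "length u = Suc (Suc (Suc (length w')))" using length_inserts[OF that] by (simp add: 3)
        then show ?thesis by (auto simp: F_simps length_Suc_conv)
      qed
      then have "map (F x) (inserts z w) = map (\<lambda>_. 0) (inserts z w)" by (intro map_cong) auto
      then have "(\<Sum>u\<leftarrow>inserts z w. F x u) = 0" by (simp only: sum_list_0)
      moreover have "F y w = F x w" for y by (cases w') (simp_all add: 3 F_simps)
      then have "(\<lambda>y. F y w) = (\<lambda>_. F x w)" by blast
      ultimately show ?thesis using has_dir_deriv_const[of "F x w" x z] by (simp only:)
    qed
  next
    fix k :: nat and v :: "nat list" assume v: "set v \<subseteq> {..<k}"
    let ?X = "prod_topology (top_of_set (V \<times> V)) (product_topology (\<lambda>_. euclidean :: ('a \<times> 'a) topology) {..<k})"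
    show "continuous_map ?X euclidean (\<lambda>(x, y). F x (map y v))"
      unfolding continuous_map_euclidean_iff_tendsto
    proof
      fix z assume z: "z \<in> topspace ?X"
      note fst = tendsto_fst_prod_topology[OF z] and snd = tendsto_snd_component_prod_topology[OF z]
      consider "v = []" | i where "v = [i]" "i < k" | i j where "v = [i, j]" "i < k" "j < k"
        | i j l w where "v = i # j # l # w"
        using v by (metis insert_subset lessThan_iff list.exhaust list.set(2))
      then show "((\<lambda>(x, y). F x (map y v)) \<longlongrightarrow> (case z of (x, y) \<Rightarrow> F x (map y v))) (atin ?X z)"
      proof cases
        case 1
        then show ?thesis unfolding case_prod_beta by (simp add: F_simps) (intro tendsto_intros tendsto_mult fst)
      next
        case 2
        then show ?thesis unfolding case_prod_beta
          by (simp add: F_simps) (intro tendsto_intros tendsto_mult fst snd; simp)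
      next
        case 3
        then show ?thesis unfolding case_prod_beta
          by (simp add: F_simps) (intro tendsto_intros tendsto_mult snd; simp)
      next
        case 4
        then show ?thesis unfolding case_prod_beta by (simp add: F_simps)
      qed
    qed
  qed (auto simp: F_simps)
qed

section \<open>Units of the algebra and smoothness of inversion\<close>

lemma monoid_algebra_monoid: "Group.monoid (algebra_monoid :: 'a::monoid_mult monoid)"
  by (rule monoidI) (auto simp: algebra_monoid_def mult.assoc)

lemma algebra_monoid_simps [simp]:
  "carrier algebra_monoid = UNIV" "x \<otimes>\<^bsub>algebra_monoid\<^esub> y = x * y" "\<one>\<^bsub>algebra_monoid\<^esub> = 1"
  by (simp_all add: algebra_monoid_def)

lemma algebra_monoid_inverse:
  assumes "x \<in> Units (algebra_monoid :: 'a::monoid_mult monoid)"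
  shows "m_inv algebra_monoid x * x = 1" "x * m_inv algebra_monoid x = 1"
  using monoid.Units_l_inv[OF monoid_algebra_monoid assms] monoid.Units_r_inv[OF monoid_algebra_monoid assms]
  by simp_all

text \<open>The words are \<open>\<plusminus> x\<^sup>-\<^sup>1 y\<^sub>1 x\<^sup>-\<^sup>1 y\<^sub>2 x\<^sup>-\<^sup>1 \<dots> y\<^sub>k x\<^sup>-\<^sup>1\<close>.\<close>

context continuous_inverse_algebra
begin

abbreviation minv :: "'a \<Rightarrow> 'a"
  where "minv \<equiv> m_inv algebra_monoid"

fun inverse_word :: "'a \<Rightarrow> 'a list \<Rightarrow> 'a"
  where
    "inverse_word x [] = minv x"
  | "inverse_word x (y # ys) = - (minv x * y * inverse_word x ys)"

text \<open>The resolvent identity y^(-1) - x^(-1) = y^(-1) (x - y) x^(-1) with y = x + t z cancels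
  the division by t; continuity of inversion gives the limit.\<close>

lemma has_dir_deriv_minv:
  assumes x: "x \<in> Units (algebra_monoid :: 'a monoid)"
  shows "has_dir_deriv minv x z (- (minv x * z * minv x))"
proof -
  let ?U = "Units (algebra_monoid :: 'a monoid)"
  have near: "eventually (\<lambda>t. x + t *\<^sub>R z \<in> ?U) (at 0)"
    by (rule eventually_in_open_along_line[OF open_Units x])
  have "((\<lambda>t. x + t *\<^sub>R z) \<longlongrightarrow> x + 0 *\<^sub>R z) (at 0)"
    by (intro tendsto_add tendsto_scaleR_lcs tendsto_const tendsto_ident_at)
  then have "((\<lambda>t. minv (x + t *\<^sub>R z)) \<longlongrightarrow> minv x) (at 0)"
    using continuous_on_tendsto_compose[OF continuous_inverse _ x near] by simp
  then have "((\<lambda>t. - (minv (x + t *\<^sub>R z) * z * minv x)) \<longlongrightarrow> - (minv x * z * minv x)) (at 0)"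
    by (intro tendsto_minus tendsto_mult tendsto_const)
  moreover have "eventually (\<lambda>t. - (minv (x + t *\<^sub>R z) * z * minv x) = (minv (x + t *\<^sub>R z) - minv x) /\<^sub>R t) (at 0)"
  proof -
    have "- (minv (x + t *\<^sub>R z) * z * minv x) = (minv (x + t *\<^sub>R z) - minv x) /\<^sub>R t"
      if xt: "x + t *\<^sub>R z \<in> ?U" and "t \<noteq> 0" for t
    proof -
      let ?y = "minv (x + t *\<^sub>R z)"
      have "?y - minv x = ?y * (x - (x + t *\<^sub>R z)) * minv x"
        using algebra_monoid_inverse(2)[OF x] algebra_monoid_inverse(1)[OF xt]
        by (simp only: right_diff_distrib left_diff_distrib mult.assoc mult_1_right) (simp flip: mult.assoc)
      also have "\<dots> = t *\<^sub>R (- (?y * z * minv x))" by simp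
      finally show ?thesis using \<open>t \<noteq> 0\<close> by simp
    qed
    then show ?thesis using near by (simp add: eventually_at_filter) (auto elim: eventually_mono)
  qed
  ultimately show ?thesis unfolding has_dir_deriv_def by (rule Lim_transform_eventually)
qed

text \<open>Differentiating the leading inverse inserts \<open>z\<close> in front of
  \<open>y\<close>, with the sign of the new letter; differentiating the remaining word inserts
  \<open>z\<close> further back.\<close>

lemma has_dir_deriv_inverse_word:
  assumes x: "x \<in> Units (algebra_monoid :: 'a monoid)"
  shows "has_dir_deriv (\<lambda>x. inverse_word x w) x z (\<Sum>w'\<leftarrow>inserts z w. inverse_word x w')"
proof (induction w)
  case Nil
  then show ?case using has_dir_deriv_minv[OF x] by simp
next
  case (Cons y ys)
  have "has_dir_deriv (\<lambda>x. - (minv x * y * inverse_word x ys)) x z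
      (- ((- (minv x * z * minv x) * y + minv x * 0) * inverse_word x ys
        + minv x * y * (\<Sum>w'\<leftarrow>inserts z ys. inverse_word x w')))"
    by (intro has_dir_deriv_uminus has_dir_deriv_mult has_dir_deriv_minv x has_dir_deriv_const Cons.IH)
  moreover have "(\<Sum>w'\<leftarrow>L. - (minv x * y * inverse_word x w')) = - (minv x * y * (\<Sum>w'\<leftarrow>L. inverse_word x w'))" for L
    by (induction L) (simp_all add: distrib_left)
  ultimately show ?case by (simp add: o_def mult.assoc)
qed

lemma smooth_map_on_inversion:
  "smooth_map_on (Units (algebra_monoid :: 'a monoid)) (m_inv (units_of (algebra_monoid :: 'a monoid)))"
proof (rule smooth_map_on_insertions[where F = inverse_word])
  fix k :: nat and v :: "nat list" assume v: "set v \<subseteq> {..<k}"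
  let ?X = "prod_topology (top_of_set (Units (algebra_monoid :: 'a monoid)))
    (product_topology (\<lambda>_. euclidean :: 'a topology) {..<k})"
  show "continuous_map ?X euclidean (\<lambda>(x, y). inverse_word x (map y v))"
    unfolding continuous_map_euclidean_iff_tendsto case_prod_beta
  proof
    fix z assume z: "z \<in> topspace ?X"
    have "continuous_map ?X euclidean (minv \<circ> fst)"
      by (rule continuous_map_compose[OF continuous_map_fst])
        (use continuous_inverse in \<open>simp add: continuous_map_iff_continuous\<close>)
    then have inv: "((\<lambda>z. minv (fst z)) \<longlongrightarrow> minv (fst z)) (atin ?X z)"
      using z unfolding continuous_map_euclidean_iff_tendsto o_def by blast
    show "((\<lambda>z. inverse_word (fst z) (map (snd z) v)) \<longlongrightarrow> inverse_word (fst z) (map (snd z) v)) (atin ?X z)"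
      using v
    proof (induction v)
      case (Cons i v)
      then have "i \<in> {..<k}" by simp
      from tendsto_snd_component_prod_topology[OF z this] Cons inv show ?case
        unfolding list.map inverse_word.simps by (intro tendsto_minus tendsto_mult) auto
    qed (use inv in simp)
  qed
qed (auto intro: eventually_in_open_along_line open_Units has_dir_deriv_inverse_word
    simp: monoid.units_of_inv[OF monoid_algebra_monoid])

lemma open_lie_group_Units: "open_lie_group (units_of (algebra_monoid :: 'a monoid))"
  using smooth_map_on_multiplication[OF open_Units] smooth_map_on_inversion open_Units
    monoid.units_group[OF monoid_algebra_monoid]
  by (simp add: open_lie_group_def units_of_def)

end

section \<open>The evolution map\<close>

lemma curve_has_deriv:
  assumes "t \<in> {0..1}"
  shows "has_curve_deriv (curve \<gamma>) (curve_deriv (curve \<gamma>) t) t"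
proof -
  have "C_curve \<infinity> (curve \<gamma>)" using curve[of \<gamma>] by simp
  then have "\<exists>v. has_curve_deriv ((curve_deriv ^^ 0) (curve \<gamma>)) v t"
    using assms unfolding C_curve_def by (metis enat_ord_code(3))
  then obtain v where "has_curve_deriv (curve \<gamma>) v t" by auto
  then show ?thesis using curve_deriv_eqI[OF _ assms] by metis
qed

text \<open>The derivative is continuous on a compact interval, hence bounded in each seminorm; so
  smooth curves are admissible coefficients.\<close>

lemma lip_curve_curve: "lip_curve (curve \<gamma>)"
proof (rule lip_curve_if_bounded_deriv[OF curve_has_deriv])
  have "C_curve \<infinity> (curve \<gamma>)" using curve[of \<gamma>] by simp
  then have "continuous_on {0..1} ((curve_deriv ^^ 1) (curve \<gamma>))"
    unfolding C_curve_def by (metis enat_ord_code(3))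
  then show "\<exists>M. \<forall>t\<in>{0..1}. p (curve_deriv (curve \<gamma>) t) \<le> M" if "cseminorm p" for p
    using seminorm_bounded_if_continuous[OF _ that] by simp
qed

lemma seminorm_le_curve_seminorm:
  assumes "cseminorm p" "t \<in> {0..1}"
  shows "p (curve \<gamma> t) \<le> curve_seminorm 0 p \<gamma>"
proof -
  obtain M where "\<And>t. t \<in> {0..1} \<Longrightarrow> p (curve \<gamma> t) \<le> M"
    using lip_curve_bounded[OF lip_curve_curve assms(1)] by metis
  then have "p (curve \<gamma> t) \<le> (SUP t\<in>{0..1}. p (curve \<gamma> t))"
    using assms(2) by (intro cSUP_upper bdd_aboveI2)
  then show ?thesis by (simp add: curve_seminorm_def)
qed

lemma open_curve_seminorm_ball:
  fixes \<gamma> :: "'a::locally_convex_space smooth_curve"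
  assumes "cseminorm (p :: 'a \<Rightarrow> real)" "e > 0"
  shows "open {\<delta>. curve_seminorm k p (\<delta> - \<gamma>) < e}"
  unfolding open_smooth_curve_def using assms by (intro generate_topology.Basis) blast

context mackey_lmc_algebra
begin

section \<open>Uniform convergence and dependence of solutions on their data\<close>

lemma tendsto_submultI:
  fixes f :: "'i \<Rightarrow> 'a"
  assumes "\<And>p e. submult_seminorm p \<Longrightarrow> e > 0 \<Longrightarrow> eventually (\<lambda>i. p (f i - l) \<le> e) F"
  shows "(f \<longlongrightarrow> l) F"
proof (rule tendsto_cseminormI)
  fix p :: "'a \<Rightarrow> real" and e :: real assume "cseminorm p" "e > 0"
  then obtain P where P: "submult_seminorm P" "\<And>x. p x \<le> P x" using dominating by blast
  have "eventually (\<lambda>i. P (f i - l) \<le> e / 2) F" using P(1) \<open>e > 0\<close> by (intro assms) auto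
  then show "eventually (\<lambda>i. p (f i - l) < e) F"
  proof eventually_elim
    case (elim i)
    with P(2)[of "f i - l"] \<open>e > 0\<close> show ?case by linarith
  qed
qed

text \<open>The filter is arbitrary because it will be \<open>at 0\<close> for difference quotients
  and \<open>atin\<close> of a product topology for continuity.\<close>

definition unif_conv :: "('i \<Rightarrow> real \<Rightarrow> 'a) \<Rightarrow> (real \<Rightarrow> 'a) \<Rightarrow> 'i filter \<Rightarrow> bool"
  where "unif_conv f l F \<longleftrightarrow>
    (\<forall>p e. submult_seminorm p \<longrightarrow> e > 0 \<longrightarrow> eventually (\<lambda>i. \<forall>t\<in>{0..1}. p (f i t - l t) \<le> e) F)"

lemma unif_convI:
  assumes "\<And>p e. submult_seminorm p \<Longrightarrow> e > 0 \<Longrightarrow> eventually (\<lambda>i. \<forall>t\<in>{0..1}. p (f i t - l t) \<le> e) F"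
  shows "unif_conv f l F"
  using assms by (simp add: unif_conv_def)

lemma unif_convD:
  assumes "unif_conv f l F" "submult_seminorm p" "e > 0"
  shows "eventually (\<lambda>i. \<forall>t\<in>{0..1}. p (f i t - l t) \<le> e) F"
  using assms by (simp add: unif_conv_def)

lemma unif_conv_const: "unif_conv (\<lambda>_. l) l F"
  by (auto simp: unif_conv_def cseminormD(5)[OF submult_seminormD(1)])

lemma unif_conv_add:
  assumes "unif_conv f l F" "unif_conv g m F"
  shows "unif_conv (\<lambda>i t. f i t + g i t) (\<lambda>t. l t + m t) F"
proof (rule unif_convI)
  fix p :: "'a \<Rightarrow> real" and e :: real assume p: "submult_seminorm p" and "e > 0"
  then have "e / 2 > 0" by simp
  with p have "eventually (\<lambda>i. \<forall>t\<in>{0..1}. p (f i t - l t) \<le> e / 2) F"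
    "eventually (\<lambda>i. \<forall>t\<in>{0..1}. p (g i t - m t) \<le> e / 2) F"
    using unif_convD[OF assms(1)] unif_convD[OF assms(2)] by blast+
  then show "eventually (\<lambda>i. \<forall>t\<in>{0..1}. p (f i t + g i t - (l t + m t)) \<le> e) F"
  proof eventually_elim
    case (elim i)
    show ?case
    proof
      fix t :: real assume "t \<in> {0..1}"
      with elim have "p (f i t - l t) \<le> e / 2" "p (g i t - m t) \<le> e / 2" by auto
      then show "p (f i t + g i t - (l t + m t)) \<le> e"
        using cseminormD(2)[OF submult_seminormD(1)[OF p], of "f i t - l t" "g i t - m t"]
        by (simp add: algebra_simps)
    qed
  qed
qed

lemma unif_conv_mult:
  assumes f: "unif_conv f l F" and g: "unif_conv g m F" and lip: "lip_curve l" "lip_curve m"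
  shows "unif_conv (\<lambda>i t. f i t * g i t) (\<lambda>t. l t * m t) F"
proof (rule unif_convI)
  fix p :: "'a \<Rightarrow> real" and e :: real assume p: "submult_seminorm p" and "e > 0"
  note cp = submult_seminormD(1)[OF p]
  obtain M where M: "M > 0" "\<And>t. t \<in> {0..1} \<Longrightarrow> p (l t) \<le> M" using lip_curve_bounded[OF lip(1) cp] by metis
  obtain N where N: "N > 0" "\<And>t. t \<in> {0..1} \<Longrightarrow> p (m t) \<le> N" using lip_curve_bounded[OF lip(2) cp] by metis
  \<comment> \<open>\<open>d \<le> 1\<close> bounds the product of the two errors by
    \<open>d\<close>; together with the two mixed terms this gives
    \<open>d * (1 + M + N)\<close>.\<close>
  define d where "d = min 1 (e / (1 + M + N))"
  have d: "d > 0" "d \<le> 1" using M(1) N(1) \<open>e > 0\<close> by (auto simp: d_def)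
  have "d \<le> e / (1 + M + N)" by (simp add: d_def)
  then have de: "d * (1 + M + N) \<le> e" using M(1) N(1) by (simp add: pos_le_divide_eq)
  have "eventually (\<lambda>i. \<forall>t\<in>{0..1}. p (f i t - l t) \<le> d) F" "eventually (\<lambda>i. \<forall>t\<in>{0..1}. p (g i t - m t) \<le> d) F"
    using unif_convD[OF f p d(1)] unif_convD[OF g p d(1)] .
  then show "eventually (\<lambda>i. \<forall>t\<in>{0..1}. p (f i t * g i t - l t * m t) \<le> e) F"
  proof eventually_elim
    case (elim i)
    show ?case
    proof
      fix t :: real assume t: "t \<in> {0..1}"
      let ?a = "f i t - l t" and ?b = "g i t - m t"
      have ab: "p ?a \<le> d" "p ?b \<le> d" using elim t by auto
      have "f i t * g i t - l t * m t = ?a * ?b + (?a * m t + l t * ?b)" by (simp add: algebra_simps)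
      then have "p (f i t * g i t - l t * m t) \<le> p (?a * ?b) + p (?a * m t + l t * ?b)"
        using cseminormD(2)[OF cp] by metis
      also have "p (?a * m t + l t * ?b) \<le> p (?a * m t) + p (l t * ?b)" by (rule cseminormD(2)[OF cp])
      also have "p (?a * ?b) \<le> p ?a * p ?b" by (rule submult_seminormD(2)[OF p])
      also have "p ?a * p ?b \<le> d * 1" using ab d by (intro mult_mono) (auto simp: cseminormD(1)[OF cp])
      also have "p (?a * m t) \<le> p ?a * p (m t)" by (rule submult_seminormD(2)[OF p])
      also have "p ?a * p (m t) \<le> d * N" using ab d N(2)[OF t] by (intro mult_mono) (auto simp: cseminormD(1)[OF cp])
      also have "p (l t * ?b) \<le> p (l t) * p ?b" by (rule submult_seminormD(2)[OF p])
      also have "p (l t) * p ?b \<le> M * d" using ab M(1) M(2)[OF t] by (intro mult_mono) (auto simp: cseminormD(1)[OF cp])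
      finally show "p (f i t * g i t - l t * m t) \<le> e" using de by (simp add: algebra_simps)
    qed
  qed
qed

text \<open>The difference \<open>d = u i - u\<close> solves \<open>d' = d \<gamma> i + u (\<gamma> i - \<gamma>) + (g i - g)\<close>.\<close>

lemma unif_conv_right_ode:
  assumes \<gamma>: "unif_conv \<gamma>i \<gamma> F" and g: "unif_conv gi g F" and lip: "lip_curve \<gamma>" "lip_curve u"
    and u: "\<And>t. t \<in> {0..1} \<Longrightarrow> has_curve_deriv u (u t * \<gamma> t + g t) t"
    and ui: "eventually (\<lambda>i. ui i 0 = u 0 \<and>
      (\<forall>t\<in>{0..1}. has_curve_deriv (ui i) (ui i t * \<gamma>i i t + gi i t) t)) F"
  shows "unif_conv ui u F"
proof (rule unif_convI)
  fix p :: "'a \<Rightarrow> real" and e :: real assume p: "submult_seminorm p" and "e > 0"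
  note cp = submult_seminormD(1)[OF p]
  obtain M where M: "M > 0" "\<And>t. t \<in> {0..1} \<Longrightarrow> p (\<gamma> t) \<le> M" using lip_curve_bounded[OF lip(1) cp] by metis
  obtain N where N: "N > 0" "\<And>t. t \<in> {0..1} \<Longrightarrow> p (u t) \<le> N" using lip_curve_bounded[OF lip(2) cp] by metis
  \<comment> \<open>\<open>M + 1\<close> bounds the perturbed coefficient once it is within 1 of
    \<gamma>, and \<open>(N + 1) * d\<close> bounds the source term; \<open>C\<close> collects the
    resulting Gronwall factor.\<close>
  define C where "C = 2 * exp (2 * (M + 1)) * (N + 1)"
  have C: "C > 0" using N(1) by (simp add: C_def)
  define d where "d = min 1 (e / C)"
  have d: "d > 0" "d \<le> 1" using C \<open>e > 0\<close> by (auto simp: d_def)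
  have "d \<le> e / C" by (simp add: d_def)
  then have de: "C * d \<le> e" using C by (simp add: pos_le_divide_eq mult.commute)
  have "eventually (\<lambda>i. \<forall>t\<in>{0..1}. p (\<gamma>i i t - \<gamma> t) \<le> d) F" "eventually (\<lambda>i. \<forall>t\<in>{0..1}. p (gi i t - g t) \<le> d) F"
    using unif_convD[OF \<gamma> p d(1)] unif_convD[OF g p d(1)] .
  with ui show "eventually (\<lambda>i. \<forall>t\<in>{0..1}. p (ui i t - u t) \<le> e) F"
  proof eventually_elim
    case (elim i)
    let ?g = "\<lambda>t. u t * (\<gamma>i i t - \<gamma> t) + (gi i t - g t)"
    have deriv: "has_curve_deriv (\<lambda>t. ui i t - u t) ((ui i t - u t) * \<gamma>i i t + ?g t) t" if "t \<in> {0..1}" for t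
    proof -
      have "has_curve_deriv (\<lambda>t. ui i t - u t) ((ui i t * \<gamma>i i t + gi i t) - (u t * \<gamma> t + g t)) t"
        using elim(1) that by (intro has_curve_deriv_diff u) auto
      then show ?thesis by (simp add: algebra_simps)
    qed
    have \<gamma>b: "p (\<gamma>i i t) \<le> M + 1" if t: "t \<in> {0..1}" for t
    proof -
      have "p (\<gamma>i i t) \<le> p (\<gamma>i i t - \<gamma> t) + p (\<gamma> t)"
        using cseminormD(2)[OF cp, of "\<gamma>i i t - \<gamma> t" "\<gamma> t"] by simp
      moreover have "p (\<gamma>i i t - \<gamma> t) \<le> 1" using elim(2) t d(2) by force
      ultimately show ?thesis using M(2)[OF t] by linarith
    qed
    have gb: "p (?g t) \<le> (N + 1) * d" if t: "t \<in> {0..1}" for t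
    proof -
      have "p (?g t) \<le> p (u t * (\<gamma>i i t - \<gamma> t)) + p (gi i t - g t)" by (rule cseminormD(2)[OF cp])
      also have "p (u t * (\<gamma>i i t - \<gamma> t)) \<le> p (u t) * p (\<gamma>i i t - \<gamma> t)" by (rule submult_seminormD(2)[OF p])
      also have "\<dots> \<le> N * d" using N t elim(2) by (intro mult_mono) (auto simp: cseminormD(1)[OF cp])
      finally show ?thesis using elim(3) t by (force simp: algebra_simps)
    qed
    show ?case
    proof
      fix t :: real assume t: "t \<in> {0..1}"
      have "p (ui i t - u t) \<le> 2 * exp (2 * (M + 1)) * (p (ui i 0 - u 0) + (N + 1) * d)"
        by (rule right_ode_estimate[OF p deriv \<gamma>b gb _ t]) (use M(1) in auto)
      also have "\<dots> = C * d" using elim(1) by (simp add: C_def cseminormD(5)[OF cp])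
      finally show "p (ui i t - u t) \<le> e" using de by linarith
    qed
  qed
qed

text \<open>For Lipschitz data the choice is determined on [0,1] by
  \<open>right_ode_unique\<close>.\<close>

definition right_ode_solution :: "'a \<Rightarrow> (real \<Rightarrow> 'a) \<Rightarrow> (real \<Rightarrow> 'a) \<Rightarrow> real \<Rightarrow> 'a"
  where "right_ode_solution c \<gamma> g =
    (SOME u. u 0 = c \<and> (\<forall>t\<in>{0..1}. has_curve_deriv u (u t * \<gamma> t + g t) t) \<and> lip_curve u)"

lemma right_ode_solution:
  assumes "lip_curve \<gamma>" "lip_curve g"
  shows "right_ode_solution c \<gamma> g 0 = c"
    and "t \<in> {0..1} \<Longrightarrow>
      has_curve_deriv (right_ode_solution c \<gamma> g) (right_ode_solution c \<gamma> g t * \<gamma> t + g t) t"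
    and "lip_curve (right_ode_solution c \<gamma> g)"
  using someI_ex[OF right_ode_solution_exists[OF assms, of c]]
  unfolding right_ode_solution_def by auto

text \<open>The empty word is the evolution \<eta> of \<gamma>. By variation of constants a longer
  word at time t is the integral over s from 0 to t of
  \<open>evol_word \<gamma> ys s * curve y s\<close> times \<eta>(s)^(-1) \<eta>(t). So a word is an
  iterated integral whose first letter acts at the latest time.\<close>

fun evol_word :: "'a smooth_curve \<Rightarrow> 'a smooth_curve list \<Rightarrow> real \<Rightarrow> 'a"
  where
    "evol_word \<gamma> [] = right_ode_solution 1 (curve \<gamma>) (\<lambda>_. 0)"
  | "evol_word \<gamma> (y # ys) = right_ode_solution 0 (curve \<gamma>) (\<lambda>t. evol_word \<gamma> ys t * curve y t)"

lemma lip_evol_word: "lip_curve (evol_word \<gamma> w)"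
  by (induction w) (auto intro!: right_ode_solution(3) lip_curve_curve lip_curve_const lip_curve_mult)

lemma evol_word_deriv:
  assumes "t \<in> {0..1}"
  shows "has_curve_deriv (evol_word \<gamma> []) (evol_word \<gamma> [] t * curve \<gamma> t) t"
    and "has_curve_deriv (evol_word \<gamma> (y # ys)) (evol_word \<gamma> (y # ys) t * curve \<gamma> t + evol_word \<gamma> ys t * curve y t) t"
  using right_ode_solution(2)[OF lip_curve_curve lip_curve_const assms, of 1 \<gamma> 0]
    right_ode_solution(2)[OF lip_curve_curve lip_curve_mult[OF lip_evol_word lip_curve_curve] assms, of 0 \<gamma> \<gamma> ys y]
  by simp_all

lemma evol_word_0: "evol_word \<gamma> [] 0 = 1" "evol_word \<gamma> (y # ys) 0 = 0"
  using right_ode_solution(1)[OF lip_curve_curve lip_curve_const, of 1 \<gamma> 0]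
    right_ode_solution(1)[OF lip_curve_curve lip_curve_mult[OF lip_evol_word lip_curve_curve], of 0 \<gamma> \<gamma> ys y]
  by simp_all

text \<open>Induction along the word: the source of each equation is the preceding word times a
  letter, and \<open>unif_conv_right_ode\<close> passes convergence of the source on to the
  solution.\<close>

lemma unif_conv_evol_word:
  assumes \<gamma>: "unif_conv (\<lambda>i. curve (\<gamma>i i)) (curve \<gamma>) F"
    and y: "\<And>j. j \<in> set v \<Longrightarrow> unif_conv (\<lambda>i. curve (yi i j)) (curve (y j)) F"
  shows "unif_conv (\<lambda>i. evol_word (\<gamma>i i) (map (yi i) v)) (evol_word \<gamma> (map y v)) F"
  using y
proof (induction v)
  case Nil
  show ?case
    by (rule unif_conv_right_ode[OF \<gamma> unif_conv_const[of "\<lambda>_. 0"] lip_curve_curve lip_evol_word])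
      (use evol_word_deriv(1) in \<open>simp_all add: evol_word_0 del: evol_word.simps\<close>)
next
  case (Cons j v)
  have "unif_conv (\<lambda>i t. evol_word (\<gamma>i i) (map (yi i) v) t * curve (yi i j) t)
      (\<lambda>t. evol_word \<gamma> (map y v) t * curve (y j) t) F"
    using Cons by (intro unif_conv_mult lip_evol_word lip_curve_curve) auto
  from unif_conv_right_ode[OF \<gamma> this lip_curve_curve lip_evol_word] show ?case
    by (simp add: evol_word_0 evol_word_deriv(2) del: evol_word.simps)
qed

text \<open>Estimated directly, since \<open>smooth_curve\<close> is set up as a vector space with a
  topology but without continuity of its vector operations.\<close>

lemma unif_conv_line: "unif_conv (\<lambda>h. curve (\<gamma> + h *\<^sub>R z)) (curve \<gamma>) (at 0)"
proof (rule unif_convI)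
  fix p :: "'a \<Rightarrow> real" and e :: real assume p: "submult_seminorm p" and "e > 0"
  note cp = submult_seminormD(1)[OF p]
  obtain M where M: "M > 0" "\<And>t. t \<in> {0..1} \<Longrightarrow> p (curve z t) \<le> M"
    using lip_curve_bounded[OF lip_curve_curve cp] by metis
  have "p (curve (\<gamma> + h *\<^sub>R z) t - curve \<gamma> t) \<le> e" if "\<bar>h\<bar> < e / M" "t \<in> {0..1}" for h t
  proof -
    have "\<bar>h\<bar> * p (curve z t) \<le> e / M * M"
      using that M by (intro mult_mono) (auto simp: cseminormD(1)[OF cp])
    then show ?thesis using M(1) by (simp add: curve_add curve_scaleR cseminormD(3)[OF cp])
  qed
  moreover have "e / M > 0" using M(1) \<open>e > 0\<close> by simp
  ultimately show "eventually (\<lambda>h. \<forall>t\<in>{0..1}. p (curve (\<gamma> + h *\<^sub>R z) t - curve \<gamma> t) \<le> e) (at 0)"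
    unfolding eventually_at by (auto simp: dist_real_def intro!: exI[of _ "e / M"])
qed

text \<open>By linearity, words with a common first letter combine into one equation whose source is
  the sum of their tails.\<close>

lemma evol_word_sum_deriv:
  assumes "t \<in> {0..1}"
  shows "has_curve_deriv (\<lambda>t. \<Sum>w\<leftarrow>L. evol_word \<gamma> (y # w) t)
    ((\<Sum>w\<leftarrow>L. evol_word \<gamma> (y # w) t) * curve \<gamma> t + (\<Sum>w\<leftarrow>L. evol_word \<gamma> w t) * curve y t) t"
proof (induction L)
  case (Cons w L)
  from has_curve_deriv_add[OF evol_word_deriv(2)[OF assms, of \<gamma> y w] this]
  show ?case by (simp add: algebra_simps del: evol_word.simps)
qed (simp add: has_curve_deriv_const)

text \<open>The difference quotient \<open>D h\<close> of \<open>evol_word\<close> solves an equation with the fixed coefficient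
  \<open>\<gamma>\<close>, because \<open>u h * (\<gamma> + h z) - u * \<gamma> = (u h - u) * \<gamma> + h (u h * z)\<close>.\<close>

lemma evol_word_difference_quotient:
  "unif_conv (\<lambda>h t. (evol_word (\<gamma> + h *\<^sub>R z) w t - evol_word \<gamma> w t) /\<^sub>R h)
    (\<lambda>t. \<Sum>w'\<leftarrow>inserts z w. evol_word \<gamma> w' t) (at 0)"
proof (induction w)
  have conv: "unif_conv (\<lambda>h t. evol_word (\<gamma> + h *\<^sub>R z) w t * curve z t) (\<lambda>t. evol_word \<gamma> w t * curve z t) (at 0)" for w
    using unif_conv_evol_word[OF unif_conv_line[of \<gamma> z], of w "\<lambda>_ j. j" "\<lambda>j. j"]
    by (intro unif_conv_mult unif_conv_const lip_evol_word lip_curve_curve) (simp add: unif_conv_const)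
  {
    case Nil
    have "unif_conv (\<lambda>h t. (evol_word (\<gamma> + h *\<^sub>R z) [] t - evol_word \<gamma> [] t) /\<^sub>R h) (evol_word \<gamma> [z]) (at 0)"
    proof (rule unif_conv_right_ode[OF unif_conv_const conv[of "[]"] lip_curve_curve lip_evol_word evol_word_deriv(2)])
      have "has_curve_deriv (\<lambda>t. (evol_word (\<gamma> + h *\<^sub>R z) [] t - evol_word \<gamma> [] t) /\<^sub>R h)
          ((evol_word (\<gamma> + h *\<^sub>R z) [] t - evol_word \<gamma> [] t) /\<^sub>R h * curve \<gamma> t
            + evol_word (\<gamma> + h *\<^sub>R z) [] t * curve z t) t"
        if "h \<noteq> 0" "t \<in> {0..1}" for h t
        using has_curve_deriv_scaleR[OF has_curve_deriv_diff[OF evol_word_deriv(1) evol_word_deriv(1)], OF that(2,2), of "inverse h" "\<gamma> + h *\<^sub>R z" \<gamma>] that(1)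
        by (simp add: curve_add curve_scaleR algebra_simps del: evol_word.simps)
      then show "eventually (\<lambda>h. (evol_word (\<gamma> + h *\<^sub>R z) [] 0 - evol_word \<gamma> [] 0) /\<^sub>R h = evol_word \<gamma> [z] 0 \<and>
          (\<forall>t\<in>{0..1}. has_curve_deriv (\<lambda>t. (evol_word (\<gamma> + h *\<^sub>R z) [] t - evol_word \<gamma> [] t) /\<^sub>R h)
            ((evol_word (\<gamma> + h *\<^sub>R z) [] t - evol_word \<gamma> [] t) /\<^sub>R h * curve \<gamma> t
              + evol_word (\<gamma> + h *\<^sub>R z) [] t * curve z t) t)) (at 0)"
        by (simp add: eventually_at_filter evol_word_0 del: evol_word.simps)
    qed
    then show ?case by (simp del: evol_word.simps)
  next
    case (Cons y ys)
    let ?D = "\<lambda>w h t. (evol_word (\<gamma> + h *\<^sub>R z) w t - evol_word \<gamma> w t) /\<^sub>R h"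
    let ?S = "\<lambda>t. \<Sum>w'\<leftarrow>inserts z ys. evol_word \<gamma> w' t"
    let ?T = "\<lambda>t. \<Sum>w'\<leftarrow>inserts z ys. evol_word \<gamma> (y # w') t"
    have lipS: "lip_curve (\<lambda>t. \<Sum>w\<leftarrow>L. evol_word \<gamma> w t)" for L
      by (induction L) (simp_all add: lip_curve_const lip_curve_add lip_evol_word)
    \<comment> \<open>The source of the equation for the quotient has two parts. The perturbed
      coefficient produces the word with \<open>z\<close> inserted in front of \<open>y\<close>; the
      quotient of the tail, known by induction, produces the insertions behind
      \<open>y\<close>.\<close>
    have "unif_conv (?D (y # ys)) (\<lambda>t. evol_word \<gamma> (z # y # ys) t + ?T t) (at 0)"
    proof (rule unif_conv_right_ode[OF unif_conv_const _ lip_curve_curve])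
      show "unif_conv (\<lambda>h t. evol_word (\<gamma> + h *\<^sub>R z) (y # ys) t * curve z t + ?D ys h t * curve y t)
          (\<lambda>t. evol_word \<gamma> (y # ys) t * curve z t + ?S t * curve y t) (at 0)"
        by (intro unif_conv_add conv unif_conv_mult[OF Cons.IH unif_conv_const lipS lip_curve_curve])
      show "lip_curve (\<lambda>t. evol_word \<gamma> (z # y # ys) t + ?T t)"
        using lip_curve_add[OF lip_evol_word lipS[of "map ((#) y) (inserts z ys)"], of \<gamma> "z # y # ys"]
        by (simp add: o_def del: evol_word.simps)
      show "has_curve_deriv (\<lambda>t. evol_word \<gamma> (z # y # ys) t + ?T t)
          ((evol_word \<gamma> (z # y # ys) t + ?T t) * curve \<gamma> t + (evol_word \<gamma> (y # ys) t * curve z t + ?S t * curve y t)) t"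
        if "t \<in> {0..1}" for t
        using has_curve_deriv_add[OF evol_word_deriv(2)[OF that, of \<gamma> z "y # ys"] evol_word_sum_deriv[OF that, of \<gamma> y "inserts z ys"]]
        by (simp add: algebra_simps del: evol_word.simps)
      have T0: "(\<Sum>w'\<leftarrow>L. evol_word \<gamma> (y # w') 0) = 0" for L
        by (induction L) (simp_all add: evol_word_0 del: evol_word.simps)
      have "has_curve_deriv (?D (y # ys) h)
          (?D (y # ys) h t * curve \<gamma> t + (evol_word (\<gamma> + h *\<^sub>R z) (y # ys) t * curve z t + ?D ys h t * curve y t)) t"
        if "h \<noteq> 0" "t \<in> {0..1}" for h t
        using has_curve_deriv_scaleR[OF has_curve_deriv_diff[OF evol_word_deriv(2) evol_word_deriv(2)], OF that(2,2), of "inverse h" "\<gamma> + h *\<^sub>R z" y ys \<gamma> y ys] that(1)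
        by (simp add: curve_add curve_scaleR algebra_simps del: evol_word.simps)
      then show "eventually (\<lambda>h. ?D (y # ys) h 0 = evol_word \<gamma> (z # y # ys) 0 + ?T 0 \<and>
          (\<forall>t\<in>{0..1}. has_curve_deriv (?D (y # ys) h) (?D (y # ys) h t * curve \<gamma> t
            + (evol_word (\<gamma> + h *\<^sub>R z) (y # ys) t * curve z t + ?D ys h t * curve y t)) t)) (at 0)"
        by (simp add: eventually_at_filter evol_word_0 T0 del: evol_word.simps)
    qed
    then show ?case by (simp add: o_def del: evol_word.simps)
  }
qed

lemma has_dir_deriv_evol_word:
  "has_dir_deriv (\<lambda>\<gamma>. evol_word \<gamma> w 1) \<gamma> z (\<Sum>w'\<leftarrow>inserts z w. evol_word \<gamma> w' 1)"
  unfolding has_dir_deriv_def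
proof (rule tendsto_submultI)
  fix p :: "'a \<Rightarrow> real" and e :: real assume "submult_seminorm p" "e > 0"
  from unif_convD[OF evol_word_difference_quotient[of \<gamma> z w] this]
  show "eventually (\<lambda>h. p ((evol_word (\<gamma> + h *\<^sub>R z) w 1 - evol_word \<gamma> w 1) /\<^sub>R h
      - (\<Sum>w'\<leftarrow>inserts z w. evol_word \<gamma> w' 1)) \<le> e) (at 0)"
    by (rule eventually_mono) simp
qed

lemma unif_conv_curve:
  assumes "(\<gamma>i \<longlongrightarrow> \<gamma>) F"
  shows "unif_conv (\<lambda>i. curve (\<gamma>i i)) (curve \<gamma>) F"
proof (rule unif_convI)
  fix p :: "'a \<Rightarrow> real" and e :: real assume "submult_seminorm p" and "e > 0"
  then have p: "cseminorm p" by (simp add: submult_seminormD)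
  have "curve_seminorm 0 p (\<gamma> - \<gamma>) = 0"
    by (simp add: curve_seminorm_def curve_zero cseminormD(5)[OF p])
  then have "\<gamma> \<in> {\<delta>. curve_seminorm 0 p (\<delta> - \<gamma>) < e}" using \<open>e > 0\<close> by simp
  from topological_tendstoD[OF assms open_curve_seminorm_ball[OF p \<open>e > 0\<close>] this]
  show "eventually (\<lambda>i. \<forall>t\<in>{0..1}. p (curve (\<gamma>i i) t - curve \<gamma> t) \<le> e) F"
  proof eventually_elim
    case (elim i)
    show ?case
    proof
      fix t :: real assume "t \<in> {0..1}"
      from seminorm_le_curve_seminorm[OF p this, of "\<gamma>i i - \<gamma>"] elim
      show "p (curve (\<gamma>i i) t - curve \<gamma> t) \<le> e" by (simp add: curve_diff)
    qed
  qed
qed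

section \<open>Identification of the evolution and its smoothness\<close>

lemma left_translate_Units:
  "left_translate (units_of (algebra_monoid :: 'a monoid)) g v = g * v"
proof -
  have "linear (\<lambda>x. g * x)" by (simp add: linear_iff distrib_left)
  from has_dir_deriv_unique[OF has_dir_deriv_linear[OF this]] show ?thesis
    by (simp add: left_translate_def units_of_def)
qed

lemma is_evolution_evol_word:
  "is_evolution (units_of (algebra_monoid :: 'a monoid)) (curve \<gamma>) (evol_word \<gamma> [])"
proof -
  let ?\<eta> = "evol_word \<gamma> []"
  have deriv: "has_curve_deriv ?\<eta> (?\<eta> t * curve \<gamma> t) t" if "t \<in> {0..1}" for t
    by (rule evol_word_deriv(1)[OF that])
  have cd: "curve_deriv ?\<eta> t = ?\<eta> t * curve \<gamma> t" if "t \<in> {0..1}" for t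
    by (rule curve_deriv_eqI[OF deriv[OF that] that])
  have c0: "continuous_on {0..1} ?\<eta>" by (rule continuous_on_if_has_curve_deriv[OF deriv])
  have "continuous_on {0..1} (curve \<gamma>)" by (rule continuous_on_if_has_curve_deriv[OF curve_has_deriv])
  with c0 have "continuous_on {0..1} (\<lambda>t. ?\<eta> t * curve \<gamma> t)"
    unfolding continuous_on_def by (auto intro: tendsto_mult)
  then have c1: "continuous_on {0..1} (curve_deriv ?\<eta>)" by (rule continuous_on_eq) (simp add: cd del: evol_word.simps)
  have "C_curve 1 ?\<eta>"
    unfolding C_curve_def
  proof (intro conjI allI impI ballI)
    fix j t assume "enat (Suc j) \<le> 1" "t \<in> {0..1::real}"
    then have "j = 0" by (simp add: one_enat_def)
    with deriv[OF \<open>t \<in> {0..1}\<close>] show "\<exists>v. has_curve_deriv ((curve_deriv ^^ j) ?\<eta>) v t" by auto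
  next
    fix j assume "enat j \<le> 1"
    then have "j = 0 \<or> j = 1" by (auto simp: one_enat_def)
    with c0 c1 show "continuous_on {0..1} ((curve_deriv ^^ j) ?\<eta>)" by auto
  qed
  moreover have "?\<eta> t \<in> Units algebra_monoid" if "t \<in> {0..1}" for t
    using evolution_invertible[OF lip_curve_curve deriv evol_word_0(1) that] by (auto simp: Units_def)
  ultimately show ?thesis
    using evol_word_0(1)[of \<gamma>] by (auto simp: is_evolution_def left_translate_Units cd units_of_carrier units_of_one
      simp del: evol_word.simps)
qed

text \<open>Every evolution is a solution of the right equation, so uniqueness on [0,1] makes the
  description in \<open>evol\<close> well defined.\<close>

lemma evol_eq_evol_word: "evol (units_of (algebra_monoid :: 'a monoid)) \<gamma> = evol_word \<gamma> [] 1"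
  unfolding evol_def
proof (rule the_equality)
  show "\<exists>\<eta>. is_evolution (units_of algebra_monoid) (curve \<gamma>) \<eta> \<and> \<eta> 1 = evol_word \<gamma> [] 1"
    using is_evolution_evol_word by blast
next
  fix g assume "\<exists>\<eta>. is_evolution (units_of algebra_monoid) (curve \<gamma>) \<eta> \<and> \<eta> 1 = g"
  then obtain \<eta> where \<eta>: "is_evolution (units_of algebra_monoid) (curve \<gamma>) \<eta>" "\<eta> 1 = g" by blast
  have "has_curve_deriv \<eta> (\<eta> t * curve \<gamma> t + 0) t" if "t \<in> {0..1}" for t
  proof -
    have "C_curve 1 \<eta>" using \<eta>(1) by (simp add: is_evolution_def)
    then have "\<exists>v. has_curve_deriv ((curve_deriv ^^ 0) \<eta>) v t"
      using that unfolding C_curve_def by (metis One_nat_def one_enat_def order_refl)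
    then obtain v where v: "has_curve_deriv \<eta> v t" by auto
    with \<eta>(1) that curve_deriv_eqI[OF v that] show ?thesis
      by (simp add: is_evolution_def left_translate_Units)
  qed
  moreover have "has_curve_deriv (evol_word \<gamma> []) (evol_word \<gamma> [] t * curve \<gamma> t + 0) t" if "t \<in> {0..1}" for t
    using evol_word_deriv(1)[OF that] by (simp del: evol_word.simps)
  moreover have "\<eta> 0 = evol_word \<gamma> [] 0"
    using \<eta>(1) evol_word_0(1)[of \<gamma>] by (simp add: is_evolution_def units_of_def)
  ultimately have "\<eta> 1 = evol_word \<gamma> [] 1"
    by (rule right_ode_unique[where g = "\<lambda>_. 0", OF lip_curve_curve]) (simp_all del: evol_word.simps)
  with \<eta>(2) show "g = evol_word \<gamma> [] 1" by simp
qed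

lemma smooth_evol: "smooth_map_on UNIV (evol (units_of (algebra_monoid :: 'a monoid)))"
proof (rule smooth_map_on_insertions[where F = "\<lambda>\<gamma> w. evol_word \<gamma> w 1"])
  fix k :: nat and v :: "nat list" assume v: "set v \<subseteq> {..<k}"
  let ?X = "prod_topology (top_of_set UNIV) (product_topology (\<lambda>_. euclidean :: 'a smooth_curve topology) {..<k})"
  show "continuous_map ?X euclidean (\<lambda>(\<gamma>, y). evol_word \<gamma> (map y v) 1)"
    unfolding continuous_map_euclidean_iff_tendsto case_prod_beta
  proof
    fix x :: "'a smooth_curve \<times> (nat \<Rightarrow> 'a smooth_curve)" assume x: "x \<in> topspace ?X"
    have conv: "unif_conv (\<lambda>z. evol_word (fst z) (map (snd z) v)) (evol_word (fst x) (map (snd x) v)) (atin ?X x)"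
      using v by (intro unif_conv_evol_word unif_conv_curve tendsto_fst_prod_topology[OF x]
          tendsto_snd_component_prod_topology[OF x]) auto
    show "((\<lambda>z. evol_word (fst z) (map (snd z) v) 1) \<longlongrightarrow> evol_word (fst x) (map (snd x) v) 1) (atin ?X x)"
    proof (rule tendsto_submultI)
      fix p :: "'a \<Rightarrow> real" and e :: real assume "submult_seminorm p" "e > 0"
      from unif_convD[OF conv this]
      show "eventually (\<lambda>z. p (evol_word (fst z) (map (snd z) v) 1 - evol_word (fst x) (map (snd x) v) 1) \<le> e) (atin ?X x)"
        by (rule eventually_mono) simp
    qed
  qed
qed (simp_all add: has_dir_deriv_evol_word evol_eq_evol_word del: evol_word.simps)

end

lemma (in continuous_inverse_algebra) dominating_submult_seminorm_if_summable:
  assumes "\<And>p. continuous_seminorm smul p \<Longrightarrow>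
      \<exists>q r. continuous_seminorm smul q \<and> r > 0 \<and>
        (\<Sum>n. ennreal (r ^ Suc n) * mult_norm (Suc n) p q) < \<infinity>"
    and "cseminorm (p :: 'a \<Rightarrow> real)"
  shows "\<exists>P. submult_seminorm P \<and> (\<forall>x. p x \<le> P x)"
proof -
  obtain p' where p': "continuous_seminorm smul p'" "\<And>x. p x \<le> p' x"
    using dominating_scale_seminorm[OF assms(2)] by blast
  obtain q r where qr: "continuous_seminorm smul q" "r > 0"
    "(\<Sum>n. ennreal (r ^ Suc n) * mult_norm (Suc n) p' q) < \<infinity>"
    using assms(1)[OF p'(1)] by blast
  note cs = cseminorm_if_scale_seminorm[OF p'(1)] cseminorm_if_scale_seminorm[OF qr(1)]
  obtain C where C: "\<And>xs. p' (prod_list xs) \<le> C * prod_list (map (\<lambda>x. q x / r) xs)"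
    using mult_norm_homogeneous[OF cs qr(2,3)] by blast
  \<comment> \<open>The radius \<open>r\<close> is absorbed into the seminorm, which brings the
    product bound into the form of \<open>dominating_submult_seminorm\<close> with
    \<open>Q = q / r\<close>.\<close>
  have "cseminorm (\<lambda>x. q x / r)"
  proof (rule cseminormI)
    show "open {x. q x < 1}" by (rule open_Collect_less[OF cseminormD(4)[OF cs(2)] continuous_on_const])
    show "q (x + y) / r \<le> q x / r + q y / r" for x y
      using cseminormD(2)[OF cs(2), of x y] qr(2) by (simp add: add_divide_distrib[symmetric] divide_right_mono)
    show "x \<in> {x. q x < 1} \<Longrightarrow> q x / r \<le> 1 / r" for x using qr(2) by (simp add: divide_right_mono)
  qed (use qr(2) in \<open>auto simp: cseminormD[OF cs(2)]\<close>)
  from dominating_submult_seminorm[OF cs(1) this C] obtain P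
    where "submult_seminorm P" "\<And>x. p' x \<le> P x" by blast
  with p'(2) show ?thesis using order_trans by blast
qed

theorem mainTheorem1:
  fixes smul :: "'k::real_or_complex \<Rightarrow> 'a::locally_convex_algebra \<Rightarrow> 'a"
  assumes "continuous_inverse_algebra smul"
    and "mackey_complete TYPE('a)"
    and "\<And>p. continuous_seminorm smul p \<Longrightarrow>
      \<exists>q r. continuous_seminorm smul q \<and> r > 0 \<and>
        (\<Sum>n. ennreal (r ^ Suc n) * mult_norm (Suc n) p q) < \<infinity>"
  shows "regular_lie_group (units_of (algebra_monoid :: 'a monoid))"
proof -
  interpret continuous_inverse_algebra smul by fact
  interpret mackey_lmc_algebra "TYPE('a)"
    using assms(2) dominating_submult_seminorm_if_summable[OF assms(3)] by unfold_locales
  show ?thesis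
    using open_lie_group_Units is_evolution_evol_word smooth_evol
    unfolding regular_lie_group_def by blast
qed

end
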